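(* For $\lambda>0$ let $g_\lambda$, $E_{\mathsf m,\lambda}$, $\mathsf h_{\mathsf m,\lambda}$, $\mathcal Z_\lambda(T)$ be as in the context, and let $\bar Z^\lambda_{\tau\in[0,T]}$ be the Bernstein process associated (in the sense of the context) with the probability measure $\bar\mu$ on $\mathcal B_d\times\mathcal B_d$ with joint density $$\bar\mu(\mathsf x,\mathsf y)=\mathcal Z_\lambda^{-1}(T)\,g_\lambda(\mathsf x,T,\mathsf y)\,\delta(\mathsf x-\mathsf y).$$ For every $\lambda>0$ the process $\bar Z^\lambda_{\tau\in[0,T]}$ is a stationary, non-Markovian Gaussian process such that the following statements are valid. (a) We have $$\mathbb P_{\bar\mu}\left(\bar Z^\lambda_t\in F\right)=(2\pi\sigma_\lambda)^{-\frac d2}\int_F d\mathsf x\exp\left[-\frac{|\mathsf x|^2}{2\sigma_\lambda}\right]$$ for each $t\in[0,T]$ and every $F\in\mathcal B_d$, where $$\sigma_\lambda=\frac{\sinh(\lambda T)}{2\lambda(\cosh(\lambda T)-1)} .$$ (b) The components of $\bar Z^\lambda_{\tau\in[0,T]}$ satisfy $$\mathbb E_{\bar\mu}\left(\bar Z^{\lambda,i}_s\bar Z^{\lambda,j}_t\right)=\frac{\cosh\left(\lambda\left(|t-s|-\frac T2\right)\right)}{2\lambda\sinh\left(\frac{\lambda T}2\right)}\,\delta_{i,j}$$ for all $s,t\in[0,T]$ and all $i,j\in\{1,\dots,d\}$. (c) For every linear bounded self-adjoint multiplication operator $B$ on $L^2(\mathbb R^d)$, $Bf=bf$ with $b\in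 L^\infty(\mathbb R^d)$ real-valued, we have $$\operatorname{Tr}\left(\mathcal R_\lambda B\right)=\mathbb E_{\bar\mu}\left(b(\bar Z^\lambda_t)\right)=(2\pi\sigma_\lambda)^{-\frac d2}\int_{\mathbb R^d}d\mathsf x\,b(\mathsf x)\exp\left[-\frac{|\mathsf x|^2}{2\sigma_\lambda}\right]$$ for every $t\in[0,T]$, where $$\mathcal R_\lambda f:=\mathcal Z_\lambda^{-1}(T)\sum_{\mathsf m\in\mathbb N^d}\exp[-TE_{\mathsf m,\lambda}]\left(f,\mathsf h_{\mathsf m,\lambda}\right)_2\mathsf h_{\mathsf m,\lambda}.$$
   Context: Fix $d\in\mathbb N^+$ and $T\in(0,+\infty)$; $\mathcal B_d$ is the Borel $\sigma$-algebra of $\mathbb R^d$; $\mathbb N=\{0,1,2,\dots\}$; $\delta$ is the Dirac measure, $\delta_{i,j}$ the Kronecker symbol; $(\cdot,\cdot)_2$ is the inner product of $L^2(\mathbb R^d)$, linear in the first argument. For $\lambda>0$, the eigenvalues of $-\frac12\Delta_{\mathsf x}+\frac{\lambda^2}2|\mathsf x|^2$ on $L^2(\mathbb R^d)$ are $E_{\mathsf m,\lambda}=\left(\sum_{j=1}^dm_j+\frac d2\right)\lambda$, $\mathsf m\in\mathbb N^d$, with orthonormal eigenfunctions $\mathsf h_{\mathsf m,\lambda}(\mathsf x)=\prod_{j=1}^dh_{m_j,\lambda}(x_j)$, where $h_{m,\lambda}(x)=\lambda^{1/4}h_m(\sqrt\lambda x)$ and $h_m(x)=(-1)^m(\pi^{1/2}2^mm!)^{-1/2}e^{x^2/2}\frac{d^m}{dx^m}e^{-x^2}$.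 Also $\mathcal Z_\lambda(T)=\sum_{\mathsf m\in\mathbb N^d}\exp[-TE_{\mathsf m,\lambda}]=(2(\cosh(\lambda T)-1))^{-d/2}$. Green's function (Mehler's kernel) is $$g_\lambda(\mathsf x,t,\mathsf y)=\left(\frac{2\pi\sinh(\lambda t)}\lambda\right)^{-\frac d2}\exp\left[-\frac{\lambda\left(\cosh(\lambda t)(|\mathsf x|^2+|\mathsf y|^2)-2(\mathsf x,\mathsf y)_{\mathbb R^d}\right)}{2\sinh(\lambda t)}\right],\quad t\in(0,T].$$ (The measure $\bar\mu$ arises as $\sum_{\mathsf m}p_{\mathsf m}\mu_{\mathsf m}$ with $p_{\mathsf m}=\mathcal Z_\lambda^{-1}(T)\exp[-TE_{\mathsf m,\lambda}]$ and $\mu_{\mathsf m}(\mathsf x,\mathsf y)=\mathsf h_{\mathsf m,\lambda}(\mathsf x)g_\lambda(\mathsf x,T,\mathsf y)\exp[TE_{\mathsf m,\lambda}]\mathsf h_{\mathsf m,\lambda}(\mathsf y)$.) Bernstein process: an $\mathbb R^d$-valued process $Z_{\tau\in[0,T]}$ on a complete probability space $(\Omega,\mathcal F,\mathbb P)$ such that $\mathbb E(b(Z_r)\mid\mathcal F_s^+\vee\mathcal F_t^-)=\mathbb E(b(Z_r)\mid Z_s,Z_t)$ $\mathbb P$-a.e. for every bounded Borel $b:\mathbb R^d\to\mathbb C$ and all $r\in(s,t)\subset[0,T]$, where $\mathcal F_s^+=\sigma\{Z_\tau^{-1}(F):\tau\le s,F\in\mathcal B_d\}$ and $\mathcal F_t^-=\sigma\{Z_\tau^{-1}(F):\tau\ge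 t,F\in\mathcal B_d\}$. Given a probability measure $\mu$ on $\mathcal B_d\times\mathcal B_d$, the Bernstein process associated with $\mu$ is the Bernstein process on a probability space $(\Omega,\mathcal F,\mathbb P_\mu)$ whose law is determined by $$\mathbb P_\mu(Z_0\in F_0,Z_{t_1}\in F_1,\dots,Z_{t_n}\in F_n,Z_T\in F_T)=\int_{F_0\times F_T}\frac{d\mu(\mathsf x,\mathsf y)}{g_\lambda(\mathsf x,T,\mathsf y)}\int_{F_1}d\mathsf x_1\cdots\int_{F_n}d\mathsf x_n\prod_{k=1}^n g_\lambda(\mathsf x_k,t_k-t_{k-1},\mathsf x_{k-1})\,g_\lambda(\mathsf y,T-t_n,\mathsf x_n)$$ for all Borel $F_0,\dots,F_n,F_T$ and $t_0=0<t_1<\dots<t_n<T$, with $\mathsf x_0=\mathsf x$. $\mathbb E_\mu$ is expectation under $\mathbb P_\mu$. A process is stationary if its finite-dimensional distributions are invariant under time translations (within the time interval). *)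

theory Defs
  imports "HOL-Probability.Probability"
begin

section \<open>The harmonic oscillator\<close>

definition hermite_fun :: "nat \<Rightarrow> real \<Rightarrow> real" where
  "hermite_fun m x = (-1) ^ m * (sqrt pi * 2 ^ m * fact m) powr (-1/2)
     * exp (x\<^sup>2 / 2) * (deriv ^^ m) (\<lambda>u. exp (- u\<^sup>2)) x"

definition hermite_fun_scaled :: "real \<Rightarrow> nat \<Rightarrow> real \<Rightarrow> real" where
  "hermite_fun_scaled lam m x = lam powr (1/4) * hermite_fun m (sqrt lam * x)"

definition osc_eigenfun :: "real \<Rightarrow> nat ^ 'd \<Rightarrow> real ^ 'd::finite \<Rightarrow> real" where
  "osc_eigenfun lam m x = (\<Prod>j\<in>UNIV. hermite_fun_scaled lam (m $ j) (x $ j))"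

definition osc_energy :: "real \<Rightarrow> nat ^ 'd::finite \<Rightarrow> real" where
  "osc_energy lam m = ((\<Sum>j\<in>UNIV. real (m $ j)) + real CARD('d) / 2) * lam"

definition partition_fun :: "'d::finite itself \<Rightarrow> real \<Rightarrow> real \<Rightarrow> real" where
  "partition_fun _ lam T = (\<Sum>\<^sub>\<infinity>m\<in>(UNIV :: (nat ^ 'd) set). exp (- T * osc_energy lam m))"

definition mehler :: "real \<Rightarrow> real ^ 'd::finite \<Rightarrow> real \<Rightarrow> real ^ 'd \<Rightarrow> real" where
  "mehler lam x t y =
     (2 * pi * sinh (lam * t) / lam) powr (- real CARD('d) / 2)
     * exp (- (lam * (cosh (lam * t) * ((norm x)\<^sup>2 + (norm y)\<^sup>2) - 2 * (x \<bullet> y)))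
              / (2 * sinh (lam * t)))"

text \<open>The measure \<open>\<delta>(x - y) dx dy\<close> is the image of Lebesgue measure under \<open>x \<mapsto> (x, x)\<close>.\<close>

definition diag_measure :: "((real ^ 'd::finite) \<times> (real ^ 'd)) measure" where
  "diag_measure = distr lborel (borel \<Otimes>\<^sub>M borel) (\<lambda>x. (x, x))"

definition mu_bar :: "real \<Rightarrow> real \<Rightarrow> ((real ^ 'd::finite) \<times> (real ^ 'd)) measure" where
  "mu_bar lam T = density diag_measure
     (\<lambda>(x, y). ennreal (inverse (partition_fun TYPE('d) lam T) * mehler lam x T y))"

definition osc_variance :: "real \<Rightarrow> real \<Rightarrow> real" where
  "osc_variance lam T = sinh (lam * T) / (2 * lam * (cosh (lam * T) - 1))"

section \<open>Processes on \<open>[0, T]\<close>\<close>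

text \<open>A process is a family \<open>Z \<tau>\<close> of which only the members with \<open>\<tau> \<in> {0..T}\<close> matter.\<close>

definition process_on :: "'w measure \<Rightarrow> real \<Rightarrow> (real \<Rightarrow> 'w \<Rightarrow> 'a::topological_space) \<Rightarrow> bool" where
  "process_on M T Z \<longleftrightarrow> (\<forall>\<tau>\<in>{0..T}. Z \<tau> \<in> M \<rightarrow>\<^sub>M borel)"

definition sigma_of :: "'w measure \<Rightarrow> (real \<Rightarrow> 'w \<Rightarrow> 'a::topological_space) \<Rightarrow> real set \<Rightarrow> 'w measure" where
  "sigma_of M Z I = sigma (space M) {Z \<tau> -` F \<inter> space M | \<tau> F. \<tau> \<in> I \<and> F \<in> sets borel}"

definition sigma_join :: "'w measure \<Rightarrow> 'w measure \<Rightarrow> 'w measure \<Rightarrow> 'w measure" where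
  "sigma_join M F G = sigma (space M) (sets F \<union> sets G)"

definition complex_cond_exp :: "'w measure \<Rightarrow> 'w measure \<Rightarrow> ('w \<Rightarrow> complex) \<Rightarrow> 'w \<Rightarrow> complex" where
  "complex_cond_exp M F f \<omega> =
     Complex (real_cond_exp M F (\<lambda>\<omega>. Re (f \<omega>)) \<omega>) (real_cond_exp M F (\<lambda>\<omega>. Im (f \<omega>)) \<omega>)"

definition bernstein_process ::
  "'w measure \<Rightarrow> real \<Rightarrow> (real \<Rightarrow> 'w \<Rightarrow> real ^ 'd::finite) \<Rightarrow> bool" where
  "bernstein_process M T Z \<longleftrightarrow>
     prob_space M \<and> complete_measure M \<and> process_on M T Z \<and>
     (\<forall>b :: real ^ 'd \<Rightarrow> complex. b \<in> borel_measurable borel \<longrightarrow> bounded (range b) \<longrightarrow>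
       (\<forall>s r t. 0 \<le> s \<longrightarrow> s < r \<longrightarrow> r < t \<longrightarrow> t \<le> T \<longrightarrow>
         (AE \<omega> in M.
            complex_cond_exp M (sigma_join M (sigma_of M Z {0..s}) (sigma_of M Z {t..T}))
              (\<lambda>\<omega>. b (Z r \<omega>)) \<omega>
            = complex_cond_exp M (sigma_of M Z {s, t}) (\<lambda>\<omega>. b (Z r \<omega>)) \<omega>)))"

text \<open>The integrals over \<open>F 1, \<dots>, F n\<close> are written as one integral over the product measure,
  and \<open>u(0 := x)\<close> implements the convention \<open>x\<^sub>0 = x\<close>.  All integrands are nonnegative.\<close>

definition associated_bernstein_process ::
  "real \<Rightarrow> real \<Rightarrow> ((real ^ 'd) \<times> (real ^ 'd)) measure
     \<Rightarrow> 'w measure \<Rightarrow> (real \<Rightarrow> 'w \<Rightarrow> real ^ 'd::finite) \<Rightarrow> bool" where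
  "associated_bernstein_process lam T \<mu> M Z \<longleftrightarrow>
     bernstein_process M T Z \<and>
     (\<forall>(n::nat) (t :: nat \<Rightarrow> real) (F :: nat \<Rightarrow> (real ^ 'd) set) FT.
        1 \<le> n \<longrightarrow> t 0 = 0 \<longrightarrow> (\<forall>k<n. t k < t (Suc k)) \<longrightarrow> t n < T \<longrightarrow>
        (\<forall>k\<le>n. F k \<in> sets borel) \<longrightarrow> FT \<in> sets borel \<longrightarrow>
        emeasure M {\<omega> \<in> space M. (\<forall>k\<le>n. Z (t k) \<omega> \<in> F k) \<and> Z T \<omega> \<in> FT} =
        (\<integral>\<^sup>+ p \<in> F 0 \<times> FT. (case p of (x, y) \<Rightarrow>
           ennreal (1 / mehler lam x T y) *
           (\<integral>\<^sup>+ u \<in> (\<Pi>\<^sub>E k\<in>{1..n}. F k).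
              (let v = u(0 := x) in
               ennreal ((\<Prod>k=1..n. mehler lam (v k) (t k - t (k - 1)) (v (k - 1)))
                        * mehler lam y (T - t n) (v n)))
            \<partial>(\<Pi>\<^sub>M k\<in>{1..n}. lborel))) \<partial>\<mu>))"

definition stationary_process ::
  "'w measure \<Rightarrow> real \<Rightarrow> (real \<Rightarrow> 'w \<Rightarrow> 'a::topological_space) \<Rightarrow> bool" where
  "stationary_process M T Z \<longleftrightarrow> process_on M T Z \<and>
     (\<forall>I h. finite I \<longrightarrow> I \<subseteq> {0..T} \<longrightarrow> (\<lambda>\<tau>. \<tau> + h) ` I \<subseteq> {0..T} \<longrightarrow>
        distr M (\<Pi>\<^sub>M \<tau>\<in>I. borel) (\<lambda>\<omega>. \<lambda>\<tau>\<in>I. Z (\<tau> + h) \<omega>)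
        = distr M (\<Pi>\<^sub>M \<tau>\<in>I. borel) (\<lambda>\<omega>. \<lambda>\<tau>\<in>I. Z \<tau> \<omega>))"

definition markov_process ::
  "'w measure \<Rightarrow> real \<Rightarrow> (real \<Rightarrow> 'w \<Rightarrow> 'a::topological_space) \<Rightarrow> bool" where
  "markov_process M T Z \<longleftrightarrow> process_on M T Z \<and>
     (\<forall>b :: 'a \<Rightarrow> complex. b \<in> borel_measurable borel \<longrightarrow> bounded (range b) \<longrightarrow>
       (\<forall>s t. 0 \<le> s \<longrightarrow> s \<le> t \<longrightarrow> t \<le> T \<longrightarrow>
         (AE \<omega> in M. complex_cond_exp M (sigma_of M Z {0..s}) (\<lambda>\<omega>. b (Z t \<omega>)) \<omega>
            = complex_cond_exp M (sigma_of M Z {s}) (\<lambda>\<omega>. b (Z t \<omega>)) \<omega>)))"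

text \<open>Constants count as Gaussian.  This is needed here because \<open>Z 0 = Z T\<close> almost surely under
  \<^const>\<open>mu_bar\<close>, so that \<open>Z T - Z 0\<close> is degenerate.\<close>

definition gaussian_rv :: "'w measure \<Rightarrow> ('w \<Rightarrow> real) \<Rightarrow> bool" where
  "gaussian_rv M X \<longleftrightarrow> X \<in> borel_measurable M \<and>
     ((\<exists>m s. 0 < s \<and> distr M borel X = density lborel (\<lambda>x. ennreal (normal_density m s x)))
      \<or> (\<exists>c. distr M borel X = return borel c))"

definition gaussian_process ::
  "'w measure \<Rightarrow> real \<Rightarrow> (real \<Rightarrow> 'w \<Rightarrow> 'a::euclidean_space) \<Rightarrow> bool" where
  "gaussian_process M T Z \<longleftrightarrow> process_on M T Z \<and>
     (\<forall>I (a :: real \<Rightarrow> 'a). finite I \<longrightarrow> I \<subseteq> {0..T} \<longrightarrow>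
        gaussian_rv M (\<lambda>\<omega>. \<Sum>\<tau>\<in>I. a \<tau> \<bullet> Z \<tau> \<omega>))"

section \<open>Operators on \<open>L\<^sup>2\<close>\<close>

text \<open>Elements of \<open>L\<^sup>2\<close> are represented by functions; equality in \<open>L\<^sup>2\<close> is equality almost
  everywhere.\<close>

definition L2 :: "('a::euclidean_space \<Rightarrow> complex) set" where
  "L2 = {f. f \<in> borel_measurable lebesgue \<and> integrable lebesgue (\<lambda>x. (norm (f x))\<^sup>2)}"

definition L2_inner :: "('a::euclidean_space \<Rightarrow> complex) \<Rightarrow> ('a \<Rightarrow> complex) \<Rightarrow> complex" where
  "L2_inner f g = (\<integral>x. f x * cnj (g x) \<partial>lebesgue)"

definition L2_norm :: "('a::euclidean_space \<Rightarrow> complex) \<Rightarrow> real" where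
  "L2_norm f = sqrt (\<integral>x. (norm (f x))\<^sup>2 \<partial>lebesgue)"

definition has_L2_sum :: "('i \<Rightarrow> 'a::euclidean_space \<Rightarrow> complex) \<Rightarrow> ('a \<Rightarrow> complex) \<Rightarrow> bool" where
  "has_L2_sum u g \<longleftrightarrow> (\<forall>i. u i \<in> L2) \<and> g \<in> L2 \<and>
     ((\<lambda>I. L2_norm (\<lambda>x. (\<Sum>i\<in>I. u i x) - g x)) \<longlongrightarrow> 0) (finite_subsets_at_top UNIV)"

definition L2_sum :: "('i \<Rightarrow> 'a::euclidean_space \<Rightarrow> complex) \<Rightarrow> 'a \<Rightarrow> complex" where
  "L2_sum u = (SOME g. has_L2_sum u g)"

text \<open>\<open>L\<^sup>2\<close> is separable and infinite-dimensional, so its orthonormal bases are sequences.\<close>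

definition L2_onb :: "(nat \<Rightarrow> 'a::euclidean_space \<Rightarrow> complex) \<Rightarrow> bool" where
  "L2_onb e \<longleftrightarrow> (\<forall>n. e n \<in> L2) \<and>
     (\<forall>m n. L2_inner (e m) (e n) = (if m = n then 1 else 0)) \<and>
     (\<forall>f\<in>L2. has_L2_sum (\<lambda>n x. L2_inner f (e n) * e n x) f)"

definition L2_bounded_operator ::
  "(('a::euclidean_space \<Rightarrow> complex) \<Rightarrow> 'a \<Rightarrow> complex) \<Rightarrow> bool" where
  "L2_bounded_operator A \<longleftrightarrow>
     (\<forall>f\<in>L2. A f \<in> L2) \<and>
     (\<forall>f\<in>L2. \<forall>g\<in>L2. AE x in lebesgue. A (\<lambda>x. f x + g x) x = A f x + A g x) \<and>
     (\<forall>c. \<forall>f\<in>L2. AE x in lebesgue. A (\<lambda>x. c * f x) x = c * A f x) \<and>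
     (\<exists>C. \<forall>f\<in>L2. L2_norm (A f) \<le> C * L2_norm f)"

text \<open>\<^const>\<open>has_sum\<close> over an index set is unconditional, hence absolute, convergence.  A bounded
  operator for which the diagonal series converges absolutely in every orthonormal basis is of trace
  class, and the common value of the sums is its trace.\<close>

definition has_trace ::
  "(('a::euclidean_space \<Rightarrow> complex) \<Rightarrow> 'a \<Rightarrow> complex) \<Rightarrow> complex \<Rightarrow> bool" where
  "has_trace A \<tau> \<longleftrightarrow> L2_bounded_operator A \<and>
     (\<forall>e. L2_onb e \<longrightarrow> ((\<lambda>n. L2_inner (A (e n)) (e n)) has_sum \<tau>) UNIV)"

definition real_Linf :: "('a::euclidean_space \<Rightarrow> real) set" where
  "real_Linf = {b. b \<in> borel_measurable lebesgue \<and> (\<exists>C. AE x in lebesgue. \<bar>b x\<bar> \<le> C)}"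

definition mult_operator :: "('a \<Rightarrow> real) \<Rightarrow> ('a \<Rightarrow> complex) \<Rightarrow> 'a \<Rightarrow> complex" where
  "mult_operator b f = (\<lambda>x. complex_of_real (b x) * f x)"

definition density_operator ::
  "real \<Rightarrow> real \<Rightarrow> (real ^ 'd::finite \<Rightarrow> complex) \<Rightarrow> real ^ 'd \<Rightarrow> complex" where
  "density_operator lam T f = (\<lambda>x. complex_of_real (inverse (partition_fun TYPE('d) lam T)) *
     L2_sum (\<lambda>(m :: nat ^ 'd) y. complex_of_real (exp (- T * osc_energy lam m))
               * L2_inner f (\<lambda>z. complex_of_real (osc_eigenfun lam m z))
               * complex_of_real (osc_eigenfun lam m y)) x)"

end

theory Submission
  imports Defs
begin

text \<open>The bridge that is built from the Mehler kernel and started from the diagonal measure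
  \<^const>\<open>mu_bar\<close> is a loop: its endpoints agree almost surely.  At times \<open>s 0 < \<dots> < s n\<close> that span less
  than \<open>T\<close>, the joint density of the positions is the cyclic product of Mehler kernels over the
  increments \<open>s k - s (k - 1)\<close> and the remaining time \<open>T - (s n - s 0)\<close> (theorem \<open>law\<close>, from the
  Chapman-Kolmogorov equation).  Only time differences occur, hence the process is stationary.  For a
  single time the density is the normalized diagonal of the Mehler kernel, a centered Gaussian.

  The negative logarithm of the joint density is a quadratic form, the action of the loop.  Its inverse
  is found without any matrix calculation.  Translating the positions by the values \<open>c (s k)\<close> of the loop
  \<open>c = \<Sum>\<^sub>j green (\<cdot> - s j) a\<^sub>j\<close>, with \<open>green\<close> the periodic Green function of
  \<open>lam\<^sup>2 - d\<^sup>2/du\<^sup>2\<close>, changes the action by the linear function \<open>\<Sum>\<^sub>k a\<^sub>k \<bullet> v\<^sub>k\<close> and a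
  constant (\<open>loop_form_green\<close>, \<open>loop_density_translate\<close>): \<open>c\<close> solves \<open>c'' = lam\<^sup>2 c\<close> between the times, so only the
  jumps of its derivative contribute.  Hence for every linear combination \<open>Y\<close> of positions, translating
  the law of \<open>Y\<close> by \<open>\<theta> V\<close> is the same as tilting it by \<open>exp (\<theta> y - \<theta>\<^sup>2 V / 2)\<close>, where \<open>V\<close> is the
  quadratic expression in the Green function.  Integrating this identity over \<open>\<theta>\<close> shows that \<open>Y\<close> is
  normal with variance \<open>V\<close> (\<open>centered_gaussian_by_tilting\<close>).  This gives Gaussianity and, by
  polarization, the covariance.

  The process is not Markov because \<open>Z T = Z 0\<close> is known at time \<open>T / 2\<close>, while \<open>Z (T / 2)\<close> alone does not
  determine whether \<open>Z 0\<close> lies in a given ball: the pair has a positive joint density.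

  For the trace formula, write the density operator as \<open>f \<mapsto> \<Sum>\<^sub>m (f, \<phi>\<^sub>m) \<phi>\<^sub>m\<close> divided by the
  partition function, with \<open>\<phi>\<^sub>m\<^sup>2 = exp (- T E\<^sub>m) h\<^sub>m\<^sup>2\<close>.  Parseval's identity shows that composing it with
  multiplication by \<open>b\<close> gives an operator whose trace is \<open>\<integral> b \<Sum>\<^sub>m \<phi>\<^sub>m\<^sup>2\<close>, again divided by the partition
  function (\<open>has_trace_sum_operator\<close>), and the sum is the diagonal of the Mehler kernel by
  \<open>mehler_diagonal_expansion\<close>.  So trace and expectation are the same Gaussian integral.  The diagonal
  Mehler formula is a statement about the generating function of the squares of Hermite polynomials;
  their three-term recurrence makes it satisfy a linear differential equation of first order
  (\<open>hermite_sq_generating_function\<close>).\<close>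

section \<open>Hermite functions and the diagonal of the Mehler kernel\<close>

text \<open>The physicists' Hermite polynomials, given by the three-term recurrence rather than by
  derivatives, because this recurrence is what drives the evaluation of the diagonal sums below.\<close>

fun hermite :: "nat \<Rightarrow> real \<Rightarrow> real" where
  "hermite 0 x = 1"
| "hermite (Suc 0) x = 2 * x"
| "hermite (Suc (Suc m)) x = 2 * x * hermite (Suc m) x - 2 * real (Suc m) * hermite m x"

lemma hermite_deriv:
  "(hermite 0 has_real_derivative 0) (at x)"
  "(hermite (Suc m) has_real_derivative 2 * real (Suc m) * hermite m x) (at x)"
proof -
  have h0: "hermite 0 = (\<lambda>x. 1)" by auto
  show "(hermite 0 has_real_derivative 0) (at x)" unfolding h0 by simp
  show "(hermite (Suc m) has_real_derivative 2 * real (Suc m) * hermite m x) (at x)"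
  proof (induction m rule: less_induct)
    case (less m)
    show ?case
    proof (cases m)
      case 0
      have h1: "hermite (Suc 0) = (\<lambda>x. 2 * x)" by auto
      show ?thesis unfolding 0 h1 by (auto intro!: derivative_eq_intros)
    next
      case (Suc k)
      have d1: "(hermite (Suc k) has_real_derivative 2 * real (Suc k) * hermite k x) (at x)"
        using less.IH[of k] Suc by simp
      have h: "hermite (Suc m) = (\<lambda>x. 2 * x * hermite (Suc k) x - 2 * real (Suc k) * hermite k x)"
        using Suc by auto
      show ?thesis
      proof (cases k)
        case 0
        show ?thesis unfolding h using Suc 0
          by (auto intro!: derivative_eq_intros)
      next
        case (Suc l)
        have d2: "(hermite k has_real_derivative 2 * real k * hermite l x) (at x)"
          using less.IH[of l] Suc \<open>m = Suc k\<close> by simp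
        have rec: "hermite (Suc k) x = 2 * x * hermite k x - 2 * real k * hermite l x"
          using Suc by simp
        have "((\<lambda>x. 2 * x * hermite (Suc k) x - 2 * real (Suc k) * hermite k x) has_real_derivative
            (2 * 1 * hermite (Suc k) x + 2 * x * (2 * real (Suc k) * hermite k x))
              - 2 * real (Suc k) * (2 * real k * hermite l x)) (at x)"
          by (rule derivative_eq_intros d1 d2 refl | simp del: hermite.simps)+
        moreover have "2 * 1 * hermite (Suc k) x + 2 * x * (2 * real (Suc k) * hermite k x)
              - 2 * real (Suc k) * (2 * real k * hermite l x) = 2 * real (Suc m) * hermite m x"
          unfolding \<open>m = Suc k\<close> rec by (simp add: algebra_simps del: hermite.simps)
        ultimately show ?thesis unfolding h by simp
      qed
    qed
  qed
qed

lemma hermite_weighted_deriv: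
  "((\<lambda>u. hermite m u * exp (- u\<^sup>2)) has_real_derivative - (hermite (Suc m) x * exp (- x\<^sup>2))) (at x)"
proof (cases m)
  case 0
  show ?thesis unfolding 0 by (auto intro!: derivative_eq_intros)
next
  case (Suc k)
  note d = hermite_deriv(2)[where m=k and x=x]
  show ?thesis unfolding Suc
    by (rule derivative_eq_intros d refl | (simp add: algebra_simps))+
qed

text \<open>Differentiating \<open>H\<^sub>m exp (-u\<^sup>2)\<close> gives \<open>-H\<^sub>m\<^sub>+\<^sub>1 exp (-u\<^sup>2)\<close>, since
  \<open>H\<^sub>m' = 2 m H\<^sub>m\<^sub>-\<^sub>1\<close>.  This links the recurrence to the eigenfunctions, which are defined by
  derivatives.\<close>

lemma rodrigues: "(deriv ^^ m) (\<lambda>u. exp (- u\<^sup>2)) = (\<lambda>u. (-1) ^ m * (hermite m u * exp (- u\<^sup>2)))"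
proof (induction m)
  case (Suc m)
  show ?case
  proof
    fix x :: real
    have "deriv (\<lambda>u. (-1) ^ m * (hermite m u * exp (- u\<^sup>2))) x = (-1) ^ m * (- (hermite (Suc m) x * exp (- x\<^sup>2)))"
      by (intro DERIV_imp_deriv DERIV_cmult hermite_weighted_deriv)
    then show "(deriv ^^ Suc m) (\<lambda>u. exp (- u\<^sup>2)) x = (-1) ^ Suc m * (hermite (Suc m) x * exp (- x\<^sup>2))"
      using Suc by simp
  qed
qed auto

text \<open>With \<open>p\<^sub>m = H\<^sub>m / sqrt (2\<^sup>m m!)\<close>, these are \<open>p\<^sub>m\<^sup>2\<close> and \<open>sqrt (2 (m + 1)) p\<^sub>m p\<^sub>m\<^sub>+\<^sub>1\<close>.
  Multiplying the three-term recurrence by its middle term relates the two sequences.  Multiplying it by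
  each of its outer terms and eliminating \<open>H\<^sub>m H\<^sub>m\<^sub>+\<^sub>2\<close> gives a second relation, so that the pair
  satisfies a closed linear system.\<close>

definition hermite_sq :: "real \<Rightarrow> nat \<Rightarrow> real" where
  "hermite_sq x m = (hermite m x)\<^sup>2 / (2 ^ m * fact m)"

definition hermite_mix :: "real \<Rightarrow> nat \<Rightarrow> real" where
  "hermite_mix x m = hermite m x * hermite (Suc m) x / (2 ^ m * fact m)"

lemma hermite_sq_nonneg: "hermite_sq x m \<ge> 0"
  by (simp add: hermite_sq_def)

lemma hermite_fun_sq: "(hermite_fun m x)\<^sup>2 = hermite_sq x m * exp (- x\<^sup>2) / sqrt pi"
proof -
  define a where "a = sqrt pi * 2 ^ m * (fact m :: real)"
  have a: "a > 0" by (simp add: a_def)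
  have "(a powr (-1/2))\<^sup>2 = 1 / a"
    using a by (simp add: power2_eq_square powr_add[symmetric] powr_minus_divide)
  moreover have "(exp (x\<^sup>2 / 2) * exp (- x\<^sup>2))\<^sup>2 = exp (- x\<^sup>2)"
    by (simp add: power2_eq_square exp_add[symmetric])
  moreover have "(hermite_fun m x)\<^sup>2
      = (a powr (-1/2))\<^sup>2 * (exp (x\<^sup>2 / 2) * exp (- x\<^sup>2))\<^sup>2 * (((-1) ^ m * (-1) ^ m) * hermite m x)\<^sup>2"
    by (cases "even m") (simp_all add: hermite_fun_def rodrigues a_def power_mult_distrib)
  moreover have "((-1::real) ^ m * (-1) ^ m) = 1" by (simp add: power_add[symmetric] flip: mult_2)
  ultimately have "(hermite_fun m x)\<^sup>2 = 1 / a * exp (- x\<^sup>2) * (1 * hermite m x)\<^sup>2" by metis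
  then show ?thesis by (simp add: hermite_sq_def a_def mult_ac)
qed

lemma hermite_mix_rec: "hermite_mix x (Suc m) + hermite_mix x m = 2 * x * hermite_sq x (Suc m)"
proof -
  define P where "P = (2 ^ m * fact m :: real)"
  have P: "P > 0" by (simp add: P_def)
  have "hermite_mix x (Suc m) = hermite (Suc m) x * hermite (Suc (Suc m)) x / (2 * real (Suc m) * P)"
    "hermite_mix x m = hermite m x * hermite (Suc m) x / P"
    "hermite_sq x (Suc m) = (hermite (Suc m) x)\<^sup>2 / (2 * real (Suc m) * P)"
    by (simp_all add: hermite_mix_def hermite_sq_def P_def field_simps del: hermite.simps)
  moreover define n where "n = real (Suc m)"
  moreover define a b where "a = hermite m x" and "b = hermite (Suc m) x"
  moreover have "hermite (Suc (Suc m)) x = 2 * x * b - 2 * n * a" by (simp add: a_def b_def n_def)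
  moreover have "n > 0" by (simp add: n_def)
  ultimately have e: "hermite_mix x (Suc m) = b * (2 * x * b - 2 * n * a) / (2 * n * P)"
    "hermite_mix x m = a * b / P" "hermite_sq x (Suc m) = b\<^sup>2 / (2 * n * P)" "n > 0"
    by (metis, metis, metis, metis)
  show ?thesis unfolding e(1-3) using P e(4)
    by (simp add: divide_simps) (simp add: algebra_simps power2_eq_square)
qed

lemma hermite_sq_rec:
  "real (Suc (Suc m)) * hermite_sq x (Suc (Suc m))
     = x * (hermite_mix x (Suc m) - hermite_mix x m) + real (Suc m) * hermite_sq x m"
proof -
  define P where "P = (2 ^ m * fact m :: real)"
  have P: "P > 0" by (simp add: P_def)
  have e: "hermite_mix x (Suc m) = hermite (Suc m) x * hermite (Suc (Suc m)) x / (2 * real (Suc m) * P)"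
    "hermite_mix x m = hermite m x * hermite (Suc m) x / P"
    "hermite_sq x m = (hermite m x)\<^sup>2 / P"
    "hermite_sq x (Suc (Suc m)) = (hermite (Suc (Suc m)) x)\<^sup>2 / (2 * real (Suc (Suc m)) * (2 * real (Suc m) * P))"
    by (simp_all add: hermite_mix_def hermite_sq_def P_def field_simps del: hermite.simps)
  define n where "n = real (Suc m)"
  have n: "n > 0" "real (Suc (Suc m)) = n + 1" by (auto simp: n_def)
  define a b where "a = hermite m x" and "b = hermite (Suc m) x"
  have c: "hermite (Suc (Suc m)) x = 2 * x * b - 2 * n * a" by (simp add: a_def b_def n_def)
  show ?thesis unfolding e c n(2) n_def[symmetric] a_def[symmetric] b_def[symmetric] using P n(1)
    by (simp add: divide_simps) (simp add: algebra_simps power2_eq_square)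
qed

text \<open>The three-term recurrence lets the larger of two consecutive terms grow by at most the factor
  \<open>1 + 2 e\<close> from some index on, for any \<open>e > 0\<close>, so the ratio test applies in the open unit disc.\<close>

lemma summable_hermite_sq:
  assumes w: "\<bar>w\<bar> < 1"
  shows "summable (\<lambda>m. hermite_sq x m * w ^ m)"
proof (cases "w = 0")
  case True
  then show ?thesis by (intro summable_finite[of "{0}"]) auto
next
  case False
  define r where "r = \<bar>w\<bar>"
  have r: "0 < r" "r < 1" using w False by (auto simp: r_def)
  \<comment> \<open>Any \<open>e > 0\<close> with \<open>(1 + 2 e) r < 1\<close> would do.\<close>
  define e where "e = (1 / r - 1) / 4"
  have e: "e > 0" using r by (simp add: e_def field_simps)
  have er: "(1 + 2 * e) * r < 1" using r by (simp add: e_def field_simps)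
  define U where "U m = max (hermite_sq x m) (hermite_sq x (Suc m))" for m
  have U0: "U m \<ge> 0" for m unfolding U_def using hermite_sq_nonneg[of x m] by linarith
  \<comment> \<open>From index \<open>N\<close> on, the coefficient \<open>(1 + 1 / e) 2 x\<^sup>2 / (m + 2)\<close> of the middle term is at most \<open>e\<close>.\<close>
  obtain N where N: "real N > (1 + 1 / e) * 2 * x\<^sup>2 / e" using reals_Archimedean2 by blast
  have step: "hermite_sq x (Suc (Suc m)) \<le> (1 + 2 * e) * U m" if m: "m \<ge> N" for m
  proof -
    define P where "P = (2 ^ m * fact m :: real)"
    have P: "P > 0" by (simp add: P_def)
    define n where "n = real (Suc m)"
    have n: "n > 0" "real (Suc (Suc m)) = n + 1" by (auto simp: n_def)
    define a b where "a = hermite m x" and "b = hermite (Suc m) x"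
    have c: "hermite (Suc (Suc m)) x = 2 * x * b - 2 * n * a" by (simp add: a_def b_def n_def)
    have q: "(2 * x * b - 2 * n * a)\<^sup>2 \<le> (1 + 1 / e) * (2 * x * b)\<^sup>2 + (1 + e) * (2 * n * a)\<^sup>2"
    proof -
      have "0 \<le> (2 * x * b + e * (2 * n * a))\<^sup>2 / e" using e by simp
      also have "\<dots> = (1 + 1 / e) * (2 * x * b)\<^sup>2 + (1 + e) * (2 * n * a)\<^sup>2 - (2 * x * b - 2 * n * a)\<^sup>2"
        using e by (simp add: field_simps power2_eq_square)
      finally show ?thesis by simp
    qed
    have s: "hermite_sq x m = a\<^sup>2 / P" "hermite_sq x (Suc m) = b\<^sup>2 / (2 * n * P)"
      "hermite_sq x (Suc (Suc m)) = (2 * x * b - 2 * n * a)\<^sup>2 / (2 * (n + 1) * (2 * n * P))"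
      unfolding c[symmetric]
      by (simp_all add: hermite_sq_def P_def a_def b_def n_def field_simps del: hermite.simps)
    have "hermite_sq x (Suc (Suc m)) \<le> ((1 + 1 / e) * (2 * x * b)\<^sup>2 + (1 + e) * (2 * n * a)\<^sup>2) / (2 * (n + 1) * (2 * n * P))"
      unfolding s using q n P by (intro divide_right_mono) auto
    also have "\<dots> = ((1 + 1 / e) * 2 * x\<^sup>2 / (n + 1)) * hermite_sq x (Suc m) + ((1 + e) * (n / (n + 1))) * hermite_sq x m"
      unfolding s using n P e by (simp add: divide_simps) (simp add: algebra_simps power2_eq_square)
    also have "\<dots> \<le> e * U m + ((1 + e) * 1) * U m"
    proof (intro add_mono mult_mono)
      have "(1 + 1 / e) * 2 * x\<^sup>2 / e < n + 1" using N m by (simp add: n_def)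
      then show "(1 + 1 / e) * 2 * x\<^sup>2 / (n + 1) \<le> e"
        using e n by (simp add: pos_divide_le_eq pos_divide_less_eq mult.commute)
    qed (use e n hermite_sq_nonneg in \<open>auto simp: U_def\<close>)
    finally show ?thesis by (simp add: algebra_simps)
  qed
  have stepU: "U (Suc m) \<le> (1 + 2 * e) * U m" if "m \<ge> N" for m
  proof -
    have "1 * U m \<le> (1 + 2 * e) * U m" using e U0 by (intro mult_right_mono) auto
    then show ?thesis using step[OF that] unfolding U_def[of "Suc m"] by (auto simp: U_def)
  qed
  have "summable (\<lambda>m. U m * r ^ m)"
  proof (rule summable_ratio_test[OF er, of N])
    fix m assume "m \<ge> N"
    have "U (Suc m) * r ^ Suc m \<le> ((1 + 2 * e) * U m) * r ^ Suc m"
      using stepU[OF \<open>m \<ge> N\<close>] r by (intro mult_right_mono) auto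
    then show "norm (U (Suc m) * r ^ Suc m) \<le> (1 + 2 * e) * r * norm (U m * r ^ m)"
      using U0 r by (simp add: abs_mult mult_ac)
  qed
  then show ?thesis
  proof (rule summable_comparison_test'[where N=0])
    fix m :: nat
    show "norm (hermite_sq x m * w ^ m) \<le> U m * r ^ m"
      using hermite_sq_nonneg[of x m] r
      by (auto simp: abs_mult power_abs r_def U_def intro!: mult_right_mono)
  qed
qed

text \<open>The two recurrences turn into \<open>(1 + w) R = 2 x S\<close> and
  \<open>(1 - w\<^sup>2) S' = w S + x (1 - w) R\<close> for the power series \<open>S\<close> of \<^const>\<open>hermite_sq\<close> and \<open>R\<close> of
  \<^const>\<open>hermite_mix\<close>.  Eliminating \<open>R\<close> leaves a linear differential equation of first order
  for \<open>S\<close>, which the closed form on the right solves with the same value at \<open>0\<close>.\<close>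

lemma hermite_sq_generating_function:
  assumes w: "\<bar>w\<bar> < 1"
  shows "(\<lambda>m. hermite_sq x m * w ^ m) sums ((1 - w\<^sup>2) powr (-1/2) * exp (2 * x\<^sup>2 * w / (1 + w)))"
proof -
  define S where "S w = (\<Sum>m. hermite_sq x m * w ^ m)" for w
  define S' where "S' w = (\<Sum>m. diffs (hermite_sq x) m * w ^ m)" for w
  define f where "f w = (1 - w\<^sup>2) powr (-1/2) * exp (2 * x\<^sup>2 * w / (1 + w))" for w :: real
  \<comment> \<open>The reciprocal of \<open>f\<close>; the product \<open>S g\<close> turns out to be constant.\<close>
  define g where "g w = sqrt (1 - w\<^sup>2) * exp (- (2 * x\<^sup>2 * w / (1 + w)))" for w :: real
  have deriv_S: "(S has_real_derivative S' w) (at w)" if "\<bar>w\<bar> < 1" for w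
    unfolding S_def S'_def
    by (rule termdiffs_strong'[where K=1]) (use that summable_hermite_sq in auto)
  have ode: "(1 - w\<^sup>2) * S' w = (w + 2 * x\<^sup>2 * (1 - w) / (1 + w)) * S w" if w: "\<bar>w\<bar> < 1" for w
  proof -
    let ?u = "hermite_sq x" and ?s = "hermite_mix x"
    have uS: "(\<lambda>m. ?u m * w ^ m) sums S w"
      unfolding S_def by (rule summable_sums[OF summable_hermite_sq[OF w]])
    have sumS': "summable (\<lambda>m. diffs ?u m * v ^ m)" if "\<bar>v\<bar> < 1" for v
      by (rule termdiff_converges[where K=1]) (use that summable_hermite_sq in auto)
    have uS': "(\<lambda>m. real (Suc m) * ?u (Suc m) * w ^ m) sums S' w"
      using summable_sums[OF sumS'[OF w]] unfolding S'_def by (simp add: diffs_def)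
    \<comment> \<open>Summability of \<^const>\<open>hermite_mix\<close> follows from that of the series of \<open>S\<close> and \<open>S'\<close>.\<close>
    have mix_le: "\<bar>?s m\<bar> \<le> ?u m + real (Suc m) * ?u (Suc m)" for m
    proof -
      define P where "P = (2 ^ m * fact m :: real)"
      have P: "P > 0" by (simp add: P_def)
      have "\<bar>a * b\<bar> \<le> a\<^sup>2 + b\<^sup>2 / 2" for a b :: real
      proof -
        have "0 \<le> (\<bar>a\<bar> - \<bar>b\<bar> / 2)\<^sup>2" by simp
        also have "\<dots> = a\<^sup>2 + b\<^sup>2 / 4 - \<bar>a * b\<bar>" by (simp add: power2_eq_square algebra_simps abs_mult)
        also have "\<dots> \<le> a\<^sup>2 + b\<^sup>2 / 2 - \<bar>a * b\<bar>" by simp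
        finally show ?thesis by simp
      qed
      from this[of "hermite m x" "hermite (Suc m) x"]
      have "\<bar>hermite m x * hermite (Suc m) x\<bar> / P \<le> ((hermite m x)\<^sup>2 + (hermite (Suc m) x)\<^sup>2 / 2) / P"
        using P by (intro divide_right_mono) auto
      also have "\<dots> = ?u m + real (Suc m) * ?u (Suc m)"
        using P by (simp add: hermite_sq_def P_def add_divide_distrib del: hermite.simps of_nat_Suc)
      finally show ?thesis using P
        by (simp add: hermite_mix_def P_def abs_mult del: hermite.simps)
    qed
    have "summable (\<lambda>m. ?s m * w ^ m)"
    proof (rule summable_comparison_test'[where N=0])
      show "summable (\<lambda>m. ?u m * \<bar>w\<bar> ^ m + diffs ?u m * \<bar>w\<bar> ^ m)"
        by (intro summable_add summable_hermite_sq sumS') (use w in auto)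
      fix m :: nat
      show "norm (?s m * w ^ m) \<le> ?u m * \<bar>w\<bar> ^ m + diffs ?u m * \<bar>w\<bar> ^ m"
        using mult_right_mono[OF mix_le[of m], of "\<bar>w\<bar> ^ m"]
        by (simp add: abs_mult power_abs diffs_def algebra_simps)
    qed
    then obtain R where sR: "(\<lambda>m. ?s m * w ^ m) sums R" by (auto simp: summable_def)
    have uS1: "(\<lambda>m. ?u (Suc m) * w ^ Suc m) sums (S w - ?u 0)"
      and sR1: "(\<lambda>m. ?s (Suc m) * w ^ Suc m) sums (R - ?s 0)"
      using uS sR sums_Suc_iff[of "\<lambda>m. ?u m * w ^ m"] sums_Suc_iff[of "\<lambda>m. ?s m * w ^ m"]
      by (simp_all del: power_Suc)
    have sR2: "(\<lambda>m. ?s m * w ^ Suc m) sums (w * R)"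
      using sums_mult[OF sR, of w] by (simp add: mult_ac)
    have i0: "?u 0 = 1" "?s 0 = 2 * x" "?u (Suc 0) = 2 * x\<^sup>2"
      by (simp_all add: hermite_sq_def hermite_mix_def power2_eq_square)
    have "(\<lambda>m. ?s (Suc m) * w ^ Suc m + ?s m * w ^ Suc m) sums (R - ?s 0 + w * R)"
      by (rule sums_add[OF sR1 sR2])
    moreover have "(\<lambda>m. 2 * x * (?u (Suc m) * w ^ Suc m)) sums (2 * x * (S w - ?u 0))"
      by (rule sums_mult[OF uS1])
    moreover have "?s (Suc m) * w ^ Suc m + ?s m * w ^ Suc m = 2 * x * (?u (Suc m) * w ^ Suc m)" for m
      using hermite_mix_rec[of x m] by (metis distrib_right mult.assoc)
    ultimately have "R - ?s 0 + w * R = 2 * x * (S w - ?u 0)"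
      by (metis (no_types, lifting) sums_cong sums_unique2)
    then have R: "(1 + w) * R = 2 * x * S w" using i0 by (simp add: algebra_simps)
    have "(\<lambda>m. real (Suc (Suc m)) * ?u (Suc (Suc m)) * w ^ Suc m) sums (S' w - ?u 1)"
      using uS' by (subst sums_Suc_iff[of "\<lambda>m. real (Suc m) * ?u (Suc m) * w ^ m"]) simp
    moreover have "(\<lambda>m. x * (?s (Suc m) * w ^ Suc m - ?s m * w ^ Suc m)
        + (real m * ?u m * w ^ Suc m + ?u m * w ^ Suc m))
        sums (x * (R - ?s 0 - w * R) + (w\<^sup>2 * S' w + w * S w))"
    proof (intro sums_add sums_mult sums_diff sR1 sR2)
      have "(\<lambda>m. real (Suc m) * ?u (Suc m) * w ^ Suc (Suc m)) sums (w\<^sup>2 * S' w)"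
        using sums_mult[OF uS', of "w\<^sup>2"] by (simp add: mult_ac power2_eq_square)
      then show "(\<lambda>m. real m * ?u m * w ^ Suc m) sums (w\<^sup>2 * S' w)"
        by (subst (asm) sums_Suc_iff) simp
      show "(\<lambda>m. ?u m * w ^ Suc m) sums (w * S w)"
        using sums_mult[OF uS, of w] by (simp add: mult_ac)
    qed
    moreover have "real (Suc (Suc m)) * ?u (Suc (Suc m)) * w ^ Suc m = x * (?s (Suc m) * w ^ Suc m - ?s m * w ^ Suc m)
        + (real m * ?u m * w ^ Suc m + ?u m * w ^ Suc m)" for m
      unfolding hermite_sq_rec by (simp add: algebra_simps)
    ultimately have "S' w - ?u 1 = x * (R - ?s 0 - w * R) + (w\<^sup>2 * S' w + w * S w)"
      by (metis (no_types, lifting) sums_cong sums_unique2)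
    then have 1: "(1 - w\<^sup>2) * S' w = w * S w + x * (1 - w) * R"
      using i0 by (simp add: algebra_simps power2_eq_square)
    have "R = 2 * x * S w / (1 + w)" using R w by (simp add: field_simps)
    then show ?thesis unfolding 1 by (simp add: algebra_simps power2_eq_square add_divide_distrib diff_divide_distrib)
  qed
  have pos: "1 - w\<^sup>2 > 0" if "\<bar>w\<bar> < 1" for w :: real
    using that by (simp add: abs_square_less_1)
  have "((\<lambda>w. S w * g w) has_real_derivative 0) (at w)" if w: "\<bar>w\<bar> < 1" for w
  proof -
    have p: "1 - w\<^sup>2 > 0" "1 + w > 0" using pos[OF w] w by auto
    have dg: "(g has_real_derivative - (w + 2 * x\<^sup>2 * (1 - w) / (1 + w)) / (1 - w\<^sup>2) * g w) (at w)"
    proof -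
      have dg: "(g has_real_derivative
          (- w / sqrt (1 - w\<^sup>2)) * exp (- (2 * x\<^sup>2 * w / (1 + w)))
          + sqrt (1 - w\<^sup>2) * (exp (- (2 * x\<^sup>2 * w / (1 + w))) * (- (2 * x\<^sup>2 / (1 + w)\<^sup>2)))) (at w)"
        unfolding g_def using p
        by (auto intro!: derivative_eq_intros simp: divide_simps) (simp add: algebra_simps power2_eq_square)
      have e1: "- w / sqrt (1 - w\<^sup>2) = - w / (1 - w\<^sup>2) * sqrt (1 - w\<^sup>2)"
        using p real_div_sqrt[of "1 - w\<^sup>2"] by (simp add: field_simps)
      have e2: "2 * x\<^sup>2 / (1 + w)\<^sup>2 = (2 * x\<^sup>2 * (1 - w) / (1 + w)) / (1 - w\<^sup>2)"
      proof -
        have "1 - w\<^sup>2 = (1 - w) * (1 + w)" "1 - w \<noteq> 0" "1 + w \<noteq> 0"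
          using w by (auto simp: algebra_simps power2_eq_square)
        then show ?thesis by (simp add: power2_eq_square)
      qed
      have "(- w / D * q) * E + q * (E * (- (A / D))) = - (w + A) / D * (q * E)" for D q E A :: real
        by (cases "D = 0") (auto simp: field_simps)
      note e3 = this
      show ?thesis using dg unfolding e1 e2 e3 by (simp add: g_def)
    qed
    have "S' w = ((1 - w\<^sup>2) * S' w) / (1 - w\<^sup>2)" using p by simp
    then have "S' w = (w + 2 * x\<^sup>2 * (1 - w) / (1 + w)) / (1 - w\<^sup>2) * S w"
      unfolding ode[OF w] by simp
    moreover have "B * s * g' + - B' * g' * s = 0" if "B' = B" for B B' s g' :: real
      using that by simp
    ultimately show ?thesis
      by (intro DERIV_cong[OF DERIV_mult[OF deriv_S[OF w] dg]]) (simp only: minus_divide_left[symmetric])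
  qed
  then have "\<exists>c. \<forall>w\<in>{-1<..<1}. S w * g w = c"
    by (intro has_field_derivative_zero_constant) (auto intro: has_field_derivative_at_within)
  then obtain c where c: "\<And>w. \<bar>w\<bar> < 1 \<Longrightarrow> S w * g w = c" by (auto simp: abs_less_iff)
  have "S 0 = hermite_sq x 0" unfolding S_def by (subst powser_zero) simp
  then have "S 0 * g 0 = 1" by (simp add: g_def hermite_sq_def)
  then have "S w * g w = 1" using c[of 0] c[OF w] by simp
  moreover have "f w * g w = 1"
  proof -
    have 1: "(1 - w\<^sup>2) powr (-1/2) * sqrt (1 - w\<^sup>2) = 1"
      using pos[OF w] by (simp add: powr_half_sqrt[symmetric] powr_add[symmetric])
    have 2: "p * a * (q * b) = p * q * (a * b)" for p a q b :: real by simp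
    show ?thesis unfolding f_def g_def 2 1 by (simp add: exp_add[symmetric])
  qed
  ultimately have "S w = f w" by (metis mult_cancel_right mult_eq_0_iff one_neq_zero)
  then show ?thesis using summable_sums[OF summable_hermite_sq[OF w], of x] by (simp add: S_def f_def)
qed

text \<open>Sums over \<open>\<nat>\<^sup>d\<close> of products factorize.  As \<^const>\<open>infsum\<close> is \<open>0\<close> for families without a sum,
  a nonzero value of the product of the factor sums also shows that the family is summable.\<close>

lemma has_sum_prod_vec:
  fixes f :: "'d::finite \<Rightarrow> nat \<Rightarrow> real"
  assumes nn: "\<And>j k. f j k \<ge> 0" and s: "\<And>j. (f j has_sum s j) UNIV" and s0: "\<And>j. s j \<noteq> 0"
  shows "((\<lambda>m :: nat ^ 'd. \<Prod>j\<in>UNIV. f j (m $ j)) has_sum (\<Prod>j\<in>UNIV. s j)) UNIV"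
proof -
  have "infsum (\<lambda>g. \<Prod>j\<in>UNIV. f j (g j)) (PiE UNIV (\<lambda>_. UNIV)) = (\<Prod>j\<in>UNIV. infsum (f j) UNIV)"
    by (intro infsum_prod_PiE_abs) (use s nn in \<open>auto simp: summable_on_def\<close>)
  also have "\<dots> = (\<Prod>j\<in>UNIV. s j)"
    using s by (intro prod.cong refl infsumI)
  finally have i: "infsum (\<lambda>g. \<Prod>j\<in>UNIV. f j (g j)) UNIV = (\<Prod>j\<in>UNIV. s j)"
    by (simp add: PiE_UNIV_domain)
  moreover have "(\<Prod>j\<in>UNIV. s j) \<noteq> 0" using s0 by simp
  ultimately have "(\<lambda>g. \<Prod>j\<in>UNIV. f j (g j)) summable_on UNIV"
    using infsum_not_exists by fastforce
  then have h: "((\<lambda>g. \<Prod>j\<in>UNIV. f j (g j)) has_sum (\<Prod>j\<in>UNIV. s j)) UNIV"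
    using i has_sum_infsum by fastforce
  have "bij_betw (vec_nth :: nat ^ 'd \<Rightarrow> _) UNIV UNIV"
    by (rule bij_betwI[where g=vec_lambda]) auto
  from has_sum_reindex_bij_betw[OF this, of "\<lambda>g. \<Prod>j\<in>UNIV. f j (g j)"] h show ?thesis by simp
qed

lemma exp_osc_energy:
  "exp (- T * osc_energy lam (m :: nat ^ 'd::finite)) = (\<Prod>j\<in>UNIV. exp (- (lam * T) * (real (m $ j) + 1 / 2)))"
proof -
  have "(\<Sum>j\<in>UNIV. - (lam * T) * (real (m $ j) + 1 / 2)) = - T * osc_energy lam m"
    unfolding osc_energy_def sum_distrib_left[symmetric] by (simp add: sum.distrib algebra_simps)
  then show ?thesis by (simp only: exp_sum[symmetric] finite)
qed

lemma partition_fun_eq: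
  assumes "0 < T" "0 < lam"
  shows "partition_fun TYPE('d::finite) lam T = (2 * sinh (lam * T / 2)) powr (- real CARD('d))"
proof -
  define q where "q = exp (- (lam * T))"
  have q: "0 < q" "q < 1" using assms by (auto simp: q_def)
  have sh: "sinh (lam * T / 2) > 0" using assms by simp
  have geo: "((\<lambda>k. exp (- (lam * T) * (real k + 1 / 2))) has_sum inverse (2 * sinh (lam * T / 2))) UNIV"
  proof -
    have "(\<lambda>k. q ^ k) sums (1 / (1 - q))" using q by (intro geometric_sums) auto
    then have "(\<lambda>k. exp (- (lam * T / 2)) * q ^ k) sums (exp (- (lam * T / 2)) * (1 / (1 - q)))"
      by (rule sums_mult)
    moreover have "exp (- (lam * T / 2)) * q ^ k = exp (- (lam * T) * (real k + 1 / 2))" for k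
      by (simp add: q_def exp_of_nat_mult[symmetric] exp_add[symmetric] algebra_simps)
    moreover have "exp (- (lam * T / 2)) * (1 / (1 - q)) = inverse (2 * sinh (lam * T / 2))"
    proof -
      define e where "e = exp (lam * T / 2)"
      have e: "e > 1" using assms by (simp add: e_def)
      have "q = inverse e * inverse e" by (simp add: q_def e_def exp_minus[symmetric] exp_add[symmetric])
      moreover have "exp (- (lam * T / 2)) = inverse e" by (simp add: e_def exp_minus)
      moreover have "2 * sinh (lam * T / 2) = e - inverse e" by (simp add: sinh_def e_def exp_minus)
      moreover have "inverse e * (1 / (1 - inverse e * inverse e)) = inverse (e - inverse e)"
      proof -
        have "e * e > 1 * 1" using e by (intro mult_strict_mono) auto
        then show ?thesis using e by (simp add: field_simps)
      qed
      ultimately show ?thesis by simp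
    qed
    ultimately have "(\<lambda>k. exp (- (lam * T) * (real k + 1 / 2))) sums inverse (2 * sinh (lam * T / 2))"
      by (simp only:)
    then show ?thesis by (intro sums_nonneg_imp_has_sum) auto
  qed
  have "((\<lambda>m :: nat ^ 'd. \<Prod>j\<in>UNIV. exp (- (lam * T) * (real (m $ j) + 1 / 2)))
      has_sum (\<Prod>j\<in>(UNIV :: 'd set). inverse (2 * sinh (lam * T / 2)))) UNIV"
    by (rule has_sum_prod_vec) (use geo sh in auto)
  then have "partition_fun TYPE('d) lam T = (\<Prod>j\<in>(UNIV :: 'd set). inverse (2 * sinh (lam * T / 2)))"
    unfolding partition_fun_def exp_osc_energy by (rule infsumI)
  also have "\<dots> = inverse ((2 * sinh (lam * T / 2)) ^ CARD('d))"
    by (simp only: prod_constant power_inverse)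
  also have "\<dots> = (2 * sinh (lam * T / 2)) powr (- real CARD('d))"
    using sh by (subst powr_minus, subst powr_realpow) auto
  finally show ?thesis .
qed

lemma mehler_diagonal:
  fixes x :: "real ^ 'd::finite"
  assumes "0 < T" "0 < lam"
  shows "mehler lam x T x = (2 * pi * sinh (lam * T) / lam) powr (- real CARD('d) / 2)
     * exp (- (lam * (cosh (lam * T) - 1) / sinh (lam * T)) * (norm x)\<^sup>2)"
proof -
  have "sinh (lam * T) > 0" using assms by simp
  then have "- (lam * (cosh (lam * T) * ((norm x)\<^sup>2 + (norm x)\<^sup>2) - 2 * (x \<bullet> x))) / (2 * sinh (lam * T))
     = - (lam * (cosh (lam * T) - 1) / sinh (lam * T)) * (norm x)\<^sup>2"
    unfolding power2_norm_eq_inner[symmetric] by (simp add: divide_simps) (simp add: algebra_simps)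
  then show ?thesis unfolding mehler_def by (simp only: minus_divide_left)
qed

text \<open>The generating function at \<open>w = exp (- lam T)\<close>, rewritten with \<open>2 sinh (lam T) = 1 / w - w\<close> and
  \<open>(cosh (lam T) - 1) / sinh (lam T) = (1 - w) / (1 + w)\<close>.\<close>

lemma hermite_fun_scaled_sq_sum:
  assumes "0 < T" "0 < lam"
  shows "((\<lambda>m. exp (- (lam * T) * (real m + 1 / 2)) * (hermite_fun_scaled lam m x)\<^sup>2) has_sum
    ((2 * pi * sinh (lam * T) / lam) powr (- 1 / 2)
      * exp (- (lam * (cosh (lam * T) - 1) / sinh (lam * T)) * x\<^sup>2))) UNIV"
proof -
  define w where "w = exp (- (lam * T))"
  have w: "0 < w" "w < 1" using assms by (auto simp: w_def)
  have sh: "sinh (lam * T) > 0" using assms by simp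
  have L: "(lam powr (1/4))\<^sup>2 = sqrt lam" using assms
    by (simp add: power2_eq_square powr_add[symmetric] powr_half_sqrt)
  define C where "C = exp (- (lam * T) / 2) * sqrt lam * exp (- (lam * x\<^sup>2)) / sqrt pi"
  have summand: "exp (- (lam * T) * (real m + 1 / 2)) * (hermite_fun_scaled lam m x)\<^sup>2
      = C * (hermite_sq (sqrt lam * x) m * w ^ m)" for m
  proof -
    have "exp (- (lam * T) * (real m + 1 / 2)) = exp (- (lam * T) / 2) * w ^ m"
      by (simp add: w_def exp_of_nat_mult[symmetric] exp_add[symmetric] algebra_simps)
    then show ?thesis using assms
      by (simp add: hermite_fun_scaled_def power_mult_distrib hermite_fun_sq L C_def)
  qed
  have "(\<lambda>m. C * (hermite_sq (sqrt lam * x) m * w ^ m)) sums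
     (C * ((1 - w\<^sup>2) powr (-1/2) * exp (2 * (sqrt lam * x)\<^sup>2 * w / (1 + w))))"
    by (intro sums_mult hermite_sq_generating_function) (use w in auto)
  moreover have "C * ((1 - w\<^sup>2) powr (-1/2) * exp (2 * (sqrt lam * x)\<^sup>2 * w / (1 + w)))
     = (2 * pi * sinh (lam * T) / lam) powr (- 1 / 2)
      * exp (- (lam * (cosh (lam * T) - 1) / sinh (lam * T)) * x\<^sup>2)"
  proof -
    have sw: "2 * sinh (lam * T) = 1 / w - w" "2 * cosh (lam * T) = 1 / w + w"
    proof -
      have "exp (lam * T) = 1 / w" by (simp add: w_def exp_minus inverse_eq_divide)
      then show "2 * sinh (lam * T) = 1 / w - w" "2 * cosh (lam * T) = 1 / w + w"
        unfolding sinh_field_def cosh_field_def w_def[symmetric] by simp_all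
    qed
    have p: "1 - w\<^sup>2 > 0" using w by (simp add: power_less_one_iff)
    have "exp (- (lam * T) / 2) = sqrt w"
    proof (rule real_sqrt_unique[symmetric])
      show "(exp (- (lam * T) / 2))\<^sup>2 = w"
        unfolding power2_eq_square exp_add[symmetric] w_def by simp
    qed simp
    moreover have "2 * pi * sinh (lam * T) / lam = pi * (1 - w\<^sup>2) / (w * lam)"
    proof -
      have "2 * pi * sinh (lam * T) / lam = pi * (2 * sinh (lam * T)) / lam" by simp
      also have "\<dots> = pi * (1 - w\<^sup>2) / (w * lam)"
        unfolding sw using w assms by (simp add: field_simps power2_eq_square)
      finally show ?thesis .
    qed
    ultimately have 1: "exp (- (lam * T) / 2) * sqrt lam / sqrt pi * (1 - w\<^sup>2) powr (-1/2)
        = (2 * pi * sinh (lam * T) / lam) powr (- 1 / 2)"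
    proof (simp only:, goal_cases)
      case 1
      have h: "a powr (-1/2) = 1 / sqrt a" if "a > 0" for a :: real
        using that by (simp add: powr_minus_divide powr_half_sqrt)
      have "pi * (1 - w\<^sup>2) / (w * lam) > 0" using w p assms by simp
      then show ?case using w p assms
        by (simp only: h) (simp add: real_sqrt_mult real_sqrt_divide)
    qed
    have "(cosh (lam * T) - 1) / sinh (lam * T) = (2 * cosh (lam * T) - 2) / (2 * sinh (lam * T))"
    proof -
      have "(c - 1) / s = (2 * c - 2) / (2 * s)" for c s :: real by (cases "s = 0") (auto simp: field_simps)
      then show ?thesis .
    qed
    also have "\<dots> = (1 - w)\<^sup>2 / (1 - w\<^sup>2)" unfolding sw using w p
      by (simp add: divide_simps) (simp add: algebra_simps power2_eq_square)
    also have "1 - w\<^sup>2 = (1 - w) * (1 + w)" by (simp add: algebra_simps power2_eq_square)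
    also have "(1 - w)\<^sup>2 / ((1 - w) * (1 + w)) = (1 - w) / (1 + w)" using w by (simp add: power2_eq_square)
    finally have ct: "(cosh (lam * T) - 1) / sinh (lam * T) = (1 - w) / (1 + w)" .
    have "- (lam * x\<^sup>2) + 2 * (sqrt lam * x)\<^sup>2 * w / (1 + w) = - (lam * ((1 - w) / (1 + w))) * x\<^sup>2"
      using w assms by (simp add: power_mult_distrib divide_simps) (simp add: algebra_simps)
    then have "exp (- (lam * x\<^sup>2)) * exp (2 * (sqrt lam * x)\<^sup>2 * w / (1 + w))
       = exp (- (lam * (cosh (lam * T) - 1) / sinh (lam * T)) * x\<^sup>2)"
      unfolding exp_add[symmetric] times_divide_eq_right[symmetric] ct by simp
    note 2 = this
    have 3: "e * s * E / p * (P * F) = (e * s / p * P) * (E * F)" for e s E p P F :: real by simp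
    show ?thesis unfolding C_def 3 1 2 ..
  qed
  ultimately have "(\<lambda>m. exp (- (lam * T) * (real m + 1 / 2)) * (hermite_fun_scaled lam m x)\<^sup>2) sums
     ((2 * pi * sinh (lam * T) / lam) powr (- 1 / 2)
      * exp (- (lam * (cosh (lam * T) - 1) / sinh (lam * T)) * x\<^sup>2))"
    by (simp only: summand)
  from sums_nonneg_imp_has_sum[OF this] show ?thesis by simp
qed

text \<open>Mehler's formula on the diagonal: the eigenfunction expansion of the heat kernel of the
  oscillator at coinciding points.  It is the link between the operator \<^const>\<open>density_operator\<close> and
  the process, and it follows coordinate by coordinate.\<close>

lemma mehler_diagonal_expansion:
  fixes x :: "real ^ 'd::finite"
  assumes "0 < T" "0 < lam"
  shows "((\<lambda>m. exp (- T * osc_energy lam m) * (osc_eigenfun lam m x)\<^sup>2) has_sum mehler lam x T x) UNIV"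
proof -
  have sh: "2 * pi * sinh (lam * T) / lam > 0" using assms by simp
  have "((\<lambda>m :: nat ^ 'd. \<Prod>j\<in>UNIV. exp (- (lam * T) * (real (m $ j) + 1 / 2)) * (hermite_fun_scaled lam (m $ j) (x $ j))\<^sup>2)
     has_sum (\<Prod>j\<in>UNIV. (2 * pi * sinh (lam * T) / lam) powr (- 1 / 2)
      * exp (- (lam * (cosh (lam * T) - 1) / sinh (lam * T)) * (x $ j)\<^sup>2))) UNIV"
    by (rule has_sum_prod_vec) (use hermite_fun_scaled_sq_sum[OF assms] sh assms in auto)
  moreover have "(\<Prod>j\<in>UNIV. exp (- (lam * T) * (real (m $ j) + 1 / 2)) * (hermite_fun_scaled lam (m $ j) (x $ j))\<^sup>2)
     = exp (- T * osc_energy lam m) * (osc_eigenfun lam m x)\<^sup>2" for m :: "nat ^ 'd"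
    unfolding exp_osc_energy osc_eigenfun_def by (simp add: prod.distrib prod_power_distrib)
  moreover have "(\<Prod>j\<in>UNIV. (2 * pi * sinh (lam * T) / lam) powr (- 1 / 2)
      * exp (- (lam * (cosh (lam * T) - 1) / sinh (lam * T)) * (x $ j)\<^sup>2)) = mehler lam x T x"
  proof -
    have "(\<Prod>j\<in>(UNIV :: 'd set). (2 * pi * sinh (lam * T) / lam) powr (- 1 / 2))
      = (2 * pi * sinh (lam * T) / lam) powr (- real CARD('d) / 2)"
    proof -
      have "(\<Prod>j\<in>(UNIV :: 'd set). a powr (- 1 / 2)) = a powr (- real CARD('d) / 2)" if "a > 0" for a :: real
      proof -
        have "(\<Prod>j\<in>(UNIV :: 'd set). a powr (- 1 / 2)) = (a powr (- 1 / 2)) powr real CARD('d)"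
          using that by (subst powr_realpow) auto
        then show ?thesis by (simp add: powr_powr)
      qed
      then show ?thesis using sh by blast
    qed
    moreover have "(\<Prod>j\<in>UNIV. exp (- (lam * (cosh (lam * T) - 1) / sinh (lam * T)) * (x $ j)\<^sup>2))
      = exp (- (lam * (cosh (lam * T) - 1) / sinh (lam * T)) * (norm x)\<^sup>2)"
    proof -
      have "(\<Sum>j\<in>UNIV. (x $ j)\<^sup>2) = (norm x)\<^sup>2"
        unfolding power2_norm_eq_inner inner_vec_def by (simp add: power2_eq_square)
      then show ?thesis by (simp only: exp_sum[OF finite, symmetric] sum_distrib_left[symmetric])
    qed
    ultimately show ?thesis unfolding mehler_diagonal[OF assms] by (simp add: prod.distrib)
  qed
  ultimately show ?thesis by simp
qed

lemma hermite_measurable: "hermite m \<in> borel_measurable borel"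
proof -
  have "continuous_on UNIV (hermite m)"
    by (cases m) (auto intro!: continuous_at_imp_continuous_on DERIV_isCont hermite_deriv)
  then show ?thesis by (rule borel_measurable_continuous_onI)
qed

lemma osc_eigenfun_measurable: "osc_eigenfun lam m \<in> borel_measurable (borel :: (real ^ 'd::finite) measure)"
proof -
  note [measurable] = hermite_measurable
  have [measurable]: "hermite_fun_scaled lam k \<in> borel_measurable borel" for k
    unfolding hermite_fun_scaled_def hermite_fun_def rodrigues by measurable
  show ?thesis unfolding osc_eigenfun_def by measurable
qed

section \<open>The semigroup property of the Mehler kernel\<close>

lemma borel_measurable_mehler [measurable (raw)]:
  fixes f g :: "'b \<Rightarrow> real ^ 'd::finite"
  assumes [measurable]: "f \<in> borel_measurable N" "g \<in> borel_measurable N"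
  shows "(\<lambda>w. mehler lam (f w) t (g w)) \<in> borel_measurable N"
  unfolding mehler_def by measurable

lemma mehler_sym: "mehler lam x t y = mehler lam y t x"
  unfolding mehler_def by (simp add: add.commute inner_commute)

lemma mehler_pos: "0 < lam \<Longrightarrow> 0 < t \<Longrightarrow> 0 < mehler lam x t y"
  unfolding mehler_def by simp

lemma nn_integral_gaussian_real:
  assumes A: "A > 0"
  shows "(\<integral>\<^sup>+x. ennreal (exp (- (A * x\<^sup>2))) \<partial>lborel) = ennreal (sqrt (pi / A))"
proof -
  define s where "s = sqrt (1 / (2 * A))"
  have s: "s > 0" "s\<^sup>2 = 1 / (2 * A)" using A by (auto simp: s_def)
  have "exp (- (A * x\<^sup>2)) = sqrt (pi / A) * normal_density 0 s x" for x
    using A unfolding normal_density_def s(2) by (simp add: field_simps)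
  then have "(\<integral>\<^sup>+x. ennreal (exp (- (A * x\<^sup>2))) \<partial>lborel)
      = (\<integral>\<^sup>+x. ennreal (sqrt (pi / A)) * ennreal (normal_density 0 s x) \<partial>lborel)"
    using A by (simp add: ennreal_mult'[symmetric])
  also have "\<dots> = ennreal (sqrt (pi / A)) * (\<integral>\<^sup>+x. ennreal (normal_density 0 s x) \<partial>lborel)"
    by (rule nn_integral_cmult) simp
  also have "(\<integral>\<^sup>+x. ennreal (normal_density 0 s x) \<partial>lborel) = 1"
    using s by (subst nn_integral_eq_integral) auto
  finally show ?thesis by simp
qed

lemma nn_integral_lborel_translate:
  fixes f :: "'a::euclidean_space \<Rightarrow> ennreal"
  assumes [measurable]: "f \<in> borel_measurable borel"
  shows "(\<integral>\<^sup>+x. f (x + c) \<partial>lborel) = (\<integral>\<^sup>+x. f x \<partial>lborel)"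
proof -
  have "(\<integral>\<^sup>+x. f x \<partial>lborel) = (\<integral>\<^sup>+x. f x \<partial>distr lborel borel ((+) c))"
    by (simp only: lborel_distr_plus)
  also have "\<dots> = (\<integral>\<^sup>+x. f (c + x) \<partial>lborel)" by (subst nn_integral_distr) auto
  finally show ?thesis by (simp add: add.commute)
qed

lemma nn_integral_gaussian:
  fixes m :: "'a::euclidean_space"
  assumes A: "A > 0"
  shows "(\<integral>\<^sup>+x. ennreal (exp (- (A * (norm (x - m))\<^sup>2))) \<partial>lborel) = ennreal ((pi / A) powr (real DIM('a) / 2))"
proof -
  have "(\<integral>\<^sup>+x. ennreal (exp (- (A * (norm (x - m))\<^sup>2))) \<partial>lborel)
      = (\<integral>\<^sup>+x. ennreal (exp (- (A * (norm x)\<^sup>2))) \<partial>(lborel :: 'a measure))"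
    using nn_integral_lborel_translate[of "\<lambda>x. ennreal (exp (- (A * (norm x)\<^sup>2)))" "- m"] by simp
  also have "\<dots> = (\<integral>\<^sup>+x. (\<Prod>b\<in>Basis. ennreal (exp (- (A * (x \<bullet> b)\<^sup>2)))) \<partial>(lborel :: 'a measure))"
  proof (intro nn_integral_cong)
    fix x :: 'a
    have "exp (- (A * (norm x)\<^sup>2)) = (\<Prod>b\<in>Basis. exp (- (A * (x \<bullet> b)\<^sup>2)))"
    proof -
      have "(norm x)\<^sup>2 = (\<Sum>b\<in>Basis. (x \<bullet> b)\<^sup>2)"
        unfolding power2_norm_eq_inner by (subst euclidean_inner) (simp add: power2_eq_square)
      then show ?thesis by (simp add: exp_sum[symmetric] sum_negf sum_distrib_left[symmetric])
    qed
    then show "ennreal (exp (- (A * (norm x)\<^sup>2))) = (\<Prod>b\<in>Basis. ennreal (exp (- (A * (x \<bullet> b)\<^sup>2))))"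
      by (simp add: prod_ennreal)
  qed
  also have "\<dots> = (\<Prod>b\<in>(Basis :: 'a set). \<integral>\<^sup>+x. ennreal (exp (- (A * x\<^sup>2))) \<partial>lborel)"
    by (rule nn_integral_lborel_prod) auto
  also have "\<dots> = ennreal (sqrt (pi / A)) ^ DIM('a)"
    by (simp add: nn_integral_gaussian_real[OF A])
  also have "\<dots> = ennreal ((pi / A) powr (real DIM('a) / 2))"
    using A by (simp add: ennreal_power powr_half_sqrt[symmetric] powr_realpow[symmetric] powr_powr)
  finally show ?thesis .
qed

text \<open>The quadratic form in the exponent of the Mehler kernel.  It is the classical action of the
  Euclidean oscillator between its two arguments in time \<open>t\<close>.\<close>

definition mehler_exponent :: "real \<Rightarrow> real \<Rightarrow> 'a::real_inner \<Rightarrow> 'a \<Rightarrow> real" where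
  "mehler_exponent lam t x y = lam * (cosh (lam * t) * (x \<bullet> x + y \<bullet> y) - 2 * (x \<bullet> y)) / (2 * sinh (lam * t))"

lemma mehler_eq_exp:
  "mehler lam x t y = (2 * pi * sinh (lam * t) / lam) powr (- real CARD('d) / 2) * exp (- mehler_exponent lam t x y)"
  for x y :: "real ^ 'd::finite"
  by (simp add: mehler_def mehler_exponent_def power2_norm_eq_inner)

text \<open>Completing the square in the intermediate point \<open>z\<close>.  The minimizer is the value at time \<open>s\<close> of
  the solution of \<open>c'' = lam\<^sup>2 c\<close> from \<open>x\<close> to \<open>y\<close>, and the minimum is the action over the total time.\<close>

lemma mehler_exponent_convolution:
  fixes x y z :: "'a::real_inner"
  assumes "0 < lam" "0 < s" "0 < t"
  shows "mehler_exponent lam s x z + mehler_exponent lam t z y =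
    (lam * sinh (lam * (s + t)) / (2 * sinh (lam * s) * sinh (lam * t)))
      * (norm (z - ((sinh (lam * t) / sinh (lam * (s + t))) *\<^sub>R x + (sinh (lam * s) / sinh (lam * (s + t))) *\<^sub>R y)))\<^sup>2
    + mehler_exponent lam (s + t) x y"
proof -
  define S1 S2 C1 C2 S C where "S1 = sinh (lam * s)" and "S2 = sinh (lam * t)" and "C1 = cosh (lam * s)"
    and "C2 = cosh (lam * t)" and "S = sinh (lam * (s + t))" and "C = cosh (lam * (s + t))"
  have pos: "S1 > 0" "S2 > 0" "S > 0" using assms by (auto simp: S1_def S2_def S_def)
  have S: "S = S1 * C2 + C1 * S2" and C: "C = C1 * C2 + S1 * S2"
    by (simp_all add: S_def C_def S1_def S2_def C1_def C2_def distrib_left sinh_add cosh_add)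
  have q: "C1 * C1 = 1 + S1 * S1" "C2 * C2 = 1 + S2 * S2"
    using cosh_square_eq[of "lam * s"] cosh_square_eq[of "lam * t"]
    by (simp_all add: C1_def S1_def C2_def S2_def power2_eq_square)
  have r1: "C1 * S - C * S1 = S2" "C2 * S - C * S2 = S1"
    unfolding S C using q by algebra+
  define m where "m = (S2 / S) *\<^sub>R x + (S1 / S) *\<^sub>R y"
  define xx yy zz xz yz xy where "xx = x \<bullet> x" and "yy = y \<bullet> y" and "zz = z \<bullet> z" and "xz = x \<bullet> z"
    and "yz = y \<bullet> z" and "xy = x \<bullet> y"
  have n: "(norm (z - m))\<^sup>2 = zz - 2 * (S2 * xz + S1 * yz) / S + (S2 * S2 * xx + 2 * S1 * S2 * xy + S1 * S1 * yy) / (S * S)"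
    using pos unfolding power2_norm_eq_inner m_def xx_def yy_def zz_def xz_def yz_def xy_def
    by (simp add: inner_diff_left inner_diff_right inner_add_left inner_add_right inner_commute field_simps)
  have "lam * (C1 * (xx + zz) - 2 * xz) / (2 * S1) + lam * (C2 * (zz + yy) - 2 * yz) / (2 * S2)
      = (lam * S / (2 * S1 * S2)) * (zz - 2 * (S2 * xz + S1 * yz) / S + (S2 * S2 * xx + 2 * S1 * S2 * xy + S1 * S1 * yy) / (S * S))
       + lam * (C * (xx + yy) - 2 * xy) / (2 * S)" (is "?L = ?R")
  proof -
    have "(?L - ?R) * (2 * S1 * S2 * S) = 0"
    proof -
      have "?L * (2 * S1 * S2 * S) = lam * S2 * S * (C1 * (xx + zz) - 2 * xz) + lam * S1 * S * (C2 * (zz + yy) - 2 * yz)"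
        using pos by (simp add: field_simps)
      moreover have "?R * (2 * S1 * S2 * S) = lam * (S * S * zz - 2 * S * (S2 * xz + S1 * yz) + (S2 * S2 * xx + 2 * S1 * S2 * xy + S1 * S1 * yy))
         + lam * S1 * S2 * (C * (xx + yy) - 2 * xy)"
        using pos by (simp add: field_simps)
      moreover have "lam * S2 * S * (C1 * (xx + zz) - 2 * xz) + lam * S1 * S * (C2 * (zz + yy) - 2 * yz)
        = lam * (S * S * zz - 2 * S * (S2 * xz + S1 * yz) + (S2 * S2 * xx + 2 * S1 * S2 * xy + S1 * S1 * yy))
         + lam * S1 * S2 * (C * (xx + yy) - 2 * xy)"
      proof -
        have "S * (S2 * C1 + S1 * C2) = S * S" using S by (simp add: algebra_simps)
        moreover have "S2 * (C1 * S - C * S1) = S2 * S2" "S1 * (C2 * S - C * S2) = S1 * S1" using r1 by auto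
        ultimately show ?thesis by algebra
      qed
      ultimately show ?thesis by (simp add: algebra_simps)
    qed
    then show ?thesis using pos by simp
  qed
  then show ?thesis
    unfolding mehler_exponent_def S1_def[symmetric] S2_def[symmetric] C1_def[symmetric] C2_def[symmetric]
      S_def[symmetric] C_def[symmetric] m_def[symmetric] n inner_commute[of z y]
      xx_def[symmetric] yy_def[symmetric] zz_def[symmetric] xz_def[symmetric] yz_def[symmetric] xy_def[symmetric] .
qed

text \<open>After completing the square, one Gaussian integral is left.  Its value turns the product of the two
  prefactors into the prefactor for the total time.\<close>

lemma mehler_Chapman_Kolmogorov:
  fixes x y :: "real ^ 'd::finite"
  assumes l: "0 < lam" and s: "0 < s" and t: "0 < t"
  shows "(\<integral>\<^sup>+z. ennreal (mehler lam x s z * mehler lam z t y) \<partial>lborel) = ennreal (mehler lam x (s + t) y)"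
proof -
  define A where "A = lam * sinh (lam * (s + t)) / (2 * sinh (lam * s) * sinh (lam * t))"
  define m where "m = (sinh (lam * t) / sinh (lam * (s + t))) *\<^sub>R x + (sinh (lam * s) / sinh (lam * (s + t))) *\<^sub>R y"
  define N where "N t = (2 * pi * sinh (lam * t) / lam) powr (- real CARD('d) / 2)" for t
  have sh: "sinh (lam * s) > 0" "sinh (lam * t) > 0" "sinh (lam * (s + t)) > 0" using assms by auto
  have A: "A > 0" unfolding A_def using sh l by simp
  have N: "N t \<ge> 0" for t by (simp add: N_def)
  have "mehler lam x s z * mehler lam z t y
     = (N s * N t * exp (- mehler_exponent lam (s + t) x y)) * exp (- (A * (norm (z - m))\<^sup>2))" for z
  proof -
    have "mehler lam x s z * mehler lam z t y = N s * N t * exp (- (mehler_exponent lam s x z + mehler_exponent lam t z y))"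
      by (simp add: mehler_eq_exp N_def exp_add[symmetric])
    then show ?thesis
      unfolding mehler_exponent_convolution[OF assms] A_def m_def by (simp add: exp_add[symmetric])
  qed
  then have "(\<integral>\<^sup>+z. ennreal (mehler lam x s z * mehler lam z t y) \<partial>lborel)
     = (\<integral>\<^sup>+z. ennreal (N s * N t * exp (- mehler_exponent lam (s + t) x y)) * ennreal (exp (- (A * (norm (z - m))\<^sup>2))) \<partial>lborel)"
    by (simp add: ennreal_mult'[symmetric] N)
  also have "\<dots> = ennreal (N s * N t * exp (- mehler_exponent lam (s + t) x y)) * ennreal ((pi / A) powr (real CARD('d) / 2))"
    by (subst nn_integral_cmult) (simp_all add: nn_integral_gaussian[OF A])
  also have "\<dots> = ennreal (N s * N t * (pi / A) powr (real CARD('d) / 2) * exp (- mehler_exponent lam (s + t) x y))"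
    by (simp add: ennreal_mult'[symmetric] N mult_ac)
  also have "N s * N t * (pi / A) powr (real CARD('d) / 2) = N (s + t)"
  proof -
    have e: "a powr (real CARD('d) / 2) = (1 / a) powr (- real CARD('d) / 2)" if "a > 0" for a :: real
      using that by (simp add: powr_divide powr_minus_divide)
    have f: "1 / (pi / A) = A / pi" by simp
    have "N s * N t * (pi / A) powr (real CARD('d) / 2)
       = ((2 * pi * sinh (lam * s) / lam) * (2 * pi * sinh (lam * t) / lam) * (A / pi)) powr (- real CARD('d) / 2)"
      unfolding N_def e[OF divide_pos_pos[OF pi_gt_zero A]] f by (simp only: powr_mult)
    also have "(2 * pi * sinh (lam * s) / lam) * (2 * pi * sinh (lam * t) / lam) * (A / pi) = 2 * pi * sinh (lam * (s + t)) / lam"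
    proof -
      have "(2 * pi * a / l) * (2 * pi * b / l) * (l * S / (2 * a * b) / pi) = 2 * pi * S / l"
        if "a > 0" "b > 0" "l > 0" for a b S l :: real
        using that by (simp add: field_simps)
      from this[OF sh(1,2) l] show ?thesis unfolding A_def .
    qed
    finally show ?thesis by (simp add: N_def)
  qed
  finally show ?thesis by (simp add: mehler_eq_exp N_def)
qed

section \<open>Symmetries of the product Lebesgue measure\<close>

lemma PiM_lborel_reindex:
  fixes p :: "'i \<Rightarrow> 'j"
  assumes p: "bij_betw p I J" and I: "finite I"
    and f [measurable]: "f \<in> borel_measurable (\<Pi>\<^sub>M i\<in>I. (lborel :: 'a::euclidean_space measure))"
  shows "(\<integral>\<^sup>+v. f (\<lambda>i\<in>I. v (p i)) \<partial>(\<Pi>\<^sub>M j\<in>J. lborel)) = (\<integral>\<^sup>+v. f v \<partial>(\<Pi>\<^sub>M i\<in>I. lborel))"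
proof -
  interpret product_sigma_finite "\<lambda>_. lborel :: 'a measure" ..
  have J: "finite J" using p I bij_betw_finite by blast
  have pJ: "p i \<in> J" if "i \<in> I" for i using p that by (auto dest: bij_betwE)
  have m [measurable]: "(\<lambda>v. \<lambda>i\<in>I. v (p i)) \<in> (\<Pi>\<^sub>M j\<in>J. lborel) \<rightarrow>\<^sub>M (\<Pi>\<^sub>M i\<in>I. (lborel :: 'a measure))"
    by (intro measurable_restrict measurable_component_singleton pJ)
  have d: "distr (\<Pi>\<^sub>M j\<in>J. lborel) (\<Pi>\<^sub>M i\<in>I. (lborel :: 'a measure)) (\<lambda>v. \<lambda>i\<in>I. v (p i)) = (\<Pi>\<^sub>M i\<in>I. lborel)"
  proof (rule PiM_eqI[OF I])
    fix A :: "'i \<Rightarrow> 'a set" assume A: "\<And>i. i \<in> I \<Longrightarrow> A i \<in> sets lborel"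
    define q where "q = inv_into I p"
    have q: "q (p i) = i" if "i \<in> I" for i using p that by (simp add: q_def bij_betw_inv_into_left)
    have qJ: "q j \<in> I" "p (q j) = j" if "j \<in> J" for j
      using p that by (auto simp: q_def bij_betw_inv_into_right bij_betw_def inv_into_into)
    have "(\<lambda>v. \<lambda>i\<in>I. v (p i)) -` Pi\<^sub>E I A \<inter> space (\<Pi>\<^sub>M j\<in>J. (lborel :: 'a measure)) = Pi\<^sub>E J (\<lambda>j. A (q j))"
    proof (intro equalityI subsetI)
      fix v assume v: "v \<in> (\<lambda>v. \<lambda>i\<in>I. v (p i)) -` Pi\<^sub>E I A \<inter> space (\<Pi>\<^sub>M j\<in>J. (lborel :: 'a measure))"
      then have "v (p i) \<in> A i" if "i \<in> I" for i using that by (auto simp: PiE_def Pi_def)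
      from this[OF qJ(1)] v qJ show "v \<in> Pi\<^sub>E J (\<lambda>j. A (q j))" by (auto simp: space_PiM PiE_def Pi_def)
    next
      fix v assume "v \<in> Pi\<^sub>E J (\<lambda>j. A (q j))"
      then show "v \<in> (\<lambda>v. \<lambda>i\<in>I. v (p i)) -` Pi\<^sub>E I A \<inter> space (\<Pi>\<^sub>M j\<in>J. (lborel :: 'a measure))"
        using q pJ by (fastforce simp: space_PiM PiE_def Pi_def)
    qed
    moreover have "emeasure (\<Pi>\<^sub>M j\<in>J. lborel) (Pi\<^sub>E J (\<lambda>j. A (q j))) = (\<Prod>j\<in>J. emeasure lborel (A (q j)))"
      using A qJ J by (intro emeasure_PiM) auto
    moreover have "\<dots> = (\<Prod>i\<in>I. emeasure lborel (A i))"
      using q by (subst prod.reindex_bij_betw[OF p, symmetric]) (auto intro: prod.cong)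
    moreover have "Pi\<^sub>E I A \<in> sets (\<Pi>\<^sub>M i\<in>I. (lborel :: 'a measure))" using A I by (intro sets_PiM_I_finite) auto
    ultimately show "emeasure (distr (\<Pi>\<^sub>M j\<in>J. lborel) (\<Pi>\<^sub>M i\<in>I. lborel) (\<lambda>v. \<lambda>i\<in>I. v (p i))) (Pi\<^sub>E I A)
      = (\<Prod>i\<in>I. emeasure lborel (A i))"
      by (subst emeasure_distr) (auto simp: m)
  qed simp
  show ?thesis
    by (subst d[symmetric], subst nn_integral_distr) auto
qed

lemma PiM_lborel_translate:
  fixes c :: "'i \<Rightarrow> 'a::euclidean_space"
  assumes I: "finite I" and f [measurable]: "f \<in> borel_measurable (\<Pi>\<^sub>M i\<in>I. (lborel :: 'a measure))"
  shows "(\<integral>\<^sup>+v. f (\<lambda>i\<in>I. v i + c i) \<partial>(\<Pi>\<^sub>M i\<in>I. lborel)) = (\<integral>\<^sup>+v. f v \<partial>(\<Pi>\<^sub>M i\<in>I. lborel))"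
proof -
  interpret product_sigma_finite "\<lambda>_. lborel :: 'a measure" ..
  have m [measurable]: "(\<lambda>v. \<lambda>i\<in>I. v i + c i) \<in> (\<Pi>\<^sub>M i\<in>I. lborel) \<rightarrow>\<^sub>M (\<Pi>\<^sub>M i\<in>I. (lborel :: 'a measure))"
    by (intro measurable_restrict) measurable
  have d: "distr (\<Pi>\<^sub>M i\<in>I. lborel) (\<Pi>\<^sub>M i\<in>I. (lborel :: 'a measure)) (\<lambda>v. \<lambda>i\<in>I. v i + c i) = (\<Pi>\<^sub>M i\<in>I. lborel)"
  proof (rule PiM_eqI[OF I])
    fix A :: "'i \<Rightarrow> 'a set" assume A: "\<And>i. i \<in> I \<Longrightarrow> A i \<in> sets lborel"
    have "(\<lambda>v. \<lambda>i\<in>I. v i + c i) -` Pi\<^sub>E I A \<inter> space (\<Pi>\<^sub>M i\<in>I. (lborel :: 'a measure))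
        = Pi\<^sub>E I (\<lambda>i. (\<lambda>x. x + c i) -` A i)"
      by (auto simp: space_PiM PiE_def Pi_def)
    moreover have "(\<lambda>x. x + c i) -` A i \<in> sets lborel" if "i \<in> I" for i
      using measurable_sets[of "\<lambda>x. x + c i" borel borel "A i"] A[OF that] by simp
    then have "emeasure (\<Pi>\<^sub>M i\<in>I. lborel) (Pi\<^sub>E I (\<lambda>i. (\<lambda>x. x + c i) -` A i))
       = (\<Prod>i\<in>I. emeasure lborel ((\<lambda>x. x + c i) -` A i))"
      by (intro emeasure_PiM I) auto
    moreover have "emeasure lborel ((\<lambda>x. x + c i) -` A i) = emeasure lborel (A i)" if "i \<in> I" for i
    proof -
      have "emeasure lborel (A i) = emeasure (distr lborel borel ((+) (c i))) (A i)" by (simp only: lborel_distr_plus)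
      also have "\<dots> = emeasure lborel ((+) (c i) -` A i)" using A[OF that] by (subst emeasure_distr) auto
      also have "(+) (c i) -` A i = (\<lambda>x. x + c i) -` A i" by (auto simp: add.commute)
      finally show ?thesis by simp
    qed
    moreover have "Pi\<^sub>E I A \<in> sets (\<Pi>\<^sub>M i\<in>I. (lborel :: 'a measure))" using A I by (intro sets_PiM_I_finite) auto
    ultimately show "emeasure (distr (\<Pi>\<^sub>M i\<in>I. lborel) (\<Pi>\<^sub>M i\<in>I. lborel) (\<lambda>v. \<lambda>i\<in>I. v i + c i)) (Pi\<^sub>E I A)
      = (\<Prod>i\<in>I. emeasure lborel (A i))"
      by (subst emeasure_distr) (auto simp: m intro: prod.cong)
  qed simp
  show ?thesis
    by (subst (2) d[symmetric], subst nn_integral_distr) auto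
qed

section \<open>Finite-dimensional distributions\<close>

text \<open>The cyclic product of Mehler kernels along \<open>v 0, \<dots>, v n\<close>: the last factor closes the loop from
  \<open>v n\<close> back to \<open>v 0\<close> in the time that is left of the period \<open>T\<close>.  Only
  differences of the times enter.\<close>

definition loop_density :: "real \<Rightarrow> real \<Rightarrow> nat \<Rightarrow> (nat \<Rightarrow> real) \<Rightarrow> (nat \<Rightarrow> real ^ 'd::finite) \<Rightarrow> real" where
  "loop_density lam T n s v = inverse (partition_fun TYPE('d) lam T) *
     ((\<Prod>k=1..n. mehler lam (v k) (s k - s (k - 1)) (v (k - 1))) * mehler lam (v 0) (T - (s n - s 0)) (v n))"

abbreviation lebesgue_upto :: "nat \<Rightarrow> (nat \<Rightarrow> real ^ 'd::finite) measure" where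
  "lebesgue_upto n \<equiv> \<Pi>\<^sub>M k\<in>{0..n}. lborel"

lemma loop_density_measurable [measurable]:
  "loop_density lam T n s \<in> borel_measurable (lebesgue_upto n :: (nat \<Rightarrow> real ^ 'd::finite) measure)"
proof -
  have "(\<lambda>v. v k) \<in> borel_measurable (lebesgue_upto n :: (nat \<Rightarrow> real ^ 'd) measure)" if "k \<le> n" for k
    using measurable_component_singleton[of k "{0..n}" "\<lambda>_. lborel :: (real ^ 'd) measure"] that by simp
  then have "(\<lambda>v. loop_density lam T n s v) \<in> borel_measurable (lebesgue_upto n :: (nat \<Rightarrow> real ^ 'd) measure)"
    unfolding loop_density_def
    by (intro borel_measurable_times borel_measurable_const borel_measurable_prod borel_measurable_mehler) auto
  then show ?thesis .
qed

lemma loop_density_nonneg: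
  assumes "0 < lam" "0 < T" "\<And>k. k < n \<Longrightarrow> s k < s (Suc k)" "s n - s 0 < T"
  shows "0 < loop_density lam T n s v"
proof -
  have "0 < partition_fun TYPE('d::finite) lam T"
    using assms(1,2) by (simp add: partition_fun_eq)
  moreover have "s (k - 1) < s k" if "k \<in> {1..n}" for k
    using assms(3)[of "k - 1"] that by auto
  ultimately show ?thesis unfolding loop_density_def using assms
    by (intro mult_pos_pos prod_pos mehler_pos) auto
qed

abbreviation rect :: "nat \<Rightarrow> (nat \<Rightarrow> (real ^ 'd::finite) set) \<Rightarrow> (nat \<Rightarrow> real ^ 'd) set" where
  "rect n F \<equiv> \<Pi>\<^sub>E k\<in>{0..n}. F k"

lemma sets_PiE_upto:
  "(\<And>k. k \<le> n \<Longrightarrow> F k \<in> sets borel) \<Longrightarrow> rect n F \<in> sets (lebesgue_upto n)"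
  by (intro sets_PiM_I_finite) auto

locale periodic_oscillator =
  fixes lam T :: real and M :: "'w measure" and Z :: "real \<Rightarrow> 'w \<Rightarrow> real ^ 'd::finite"
  assumes T_pos: "0 < T" and lam_pos: "0 < lam"
    and assoc: "associated_bernstein_process lam T (mu_bar lam T) M Z"
begin

lemma process: "process_on M T Z" and prob_M: "prob_space M" and complete_M: "complete_measure M"
  using assoc by (auto simp: associated_bernstein_process_def bernstein_process_def)

sublocale prob_space M by (rule prob_M)

lemma Z_measurable: "0 \<le> t \<Longrightarrow> t \<le> T \<Longrightarrow> Z t \<in> borel_measurable M"
  using process by (auto simp: process_on_def)

lemma inv_part_pos: "inverse (partition_fun TYPE('d) lam T) > 0"
  using T_pos lam_pos by (simp add: partition_fun_eq)

text \<open>Under \<^const>\<open>mu_bar\<close> both endpoints are the same point \<open>x\<close>.  Its density \<open>mehler lam x T x\<close> cancels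
  against the denominator in the law of the process, which leaves the cyclic product, with \<open>x\<close> as its
  entry \<open>0\<close>.  The conditions at the times \<open>0\<close> and \<open>T\<close> are conditions on this same entry.\<close>

lemma law_from_zero:
  fixes F :: "nat \<Rightarrow> (real ^ 'd) set"
  assumes n: "1 \<le> n" and t0: "t 0 = 0" and t: "\<And>k. k < n \<Longrightarrow> t k < t (Suc k)" and tn: "t n < T"
    and F: "\<And>k. k \<le> n \<Longrightarrow> F k \<in> sets borel" and G: "G \<in> sets borel"
  shows "emeasure M {\<omega> \<in> space M. (\<forall>k\<le>n. Z (t k) \<omega> \<in> F k) \<and> Z T \<omega> \<in> G} =
    (\<integral>\<^sup>+v\<in>rect n (F(0 := F 0 \<inter> G)). ennreal (loop_density lam T n t v) \<partial>lebesgue_upto n)"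
proof -
  interpret product_sigma_finite "\<lambda>_. lborel :: (real ^ 'd) measure" ..
  define Zinv where "Zinv = inverse (partition_fun TYPE('d) lam T)"
  have Zinv_pos: "Zinv > 0" unfolding Zinv_def by (rule inv_part_pos)
  define P where "P = (\<lambda>(y :: real ^ 'd) v. (\<Prod>k=1..n. mehler lam (v k) (t k - t (k - 1)) (v (k - 1))) * mehler lam y (T - t n) (v n))"
  define f where "f v = ennreal (loop_density lam T n t v) * indicator (rect n (F(0 := F 0 \<inter> G))) v" for v
  define inner where "inner x y = (\<integral>\<^sup>+u\<in>(\<Pi>\<^sub>E k\<in>{1..n}. F k). ennreal (P y (u(0 := x))) \<partial>(\<Pi>\<^sub>M k\<in>{1..n}. lborel))" for x y
  have [measurable]: "F 0 \<in> sets borel" "G \<in> sets borel" using F G by auto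
  have box [measurable]: "(\<Pi>\<^sub>E k\<in>{1..n}. F k) \<in> sets (\<Pi>\<^sub>M k\<in>{1..n}. (lborel :: (real ^ 'd) measure))"
    using F by (intro sets_PiM_I_finite) auto
  have upd [measurable]: "(\<lambda>w. ((snd w)(0 := fst (fst w))) k) \<in>
      borel_measurable ((borel \<Otimes>\<^sub>M borel) \<Otimes>\<^sub>M (\<Pi>\<^sub>M k\<in>{1..n}. (lborel :: (real ^ 'd) measure)))" if "k \<le> n" for k
  proof (cases "k = 0")
    case False
    then have "k \<in> {1..n}" using that by auto
    then have "(\<lambda>w. snd w k) \<in> (borel \<Otimes>\<^sub>M borel) \<Otimes>\<^sub>M (\<Pi>\<^sub>M k\<in>{1..n}. (lborel :: (real ^ 'd) measure)) \<rightarrow>\<^sub>M lborel"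
      by (intro measurable_compose[OF measurable_snd measurable_component_singleton])
    then show ?thesis using False by simp
  qed simp
  have Pm: "(\<lambda>w. P (snd (fst w)) ((snd w)(0 := fst (fst w)))) \<in>
      borel_measurable ((borel \<Otimes>\<^sub>M borel) \<Otimes>\<^sub>M (\<Pi>\<^sub>M k\<in>{1..n}. (lborel :: (real ^ 'd) measure)))"
    unfolding P_def
    by (intro borel_measurable_times borel_measurable_prod borel_measurable_mehler upd
        measurable_compose[OF measurable_fst measurable_snd]) auto
  have inner_m: "(\<lambda>p. inner (fst p) (snd p)) \<in> borel_measurable (borel \<Otimes>\<^sub>M (borel :: (real ^ 'd) measure))"
    unfolding inner_def
  proof (rule sigma_finite_measure.borel_measurable_nn_integral)
    show "sigma_finite_measure (\<Pi>\<^sub>M k\<in>{1..n}. (lborel :: (real ^ 'd) measure))" by (rule sigma_finite) simp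
    show "(\<lambda>(p, u). ennreal (P (snd p) (u(0 := fst p))) * indicator (\<Pi>\<^sub>E k\<in>{1..n}. F k) u)
        \<in> borel_measurable ((borel \<Otimes>\<^sub>M borel) \<Otimes>\<^sub>M (\<Pi>\<^sub>M k\<in>{1..n}. (lborel :: (real ^ 'd) measure)))"
      unfolding case_prod_unfold using Pm by measurable
  qed
  have inner_xx: "(\<lambda>x. inner x x) \<in> borel_measurable borel"
    using measurable_compose[OF _ inner_m, of "\<lambda>x. (x, x)" borel] by simp
  have "emeasure M {\<omega> \<in> space M. (\<forall>k\<le>n. Z (t k) \<omega> \<in> F k) \<and> Z T \<omega> \<in> G} =
     (\<integral>\<^sup>+p\<in>F 0 \<times> G. (case p of (x, y) \<Rightarrow> ennreal (1 / mehler lam x T y) * inner x y) \<partial>mu_bar lam T)"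
    unfolding inner_def P_def using assoc n t0 t tn F G
    unfolding associated_bernstein_process_def Let_def by blast
  also have "\<dots> = (\<integral>\<^sup>+p. ennreal (Zinv * mehler lam (fst p) T (snd p)) *
      (ennreal (1 / mehler lam (fst p) T (snd p)) * inner (fst p) (snd p) * indicator (F 0 \<times> G) p) \<partial>diag_measure)"
    unfolding mu_bar_def case_prod_unfold Zinv_def using inner_m
    by (subst nn_integral_density) (simp_all add: diag_measure_def)
  also have "\<dots> = (\<integral>\<^sup>+x. ennreal (Zinv * mehler lam x T x) *
      (ennreal (1 / mehler lam x T x) * inner x x * indicator (F 0 \<times> G) (x, x)) \<partial>lborel)"
    unfolding diag_measure_def using inner_m by (subst nn_integral_distr) auto
  also have "\<dots> = (\<integral>\<^sup>+x. ennreal Zinv * inner x x * indicator (F 0 \<inter> G) x \<partial>lborel)"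
  proof (intro nn_integral_cong)
    fix x :: "real ^ 'd"
    have m: "mehler lam x T x > 0" using mehler_pos lam_pos T_pos by blast
    have "ennreal (Zinv * mehler lam x T x) * ennreal (1 / mehler lam x T x) = ennreal Zinv"
      using m Zinv_pos by (subst ennreal_mult'[symmetric]) (auto intro: order_less_imp_le)
    then show "ennreal (Zinv * mehler lam x T x) * (ennreal (1 / mehler lam x T x) * inner x x * indicator (F 0 \<times> G) (x, x))
       = ennreal Zinv * inner x x * indicator (F 0 \<inter> G) x"
      by (auto simp: indicator_def mult.assoc[symmetric])
  qed
  also have "\<dots> = (\<integral>\<^sup>+x. (\<integral>\<^sup>+u. f (u(0 := x)) \<partial>(\<Pi>\<^sub>M k\<in>{1..n}. lborel)) \<partial>lborel)"
  proof (intro nn_integral_cong)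
    fix x :: "real ^ 'd"
    have [measurable]: "(\<lambda>u. P x (u(0 := x))) \<in> borel_measurable (\<Pi>\<^sub>M k\<in>{1..n}. (lborel :: (real ^ 'd) measure))"
      using measurable_compose[OF measurable_Pair1'[of "(x, x)"] Pm] by (simp add: space_pair_measure)
    have "ennreal Zinv * inner x x * indicator (F 0 \<inter> G) x
      = (\<integral>\<^sup>+u. (ennreal Zinv * indicator (F 0 \<inter> G) x) * (ennreal (P x (u(0 := x))) * indicator (\<Pi>\<^sub>E k\<in>{1..n}. F k) u) \<partial>(\<Pi>\<^sub>M k\<in>{1..n}. lborel))"
      unfolding inner_def by (subst nn_integral_cmult) (measurable, simp only: mult_ac)
    also have "\<dots> = (\<integral>\<^sup>+u. f (u(0 := x)) \<partial>(\<Pi>\<^sub>M k\<in>{1..n}. lborel))"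
    proof (intro nn_integral_cong)
      fix u assume u: "u \<in> space (\<Pi>\<^sub>M k\<in>{1..n}. (lborel :: (real ^ 'd) measure))"
      then have ext: "u \<in> extensional {1..n}" by (simp add: space_PiM PiE_def)
      have "loop_density lam T n t (u(0 := x)) = Zinv * P x (u(0 := x))"
        by (simp add: loop_density_def P_def t0 Zinv_def)
      then have 1: "ennreal (loop_density lam T n t (u(0 := x))) = ennreal Zinv * ennreal (P x (u(0 := x)))"
        using Zinv_pos by (simp add: ennreal_mult')
      have "u(0 := x) \<in> extensional {0..n}"
        using ext by (auto simp: extensional_def)
      then have "u(0 := x) \<in> rect n (F(0 := F 0 \<inter> G)) \<longleftrightarrow> x \<in> F 0 \<inter> G \<and> u \<in> (\<Pi>\<^sub>E k\<in>{1..n}. F k)"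
        using ext n by (auto simp: PiE_def Pi_def split: if_splits) 
      then show "(ennreal Zinv * indicator (F 0 \<inter> G) x) * (ennreal (P x (u(0 := x))) * indicator (\<Pi>\<^sub>E k\<in>{1..n}. F k) u)
        = f (u(0 := x))"
        unfolding f_def 1 by (auto simp: indicator_def)
    qed
    finally show "ennreal Zinv * inner x x * indicator (F 0 \<inter> G) x
      = (\<integral>\<^sup>+u. f (u(0 := x)) \<partial>(\<Pi>\<^sub>M k\<in>{1..n}. lborel))" .
  qed
  also have "\<dots> = (\<integral>\<^sup>+v. f v \<partial>lebesgue_upto n)"
  proof -
    have ins: "{0..n} = insert 0 {1..n}" by auto
    have "rect n (F(0 := F 0 \<inter> G)) \<in> sets (lebesgue_upto n)"
      using F G by (intro sets_PiE_upto) auto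
    then have "f
      \<in> borel_measurable (lebesgue_upto n)" unfolding f_def[abs_def] by measurable
    then show ?thesis
      using product_nn_integral_insert_rev[of "{1..n}" 0 f]
      unfolding ins[symmetric] by simp
  qed
  finally show ?thesis unfolding f_def .
qed

lemma law_no_endpoint:
  assumes n: "1 \<le> n" and t0: "t 0 = 0" and t: "\<And>k. k < n \<Longrightarrow> t k < t (Suc k)" and tn: "t n < T"
    and F: "\<And>k. k \<le> n \<Longrightarrow> F k \<in> sets borel"
  shows "emeasure M {\<omega> \<in> space M. \<forall>k\<le>n. Z (t k) \<omega> \<in> F k} =
    (\<integral>\<^sup>+v\<in>rect n F. ennreal (loop_density lam T n t v) \<partial>lebesgue_upto n)"
proof -
  have e: "F(0 := F 0 \<inter> UNIV) = F" by simp
  have "emeasure M {\<omega> \<in> space M. (\<forall>k\<le>n. Z (t k) \<omega> \<in> F k) \<and> Z T \<omega> \<in> UNIV} =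
    (\<integral>\<^sup>+v\<in>(\<Pi>\<^sub>E k\<in>{0..n}. (F(0 := F 0 \<inter> UNIV)) k). ennreal (loop_density lam T n t v) \<partial>lebesgue_upto n)"
    by (rule law_from_zero) (use assms in auto)
  then show ?thesis unfolding e by simp
qed

text \<open>The path is a loop: outside a null set, every set of a countable basis that contains the initial
  point also contains the final point.\<close>

lemma endpoints_AE_equal: "AE \<omega> in M. Z T \<omega> = Z 0 \<omega>"
proof -
  define t :: "nat \<Rightarrow> real" where "t = (\<lambda>k. if k = 0 then 0 else T / 2)"
  have [measurable]: "Z 0 \<in> borel_measurable M" "Z T \<in> borel_measurable M"
    using T_pos by (auto intro!: Z_measurable)
  \<comment> \<open>Both conditions fall on the entry \<open>0\<close> of the cyclic product, where they contradict each other.\<close>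
  have half: "emeasure M {\<omega> \<in> space M. Z 0 \<omega> \<in> F \<and> Z T \<omega> \<in> - F} = 0" if [measurable]: "F \<in> sets borel" for F
  proof -
    have "emeasure M {\<omega> \<in> space M. (\<forall>k\<le>1. Z (t k) \<omega> \<in> (if k = 0 then F else UNIV)) \<and> Z T \<omega> \<in> - F} =
      (\<integral>\<^sup>+v\<in>(\<Pi>\<^sub>E k\<in>{0..1}. ((\<lambda>k :: nat. if k = 0 then F else UNIV)(0 := (if (0::nat) = 0 then F else UNIV) \<inter> - F)) k).
         ennreal (loop_density lam T 1 t v) \<partial>lebesgue_upto 1)"
      by (rule law_from_zero) (use T_pos in \<open>auto simp: t_def\<close>)
    also have "(\<Pi>\<^sub>E k\<in>{0..1}. ((\<lambda>k :: nat. if k = 0 then F else UNIV)(0 := (if (0::nat) = 0 then F else UNIV) \<inter> - F)) k) = {}"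
      by (auto simp: PiE_def Pi_def intro!: exI[of _ 0])
    also have "{\<omega> \<in> space M. (\<forall>k\<le>1. Z (t k) \<omega> \<in> (if k = 0 then F else UNIV)) \<and> Z T \<omega> \<in> - F}
      = {\<omega> \<in> space M. Z 0 \<omega> \<in> F \<and> Z T \<omega> \<in> - F}"
      by (auto simp: t_def split: if_splits dest: spec[of _ 0])
    finally show ?thesis by simp
  qed
  obtain B :: "(real ^ 'd) set set" where B: "countable B" "topological_basis B"
    using ex_countable_basis by auto
  have "AE \<omega> in M. \<forall>F\<in>B. \<not> (Z 0 \<omega> \<in> F \<and> Z T \<omega> \<in> - F)"
  proof (subst AE_ball_countable[OF B(1)], intro ballI)
    fix F assume "F \<in> B"
    then have "open F" using B(2) by (metis topological_basis_open)
    then have [measurable]: "F \<in> sets borel" by simp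
    show "AE \<omega> in M. \<not> (Z 0 \<omega> \<in> F \<and> Z T \<omega> \<in> - F)"
      by (rule AE_I[OF _ half[of F]]) auto
  qed
  then show ?thesis
  proof eventually_elim
    case (elim \<omega>)
    show ?case
    proof (rule ccontr)
      assume "Z T \<omega> \<noteq> Z 0 \<omega>"
      then obtain U where "open U" "Z 0 \<omega> \<in> U" "Z T \<omega> \<notin> U"
        by (metis separation_t1)
      then obtain F where "F \<in> B" "Z 0 \<omega> \<in> F" "F \<subseteq> U"
        using B(2) by (meson topological_basisE)
      then show False using elim \<open>Z T \<omega> \<notin> U\<close> by auto
    qed
  qed
qed

text \<open>The law of the process is only prescribed together with at least one interior time.  For the two
  times \<open>0\<close> and \<open>T / 2\<close> the cyclic product is symmetric in its two entries.\<close>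

lemma start_and_half_time_same_law:
  assumes A: "A \<in> sets borel"
  shows "emeasure M {\<omega> \<in> space M. Z 0 \<omega> \<in> A} = emeasure M {\<omega> \<in> space M. Z (T / 2) \<omega> \<in> A}"
proof -
  define t :: "nat \<Rightarrow> real" where "t = (\<lambda>k. if k = 0 then 0 else T / 2)"
  define F :: "nat \<Rightarrow> nat \<Rightarrow> (real ^ 'd) set" where "F = (\<lambda>j k. if k = j then A else UNIV)"
  have Fm: "F j k \<in> sets borel" for j k using A by (simp add: F_def)
  have law_t: "emeasure M {\<omega> \<in> space M. \<forall>k\<le>1. Z (t k) \<omega> \<in> F j k} =
      (\<integral>\<^sup>+v\<in>(\<Pi>\<^sub>E k\<in>{0..1}. F j k). ennreal (loop_density lam T 1 t v) \<partial>lebesgue_upto 1)" for j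
    by (rule law_no_endpoint) (use T_pos Fm in \<open>auto simp: t_def\<close>)
  have "(\<integral>\<^sup>+v\<in>(\<Pi>\<^sub>E k\<in>{0..1}. F 0 k). ennreal (loop_density lam T 1 t v) \<partial>lebesgue_upto 1)
    = (\<integral>\<^sup>+v. (\<lambda>w. ennreal (loop_density lam T 1 t w) * indicator (\<Pi>\<^sub>E k\<in>{0..1}. F 1 k) w) (\<lambda>k\<in>{0..1}. v (1 - k)) \<partial>lebesgue_upto 1)"
  proof (rule nn_integral_cong)
    fix v :: "nat \<Rightarrow> real ^ 'd" assume "v \<in> space (lebesgue_upto 1)"
    then have "v \<in> (\<Pi>\<^sub>E k\<in>{0..1}. F 0 k) \<longleftrightarrow> (\<lambda>k\<in>{0..1}. v (1 - k)) \<in> (\<Pi>\<^sub>E k\<in>{0..1}. F 1 k)"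
      by (auto simp: space_PiM PiE_def Pi_def F_def)
    moreover have "loop_density lam T 1 t v = loop_density lam T 1 t (\<lambda>k\<in>{0..1}. v (1 - k))"
      by (simp add: loop_density_def t_def mehler_sym)
    ultimately show "ennreal (loop_density lam T 1 t v) * indicator (\<Pi>\<^sub>E k\<in>{0..1}. F 0 k) v
      = ennreal (loop_density lam T 1 t (\<lambda>k\<in>{0..1}. v (1 - k))) * indicator (\<Pi>\<^sub>E k\<in>{0..1}. F 1 k) (\<lambda>k\<in>{0..1}. v (1 - k))"
      by (simp only: indicator_def)
  qed
  also have "\<dots> = (\<integral>\<^sup>+v\<in>(\<Pi>\<^sub>E k\<in>{0..1}. F 1 k). ennreal (loop_density lam T 1 t v) \<partial>lebesgue_upto 1)"
  proof (rule PiM_lborel_reindex)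
    show "bij_betw (\<lambda>k. 1 - k) {0..1} {0..1::nat}" by (rule bij_betwI[where g="\<lambda>k. 1 - k"]) auto
    have "(\<Pi>\<^sub>E k\<in>{0..1}. F 1 k) \<in> sets (lebesgue_upto 1)" by (rule sets_PiE_upto[OF Fm])
    then show "(\<lambda>w. ennreal (loop_density lam T 1 t w) * indicator (\<Pi>\<^sub>E k\<in>{0..1}. F 1 k) w) \<in> borel_measurable (lebesgue_upto 1)"
      by measurable
  qed simp
  finally have "emeasure M {\<omega> \<in> space M. \<forall>k\<le>1. Z (t k) \<omega> \<in> F 0 k} = emeasure M {\<omega> \<in> space M. \<forall>k\<le>1. Z (t k) \<omega> \<in> F 1 k}"
    unfolding law_t .
  moreover have "(\<forall>k\<le>1. Z (t k) \<omega> \<in> F 0 k) \<longleftrightarrow> Z 0 \<omega> \<in> A" "(\<forall>k\<le>1. Z (t k) \<omega> \<in> F 1 k) \<longleftrightarrow> Z (T / 2) \<omega> \<in> A" for \<omega>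
    by (auto simp: t_def F_def split: if_splits)
  ultimately show ?thesis by simp
qed

text \<open>If time \<open>0\<close> is not observed, then integrating out its position with the Chapman-Kolmogorov equation
  merges the two kernels next to it into the one that closes the loop.\<close>

lemma law_interior:
  assumes s0: "0 < s 0" and s: "\<And>k. k < n \<Longrightarrow> s k < s (Suc k)" and sn: "s n < T"
    and F: "\<And>k. k \<le> n \<Longrightarrow> F k \<in> sets borel"
  shows "emeasure M {\<omega> \<in> space M. \<forall>k\<le>n. Z (s k) \<omega> \<in> F k} =
    (\<integral>\<^sup>+v\<in>rect n F. ennreal (loop_density lam T n s v) \<partial>lebesgue_upto n)"
proof -
  interpret product_sigma_finite "\<lambda>_. lborel :: (real ^ 'd) measure" ..
  define t :: "nat \<Rightarrow> real" where "t = (\<lambda>k. if k = 0 then 0 else s (k - 1))"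
  define F' :: "nat \<Rightarrow> (real ^ 'd) set" where "F' = (\<lambda>k. if k = 0 then UNIV else F (k - 1))"
  define Zinv where "Zinv = inverse (partition_fun TYPE('d) lam T)"
  define f where "f v = ennreal (loop_density lam T (Suc n) t v) * indicator (rect (Suc n) F') v" for v
  define g where "g w = ennreal (loop_density lam T n s w) * indicator (rect n F) w" for w
  define J where "J = {1..Suc n}"
  have J: "finite J" "0 \<notin> J" "{0..Suc n} = insert 0 J" by (auto simp: J_def)
  have ev: "{\<omega> \<in> space M. \<forall>k\<le>n. Z (s k) \<omega> \<in> F k} = {\<omega> \<in> space M. \<forall>k\<le>Suc n. Z (t k) \<omega> \<in> F' k}"
  proof -
    have "(\<forall>k\<le>n. Z (s k) \<omega> \<in> F k) \<longleftrightarrow> (\<forall>k\<le>Suc n. Z (t k) \<omega> \<in> F' k)" for \<omega>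
      unfolding t_def F'_def by (auto split: if_splits)
    then show ?thesis by simp
  qed
  have tmono: "t k < t (Suc k)" if "k < Suc n" for k
    using that s0 s[of "k - 1"] by (auto simp: t_def)
  have F'm: "F' k \<in> sets borel" if "k \<le> Suc n" for k using F[of "k - 1"] that by (auto simp: F'_def)
  have box: "rect (Suc n) F' \<in> sets (lebesgue_upto (Suc n))" by (rule sets_PiE_upto[OF F'm])
  have box0: "rect n F \<in> sets (lebesgue_upto n)" by (rule sets_PiE_upto[OF F])
  have "emeasure M {\<omega> \<in> space M. \<forall>k\<le>n. Z (s k) \<omega> \<in> F k} =
    (\<integral>\<^sup>+v\<in>rect (Suc n) F'. ennreal (loop_density lam T (Suc n) t v) \<partial>lebesgue_upto (Suc n))"
    unfolding ev by (rule law_no_endpoint) (use sn tmono F'm in \<open>auto simp: t_def\<close>)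
  also have "\<dots> = (\<integral>\<^sup>+u. (\<integral>\<^sup>+x. f (u(0 := x)) \<partial>lborel) \<partial>(\<Pi>\<^sub>M k\<in>J. lborel))"
  proof -
    have "f \<in> borel_measurable (lebesgue_upto (Suc n))" unfolding f_def[abs_def] using box by measurable
    then show ?thesis
      unfolding f_def[symmetric] unfolding J(3) by (intro product_nn_integral_insert J) auto
  qed
  also have "\<dots> = (\<integral>\<^sup>+u. g (\<lambda>k\<in>{0..n}. u (Suc k)) \<partial>(\<Pi>\<^sub>M k\<in>J. lborel))"
  proof (intro nn_integral_cong)
    fix u assume "u \<in> space (\<Pi>\<^sub>M k\<in>J. (lborel :: (real ^ 'd) measure))"
    then have ext: "u \<in> extensional J" by (simp add: space_PiM PiE_def)
    define w where "w = (\<lambda>k\<in>{0..n}. u (Suc k))"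
    define R where "R = (\<Prod>j=1..n. mehler lam (u (Suc j)) (s j - s (j - 1)) (u j))"
    have R0: "R \<ge> 0"
      unfolding R_def
    proof (intro prod_nonneg order_less_imp_le mehler_pos lam_pos)
      fix j assume "j \<in> {1..n}"
      then show "0 < s j - s (j - 1)" using s[of "j - 1"] by auto
    qed
    have Zp: "Zinv > 0" unfolding Zinv_def by (rule inv_part_pos)
    have dens: "loop_density lam T (Suc n) t (u(0 := x))
       = (Zinv * R) * (mehler lam (u 1) (s 0) x * mehler lam x (T - s n) (u (Suc n)))" for x
    proof -
      let ?g = "\<lambda>k. mehler lam ((u(0 := x)) k) (t k - t (k - 1)) ((u(0 := x)) (k - 1))"
      have "(\<Prod>k=1..Suc n. ?g k) = ?g 1 * (\<Prod>k=Suc 1..Suc n. ?g k)"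
        by (rule prod.atLeast_Suc_atMost) simp
      also have "(\<Prod>k=Suc 1..Suc n. ?g k) = (\<Prod>k=1..n. ?g (Suc k))"
        by (rule prod.shift_bounds_cl_Suc_ivl)
      also have "\<dots> = R" unfolding R_def by (intro prod.cong) (auto simp: t_def)
      finally show ?thesis unfolding loop_density_def Zinv_def by (simp add: t_def)
    qed
    have ind: "u(0 := x) \<in> rect (Suc n) F' \<longleftrightarrow> w \<in> rect n F" for x
    proof
      assume a: "u(0 := x) \<in> rect (Suc n) F'"
      have "w k \<in> F k" if "k \<le> n" for k
        using PiE_mem[OF a, of "Suc k"] that by (simp add: w_def F'_def)
      then show "w \<in> rect n F" by (auto simp: w_def)
    next
      assume a: "w \<in> rect n F"
      have "u (Suc k) \<in> F k" if "k \<le> n" for k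
        using PiE_mem[OF a, of k] that by (simp add: w_def)
      then have "(u(0 := x)) k \<in> F' k" if "k \<le> Suc n" for k
        using that by (cases k) (auto simp: F'_def)
      then show "u(0 := x) \<in> rect (Suc n) F'"
        using ext by (auto simp: PiE_def Pi_def extensional_def J_def)
    qed
    have "(\<integral>\<^sup>+x. f (u(0 := x)) \<partial>lborel)
      = (\<integral>\<^sup>+x. (ennreal (Zinv * R) * indicator (rect n F) w) * ennreal (mehler lam (u 1) (s 0) x * mehler lam x (T - s n) (u (Suc n))) \<partial>lborel)"
      using R0 Zp by (intro nn_integral_cong) (simp add: f_def dens ind indicator_def ennreal_mult')
    also have "\<dots> = (ennreal (Zinv * R) * indicator (rect n F) w) * ennreal (mehler lam (u 1) (s 0 + (T - s n)) (u (Suc n)))"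
      using s0 sn lam_pos by (subst nn_integral_cmult) (auto simp: mehler_Chapman_Kolmogorov)
    also have "\<dots> = ennreal (loop_density lam T n s w) * indicator (rect n F) w"
    proof -
      have e1: "(\<Prod>k=1..n. mehler lam (w k) (s k - s (k - 1)) (w (k - 1))) = R"
        unfolding R_def by (intro prod.cong) (auto simp: w_def)
      have e2: "T - (s n - s 0) = s 0 + (T - s n)" by simp
      have "loop_density lam T n s w = (Zinv * R) * mehler lam (u 1) (s 0 + (T - s n)) (u (Suc n))"
        unfolding loop_density_def Zinv_def e1 e2 by (simp add: w_def)
      then show ?thesis using R0 Zp by (simp add: ennreal_mult' mult_ac)
    qed
    finally show "(\<integral>\<^sup>+x. f (u(0 := x)) \<partial>lborel)
      = g (\<lambda>k\<in>{0..n}. u (Suc k))"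
      unfolding w_def g_def .
  qed
  also have "\<dots> = (\<integral>\<^sup>+v. g v \<partial>lebesgue_upto n)"
  proof (rule PiM_lborel_reindex)
    show "bij_betw Suc {0..n} J" unfolding J_def bij_betw_def by (auto simp: image_Suc_atLeastAtMost)
    show "g \<in> borel_measurable (lebesgue_upto n)"
      unfolding g_def[abs_def] using box0 by measurable
  qed simp
  finally show ?thesis unfolding g_def .
qed

lemma loop_density_zero:
  "loop_density lam T 0 s v = inverse (partition_fun TYPE('d) lam T) * mehler lam (v 0) T (v 0 :: real ^ 'd)"
  by (simp add: loop_density_def)

text \<open>The law at \<open>T / 2\<close>, hence also at \<open>0\<close>, comes from \<open>law_interior\<close>, and the cyclic product of a
  single kernel does not depend on the time.\<close>

lemma law_at_zero:
  assumes F: "F 0 \<in> sets borel"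
  shows "emeasure M {\<omega> \<in> space M. Z 0 \<omega> \<in> F 0} =
    (\<integral>\<^sup>+v\<in>rect 0 F. ennreal (loop_density lam T 0 s v) \<partial>lebesgue_upto 0)"
  using law_interior[of "\<lambda>_. T / 2" 0 F] start_and_half_time_same_law[OF F] F T_pos
  by (simp add: loop_density_zero)

text \<open>If the last time is \<open>T\<close>, then its position is the one at time \<open>0\<close>, and the formula is that of
  \<open>law_from_zero\<close> with the positions rotated by one place.\<close>

lemma law_at_end:
  assumes s0: "0 < s 0" and s: "\<And>k. k < Suc m \<Longrightarrow> s k < s (Suc k)" and sn: "s (Suc m) = T"
    and F: "\<And>k. k \<le> Suc m \<Longrightarrow> F k \<in> sets borel"
  shows "emeasure M {\<omega> \<in> space M. \<forall>k\<le>Suc m. Z (s k) \<omega> \<in> F k} =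
    (\<integral>\<^sup>+v\<in>rect (Suc m) F. ennreal (loop_density lam T (Suc m) s v) \<partial>lebesgue_upto (Suc m))"
proof -
  define n where "n = Suc m"
  define t :: "nat \<Rightarrow> real" where "t = (\<lambda>k. if k = 0 then 0 else s (k - 1))"
  define F' :: "nat \<Rightarrow> (real ^ 'd) set" where "F' = (\<lambda>k. if k = 0 then UNIV else F (k - 1))"
  define Zinv where "Zinv = inverse (partition_fun TYPE('d) lam T)"
  \<comment> \<open>The rotation of the positions.\<close>
  define p where "p = (\<lambda>k. if k < n then Suc k else 0)"
  have p: "bij_betw p {0..n} {0..n}"
    by (rule bij_betwI[where g="\<lambda>k. if k = 0 then n else k - 1"]) (auto simp: p_def)
  have ev: "{\<omega> \<in> space M. \<forall>k\<le>n. Z (s k) \<omega> \<in> F k} = {\<omega> \<in> space M. (\<forall>k\<le>n. Z (t k) \<omega> \<in> F' k) \<and> Z T \<omega> \<in> F n}"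
  proof -
    have "(\<forall>k\<le>n. Z (s k) \<omega> \<in> F k) \<longleftrightarrow> (\<forall>k\<le>m. Z (s k) \<omega> \<in> F k) \<and> Z T \<omega> \<in> F n" for \<omega>
      unfolding n_def by (metis le_Suc_eq sn order_refl)
    moreover have "(\<forall>k\<le>m. Z (s k) \<omega> \<in> F k) \<longleftrightarrow> (\<forall>k\<le>n. Z (t k) \<omega> \<in> F' k)" for \<omega>
      unfolding t_def F'_def n_def by (auto split: if_splits)
    ultimately show ?thesis by simp
  qed
  have tmono: "t k < t (Suc k)" if "k < n" for k
    using that s0 s[of "k - 1"] by (auto simp: t_def n_def)
  have F'm: "F' k \<in> sets borel" if "k \<le> n" for k using F[of "k - 1"] that by (auto simp: F'_def n_def)
  have Fn: "F n \<in> sets borel" using F by (simp add: n_def)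
  have tn: "t n < T" using s[of m] sn by (simp add: t_def n_def)
  have dens: "loop_density lam T n t v = loop_density lam T n s (\<lambda>k\<in>{0..n}. v (p k))" for v :: "nat \<Rightarrow> real ^ 'd"
  proof -
    define w where "w = (\<lambda>k\<in>{0..n}. v (p k))"
    have w: "w n = v 0" "\<And>k. k \<le> m \<Longrightarrow> w k = v (Suc k)" by (auto simp: w_def p_def n_def)
    let ?g = "\<lambda>k. mehler lam (v k) (t k - t (k - 1)) (v (k - 1))"
    let ?h = "\<lambda>k. mehler lam (w k) (s k - s (k - 1)) (w (k - 1))"
    let ?R = "\<Prod>j=1..m. mehler lam (v (Suc j)) (s j - s (j - 1)) (v j)"
    have "(\<Prod>k=1..Suc m. ?g k) = ?g 1 * (\<Prod>k=Suc 1..Suc m. ?g k)"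
      by (rule prod.atLeast_Suc_atMost) simp
    also have "(\<Prod>k=Suc 1..Suc m. ?g k) = (\<Prod>k=1..m. ?g (Suc k))"
      by (rule prod.shift_bounds_cl_Suc_ivl)
    also have "\<dots> = ?R" by (intro prod.cong) (auto simp: t_def)
    finally have 1: "(\<Prod>k=1..n. ?g k) = mehler lam (v 1) (s 0) (v 0) * ?R" by (simp add: t_def n_def)
    have "(\<Prod>k=1..Suc m. ?h k) = (\<Prod>k=1..m. ?h k) * ?h (Suc m)" by simp
    also have "(\<Prod>k=1..m. ?h k) = ?R" using w by (intro prod.cong) auto
    also have "?h (Suc m) = mehler lam (v 0) (T - s m) (v n)" using w sn by (simp add: n_def)
    finally have 2: "(\<Prod>k=1..n. ?h k) = ?R * mehler lam (v 0) (T - s m) (v n)" by (simp add: n_def)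
    have 3: "mehler lam (v 0) (T - (t n - t 0)) (v n) = mehler lam (v 0) (T - s m) (v n)"
      by (simp add: t_def n_def)
    have 4: "mehler lam (w 0) (T - (s n - s 0)) (w n) = mehler lam (v 1) (s 0) (v 0)"
      using w sn by (simp add: n_def)
    show ?thesis unfolding w_def[symmetric] loop_density_def 1 2 3 4 by (simp add: mult_ac)
  qed
  have ind: "v \<in> rect n (F'(0 := F' 0 \<inter> F n)) \<longleftrightarrow> (\<lambda>k\<in>{0..n}. v (p k)) \<in> rect n F"
    if v: "v \<in> space (lebesgue_upto n)" for v :: "nat \<Rightarrow> real ^ 'd"
  proof -
    have all_Suc: "(\<forall>k\<le>Suc m. P k) \<longleftrightarrow> P 0 \<and> (\<forall>k\<le>m. P (Suc k))" for P
      by (metis Suc_le_mono bot_nat_0.extremum not0_implies_Suc)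
    have "v \<in> rect n (F'(0 := F' 0 \<inter> F n)) \<longleftrightarrow> (\<forall>k\<le>n. v k \<in> (F'(0 := F' 0 \<inter> F n)) k)"
      using v by (auto simp: space_PiM PiE_def Pi_def)
    also have "\<dots> \<longleftrightarrow> v 0 \<in> F n \<and> (\<forall>k\<le>m. v (Suc k) \<in> F k)"
      unfolding n_def all_Suc by (simp add: F'_def)
    also have "\<dots> \<longleftrightarrow> (\<forall>k\<le>n. v (p k) \<in> F k)"
      unfolding n_def p_def by (auto simp: le_Suc_eq)
    also have "\<dots> \<longleftrightarrow> (\<lambda>k\<in>{0..n}. v (p k)) \<in> rect n F"
      by (auto simp: PiE_def Pi_def)
    finally show ?thesis .
  qed
  have box0: "rect n F \<in> sets (lebesgue_upto n)" using F by (intro sets_PiE_upto) (simp add: n_def)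
  have "emeasure M {\<omega> \<in> space M. \<forall>k\<le>n. Z (s k) \<omega> \<in> F k} =
    (\<integral>\<^sup>+v\<in>rect n (F'(0 := F' 0 \<inter> F n)). ennreal (loop_density lam T n t v) \<partial>lebesgue_upto n)"
    unfolding ev by (rule law_from_zero) (use tn tmono F'm Fn in \<open>auto simp: t_def n_def\<close>)
  also have "\<dots> = (\<integral>\<^sup>+v. (\<lambda>w. ennreal (loop_density lam T n s w) * indicator (rect n F) w) (\<lambda>k\<in>{0..n}. v (p k)) \<partial>lebesgue_upto n)"
    by (intro nn_integral_cong) (simp only: dens ind indicator_def)
  also have "\<dots> = (\<integral>\<^sup>+v\<in>rect n F. ennreal (loop_density lam T n s v) \<partial>lebesgue_upto n)"
    using box0 by (intro PiM_lborel_reindex p) auto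
  finally show ?thesis unfolding n_def .
qed

text \<open>All finite-dimensional distributions at times that do not contain both \<open>0\<close> and \<open>T\<close>.  Since the
  cyclic product sees only time differences, stationarity can be read off from this formula.\<close>

theorem law:
  assumes s_range: "0 \<le> s 0" "s n \<le> T" "s n - s 0 < T" and s: "\<And>k. k < n \<Longrightarrow> s k < s (Suc k)"
    and F: "\<And>k. k \<le> n \<Longrightarrow> F k \<in> sets borel"
  shows "emeasure M {\<omega> \<in> space M. \<forall>k\<le>n. Z (s k) \<omega> \<in> F k} =
    (\<integral>\<^sup>+v\<in>rect n F. ennreal (loop_density lam T n s v) \<partial>lebesgue_upto n)"
proof -
  consider "s 0 = 0" "n = 0" | "s 0 = 0" "n \<noteq> 0" | "0 < s 0" "s n < T" | "0 < s 0" "s n = T" "n = 0"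
    | "0 < s 0" "s n = T" "n \<noteq> 0" using s_range by force
  then show ?thesis
  proof cases
    case 1
    then show ?thesis using law_at_zero[of F s] F by simp
  next
    case 2
    then show ?thesis using s_range by (intro law_no_endpoint s F) auto
  next
    case 3
    then show ?thesis by (intro law_interior s F)
  next
    case 4
    have [measurable]: "F 0 \<in> sets borel" "Z 0 \<in> borel_measurable M" "Z T \<in> borel_measurable M"
      using F Z_measurable[of 0] Z_measurable[of T] T_pos by auto
    have "emeasure M {\<omega> \<in> space M. Z T \<omega> \<in> F 0} = emeasure M {\<omega> \<in> space M. Z 0 \<omega> \<in> F 0}"
      by (rule emeasure_eq_AE) (use endpoints_AE_equal in auto)
    then show ?thesis using 4 law_at_zero[of F s] F by simp
  next
    case 5
    then obtain m where m: "n = Suc m" by (cases n) auto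
    show ?thesis unfolding m by (rule law_at_end) (use 5 s F in \<open>auto simp: m\<close>)
  qed
qed

end

section \<open>Stationarity and the one-time distribution\<close>

lemma double_cosh_minus_one: "2 * (cosh x - 1) = (2 * sinh (x / 2))\<^sup>2" for x :: real
proof -
  have "cosh x = cosh (x / 2 + x / 2)" by simp
  also have "\<dots> = cosh (x / 2) * cosh (x / 2) + sinh (x / 2) * sinh (x / 2)" by (rule cosh_add)
  also have "cosh (x / 2) * cosh (x / 2) = 1 + sinh (x / 2) * sinh (x / 2)"
    using cosh_square_eq[of "x / 2"] by (simp add: power2_eq_square)
  finally show ?thesis by (simp add: power2_eq_square)
qed

lemma osc_variance_pos: "0 < T \<Longrightarrow> 0 < lam \<Longrightarrow> 0 < osc_variance lam T"
proof -
  assume a: "0 < T" "0 < lam"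
  then have "2 * (cosh (lam * T) - 1) > 0" unfolding double_cosh_minus_one by simp
  then show ?thesis unfolding osc_variance_def using a by (intro divide_pos_pos mult_pos_pos) auto
qed

text \<open>The value of the partition function turns the diagonal of the Mehler kernel into the centered
  Gaussian density with variance \<^const>\<open>osc_variance\<close> in each coordinate; the powers of the hyperbolic functions combine
  because \<open>2 (cosh a - 1) = (2 sinh (a / 2))\<^sup>2\<close>.\<close>

lemma mehler_diagonal_normalized:
  fixes x :: "real ^ 'd::finite"
  assumes T: "0 < T" and l: "0 < lam"
  shows "inverse (partition_fun TYPE('d) lam T) * mehler lam x T x
    = (2 * pi * osc_variance lam T) powr (- real CARD('d) / 2) * exp (- (norm x)\<^sup>2 / (2 * osc_variance lam T))"
proof -
  define s where "s = 2 * sinh (lam * T / 2)"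
  have s: "s > 0" using T l by (simp add: s_def)
  define S where "S = sinh (lam * T)"
  have S: "S > 0" using T l by (simp add: S_def)
  have c: "cosh (lam * T) - 1 = s\<^sup>2 / 2" using double_cosh_minus_one[of "lam * T"] by (simp add: s_def)
  have var: "osc_variance lam T = S / (lam * s\<^sup>2)"
    unfolding osc_variance_def c S_def by simp
  have e: "- (lam * (cosh (lam * T) - 1) / sinh (lam * T)) * (norm x)\<^sup>2 = - (norm x)\<^sup>2 / (2 * osc_variance lam T)"
    unfolding var c S_def[symmetric] using S s l by (simp add: field_simps)
  have "inverse (partition_fun TYPE('d) lam T) = s powr real CARD('d)"
    unfolding partition_fun_eq[OF T l] s_def[symmetric] using s by (simp add: powr_minus)
  also have "\<dots> = (s\<^sup>2) powr (real CARD('d) / 2)"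
  proof -
    have "s\<^sup>2 = s powr 2" using s by simp
    then show ?thesis by (simp only: powr_powr) simp
  qed
  also have "\<dots> = (1 / s\<^sup>2) powr (- real CARD('d) / 2)"
  proof -
    have "a powr b = (1 / a) powr (- b)" if "a > 0" for a b :: real
      using that by (simp add: powr_divide powr_minus_divide)
    from this[of "s\<^sup>2" "real CARD('d) / 2"] s show ?thesis by simp
  qed
  finally have "inverse (partition_fun TYPE('d) lam T) * (2 * pi * sinh (lam * T) / lam) powr (- real CARD('d) / 2)
    = ((1 / s\<^sup>2) * (2 * pi * S / lam)) powr (- real CARD('d) / 2)"
    by (simp only: powr_mult S_def)
  also have "(1 / s\<^sup>2) * (2 * pi * S / lam) = 2 * pi * osc_variance lam T"
    unfolding var by simp
  finally show ?thesis unfolding mehler_diagonal[OF T l] e mult.assoc[symmetric] by (simp only:)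
qed

lemma finite_real_set_enumeration:
  fixes J :: "real set"
  assumes "finite J" "J \<noteq> {}"
  obtains n and s :: "nat \<Rightarrow> real" where "\<And>k. k < n \<Longrightarrow> s k < s (Suc k)" "bij_betw s {0..n} J"
proof -
  define l where "l = sorted_list_of_set J"
  define n where "n = card J - 1"
  have c: "card J > 0" using assms by (simp add: card_gt_0_iff)
  have len: "length l = Suc n" using assms c by (simp add: l_def n_def)
  have set: "set l = J" "distinct l" using assms by (auto simp: l_def)
  have strict: "sorted_wrt (<) l" unfolding l_def by (rule strict_sorted_list_of_set)
  show ?thesis
  proof (rule that[of n "\<lambda>k. l ! k"])
    show "l ! k < l ! Suc k" if "k < n" for k
      using sorted_wrt_nth_less[OF strict, of k "Suc k"] that len by simp
    have "{0..n} = {..<length l}" using len by auto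
    then show "bij_betw (\<lambda>k. l ! k) {0..n} J"
      using bij_betw_nth[OF set(2) refl set(1)[symmetric]] by simp
  qed
qed

lemma strict_steps_less:
  fixes s :: "nat \<Rightarrow> real"
  assumes s: "\<And>k. k < n \<Longrightarrow> s k < s (Suc k)" and "i \<le> j" "j \<le> n"
  shows "s i \<le> s j" and "i < j \<Longrightarrow> s i < s j"
proof -
  have "i \<le> j \<Longrightarrow> j \<le> n \<Longrightarrow> s i \<le> s j \<and> (i < j \<longrightarrow> s i < s j)" for j
  proof (induction j)
    case (Suc j)
    then show ?case using s[of j] by (cases "i = Suc j") (auto simp: le_Suc_eq intro: less_trans)
  qed auto
  then show "s i \<le> s j" "i < j \<Longrightarrow> s i < s j" using assms(2,3) by auto
qed

lemma loop_density_shift: "loop_density lam T n (\<lambda>k. s k + h) = loop_density lam T n s"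
  by (simp add: loop_density_def fun_eq_iff)

context periodic_oscillator
begin

lemma joint_measurable:
  assumes "\<And>k. k \<le> n \<Longrightarrow> 0 \<le> s k \<and> s k \<le> T"
  shows "(\<lambda>\<omega>. \<lambda>k\<in>{0..n}. Z (s k) \<omega>) \<in> M \<rightarrow>\<^sub>M lebesgue_upto n"
proof (rule measurable_restrict)
  fix k assume "k \<in> {0..n}"
  then have "Z (s k) \<in> M \<rightarrow>\<^sub>M borel" using assms by (intro Z_measurable) auto
  then show "Z (s k) \<in> M \<rightarrow>\<^sub>M lborel" by simp
qed

lemma joint_distr:
  assumes s_range: "0 \<le> s 0" "s n \<le> T" "s n - s 0 < T" and s: "\<And>k. k < n \<Longrightarrow> s k < s (Suc k)"
  shows "distr M (lebesgue_upto n) (\<lambda>\<omega>. \<lambda>k\<in>{0..n}. Z (s k) \<omega>)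
    = density (lebesgue_upto n) (\<lambda>v. ennreal (loop_density lam T n s v))"
proof -
  have r: "0 \<le> s k \<and> s k \<le> T" if "k \<le> n" for k
    using strict_steps_less(1)[of n s 0 k, OF s] strict_steps_less(1)[of n s k n, OF s] that s_range by auto
  note m = joint_measurable[of n s, OF r]
  interpret D: prob_space "distr M (lebesgue_upto n) (\<lambda>\<omega>. \<lambda>k\<in>{0..n}. Z (s k) \<omega>)"
    by (rule prob_space_distr[OF m])
  show ?thesis
  proof (rule measure_eqI_PiM_finite[of "{0..n}"])
    fix A :: "nat \<Rightarrow> (real ^ 'd) set" assume A: "\<And>i. i \<in> {0..n} \<Longrightarrow> A i \<in> sets lborel"
    then have A': "A k \<in> sets borel" if "k \<le> n" for k using that by simp
    have box: "Pi\<^sub>E {0..n} A \<in> sets (lebesgue_upto n)" by (rule sets_PiE_upto[OF A'])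
    have "(\<lambda>\<omega>. \<lambda>k\<in>{0..n}. Z (s k) \<omega>) -` Pi\<^sub>E {0..n} A \<inter> space M = {\<omega> \<in> space M. \<forall>k\<le>n. Z (s k) \<omega> \<in> A k}"
      by (auto simp: PiE_def Pi_def)
    then show "emeasure (distr M (lebesgue_upto n) (\<lambda>\<omega>. \<lambda>k\<in>{0..n}. Z (s k) \<omega>)) (Pi\<^sub>E {0..n} A)
      = emeasure (density (lebesgue_upto n) (\<lambda>v. ennreal (loop_density lam T n s v))) (Pi\<^sub>E {0..n} A)"
      using law[of s n A, OF s_range s A'] box m by (simp add: emeasure_distr emeasure_density)
  next
    show "range (\<lambda>i::nat. \<Pi>\<^sub>E k\<in>{0..n}. (UNIV :: (real ^ 'd) set)) \<subseteq> prod_algebra {0..n} (\<lambda>_. lborel)"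
      by (auto intro!: prod_algebraI_finite)
    show "(\<Union>i::nat. \<Pi>\<^sub>E k\<in>{0..n}. (UNIV :: (real ^ 'd) set)) = space (lebesgue_upto n)"
      by (simp add: space_PiM)
    show "emeasure (distr M (lebesgue_upto n) (\<lambda>\<omega>. \<lambda>k\<in>{0..n}. Z (s k) \<omega>)) (\<Pi>\<^sub>E k\<in>{0..n}. (UNIV :: (real ^ 'd) set)) \<noteq> \<infinity>"
      for i :: nat using D.emeasure_finite by simp
  qed simp_all
qed

text \<open>Either the shift is \<open>0\<close>, or the times span less than the period.  In the second case the positions at
  the times and at the shifted times have the same joint density, the cyclic product.\<close>

theorem stationary: "stationary_process M T Z"
  unfolding stationary_process_def
proof (intro conjI allI impI process)
  fix I :: "real set" and h :: real
  assume I: "finite I" "I \<subseteq> {0..T}" and Ih: "(\<lambda>\<tau>. \<tau> + h) ` I \<subseteq> {0..T}"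
  show "distr M (\<Pi>\<^sub>M \<tau>\<in>I. borel) (\<lambda>\<omega>. \<lambda>\<tau>\<in>I. Z (\<tau> + h) \<omega>) = distr M (\<Pi>\<^sub>M \<tau>\<in>I. borel) (\<lambda>\<omega>. \<lambda>\<tau>\<in>I. Z \<tau> \<omega>)"
  proof (cases "I = {} \<or> h = 0")
    case True
    then have "(\<lambda>\<omega>. \<lambda>\<tau>\<in>I. Z (\<tau> + h) \<omega>) = (\<lambda>\<omega>. \<lambda>\<tau>\<in>I. Z \<tau> \<omega>)"
      by (intro ext) (auto simp: restrict_def)
    then show ?thesis by simp
  next
    case False
    then obtain n s where s: "\<And>k. k < n \<Longrightarrow> s k < s (Suc k)" "bij_betw s {0..n} I"
      using finite_real_set_enumeration[OF I(1)] by blast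
    have sI: "s k \<in> I" if "k \<le> n" for k using s(2) that by (auto simp: bij_betw_def)
    have gap: "s n - s 0 < T"
    proof -
      have "s 0 \<in> {0..T}" "s n \<in> {0..T}" "s 0 + h \<in> {0..T}" "s n + h \<in> {0..T}"
        using sI[of 0] sI[of n] I(2) Ih by auto
      then show ?thesis using False by auto
    qed
    define q where "q = inv_into {0..n} s"
    have q: "q \<tau> \<in> {0..n}" "s (q \<tau>) = \<tau>" if "\<tau> \<in> I" for \<tau>
      using s(2) that unfolding q_def bij_betw_def by (auto intro: inv_into_into f_inv_into_f)
    have q_m: "(\<lambda>v. \<lambda>\<tau>\<in>I. v (q \<tau>)) \<in> lebesgue_upto n \<rightarrow>\<^sub>M (\<Pi>\<^sub>M \<tau>\<in>I. (borel :: (real ^ 'd) measure))"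
    proof (rule measurable_restrict)
      fix \<tau> assume "\<tau> \<in> I"
      then show "(\<lambda>v. v (q \<tau>)) \<in> lebesgue_upto n \<rightarrow>\<^sub>M (borel :: (real ^ 'd) measure)"
        using measurable_component_singleton[OF q(1), of \<tau> "\<lambda>_. lborel :: (real ^ 'd) measure"] by simp
    qed
    have "distr M (\<Pi>\<^sub>M \<tau>\<in>I. borel) (\<lambda>\<omega>. \<lambda>\<tau>\<in>I. Z (\<tau> + h') \<omega>)
        = distr (density (lebesgue_upto n) (\<lambda>v. ennreal (loop_density lam T n s v))) (\<Pi>\<^sub>M \<tau>\<in>I. borel) (\<lambda>v. \<lambda>\<tau>\<in>I. v (q \<tau>))"
      if h': "(\<lambda>\<tau>. \<tau> + h') ` I \<subseteq> {0..T}" for h'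
    proof -
      have r: "0 \<le> s k + h' \<and> s k + h' \<le> T" if "k \<le> n" for k using h' sI[OF that] by auto
      have "density (lebesgue_upto n) (\<lambda>v. ennreal (loop_density lam T n s v))
          = distr M (lebesgue_upto n) (\<lambda>\<omega>. \<lambda>k\<in>{0..n}. Z (s k + h') \<omega>)"
        using joint_distr[of "\<lambda>k. s k + h'" n] r[of 0] r[of n] gap s(1) by (simp add: loop_density_shift)
      moreover have "(\<lambda>v. \<lambda>\<tau>\<in>I. v (q \<tau>)) \<circ> (\<lambda>\<omega>. \<lambda>k\<in>{0..n}. Z (s k + h') \<omega>) = (\<lambda>\<omega>. \<lambda>\<tau>\<in>I. Z (\<tau> + h') \<omega>)"
        using q by (auto simp: fun_eq_iff restrict_def)
      ultimately show ?thesis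
        using distr_distr[OF q_m joint_measurable[of n "\<lambda>k. s k + h'", OF r]] by simp
    qed
    from this[OF Ih] this[of 0] I(2) show ?thesis by simp
  qed
qed

definition marginal :: "real ^ 'd \<Rightarrow> real" where
  "marginal x = (2 * pi * osc_variance lam T) powr (- real CARD('d) / 2) * exp (- (norm x)\<^sup>2 / (2 * osc_variance lam T))"

lemma marginal_measurable [measurable]: "marginal \<in> borel_measurable borel"
  unfolding marginal_def by measurable

lemma marginal_nonneg: "marginal x \<ge> 0"
  by (simp add: marginal_def)

lemma distr_marginal:
  assumes t: "0 \<le> t" "t \<le> T"
  shows "distr M borel (Z t) = density lborel (\<lambda>x. ennreal (marginal x))"
proof (rule measure_eqI)
  interpret product_sigma_finite "\<lambda>_. lborel :: (real ^ 'd) measure" ..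
  fix A assume "A \<in> sets (distr M borel (Z t))"
  then have A [measurable]: "A \<in> sets borel" by simp
  note Z_measurable[OF t, measurable]
  have "emeasure (distr M borel (Z t)) A = emeasure M {\<omega> \<in> space M. Z t \<omega> \<in> A}"
    by (subst emeasure_distr) (auto simp: vimage_def Int_def conj_commute)
  also have "\<dots> = emeasure M {\<omega> \<in> space M. \<forall>k\<le>0. Z ((\<lambda>k. t) k) \<omega> \<in> (\<lambda>k::nat. A) k}" by simp
  also have "\<dots> = (\<integral>\<^sup>+v\<in>(\<Pi>\<^sub>E k\<in>{0..0}. A). ennreal (loop_density lam T 0 (\<lambda>k. t) v) \<partial>lebesgue_upto 0)"
    by (rule law) (use t T_pos in auto)
  also have "\<dots> = (\<integral>\<^sup>+v. (\<lambda>x. ennreal (marginal x) * indicator A x) (v 0) \<partial>(\<Pi>\<^sub>M k\<in>{0::nat}. lborel))"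
    unfolding atLeastAtMost_singleton
  proof (rule nn_integral_cong)
    fix v assume "v \<in> space (\<Pi>\<^sub>M k\<in>{0::nat}. (lborel :: (real ^ 'd) measure))"
    then have "v \<in> (\<Pi>\<^sub>E k\<in>{0}. A) \<longleftrightarrow> v 0 \<in> A" by (auto simp: space_PiM PiE_def Pi_def)
    then show "ennreal (loop_density lam T 0 (\<lambda>k. t) v) * indicator (\<Pi>\<^sub>E k\<in>{0}. A) v = ennreal (marginal (v 0)) * indicator A (v 0)"
      by (simp add: loop_density_zero mehler_diagonal_normalized[OF T_pos lam_pos] marginal_def indicator_def)
  qed
  also have "\<dots> = (\<integral>\<^sup>+x\<in>A. ennreal (marginal x) \<partial>lborel)"
    by (rule product_nn_integral_singleton) measurable
  also have "\<dots> = emeasure (density lborel (\<lambda>x. ennreal (marginal x))) A"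
    by (rule emeasure_density[symmetric]) auto
  finally show "emeasure (distr M borel (Z t)) A = emeasure (density lborel (\<lambda>x. ennreal (marginal x))) A" .
qed simp

lemma marginal_integrable: "integrable lborel marginal"
proof -
  have "(\<integral>\<^sup>+x. ennreal (marginal x) \<partial>lborel) = emeasure (density lborel (\<lambda>x. ennreal (marginal x))) UNIV"
    by (subst emeasure_density) auto
  also have "\<dots> = emeasure (distr M borel (Z 0)) UNIV"
    using distr_marginal[of 0] T_pos by simp
  also have "\<dots> = 1"
    using Z_measurable[of 0] T_pos by (subst emeasure_distr) (auto simp: emeasure_space_1)
  finally show ?thesis
    by (intro integrableI_nonneg) (auto simp: marginal_nonneg)
qed

theorem one_time_distribution:
  assumes t: "0 \<le> t" "t \<le> T" and F [measurable]: "F \<in> sets borel"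
  shows "measure M {\<omega> \<in> space M. Z t \<omega> \<in> F} = (LINT x:F|lborel. marginal x)"
proof -
  note Z_measurable[OF t, measurable]
  have "measure M {\<omega> \<in> space M. Z t \<omega> \<in> F} = measure (distr M borel (Z t)) F"
    by (subst measure_distr) (auto simp: vimage_def Int_def conj_commute)
  also have "\<dots> = enn2real (\<integral>\<^sup>+x\<in>F. ennreal (marginal x) \<partial>lborel)"
    unfolding distr_marginal[OF t] measure_def by (subst emeasure_density) auto
  also have "(\<integral>\<^sup>+x\<in>F. ennreal (marginal x) \<partial>lborel) = (\<integral>\<^sup>+x. ennreal (indicator F x * marginal x) \<partial>lborel)"
    by (intro nn_integral_cong) (simp add: indicator_def)
  also have "enn2real \<dots> = (LINT x:F|lborel. marginal x)"
    unfolding set_lebesgue_integral_def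
    by (subst integral_eq_nn_integral) (auto simp: marginal_nonneg)
  finally show ?thesis .
qed

end

section \<open>Gaussian laws from exponential tilting\<close>

text \<open>A degenerate variance \<open>V = 0\<close> is allowed, because \<open>Z T - Z 0\<close> vanishes almost surely.\<close>

definition centered_gaussian :: "'w measure \<Rightarrow> ('w \<Rightarrow> real) \<Rightarrow> real \<Rightarrow> bool" where
  "centered_gaussian M Y V \<longleftrightarrow> Y \<in> borel_measurable M \<and> 0 \<le> V \<and> (V = 0 \<longrightarrow> (AE \<omega> in M. Y \<omega> = 0)) \<and>
     (0 < V \<longrightarrow> distr M borel Y = density lborel (\<lambda>x. ennreal (normal_density 0 (sqrt V) x)))"

text \<open>The hypothesis says that tilting the law of \<open>Y\<close> by \<open>exp (\<theta> y - \<theta>\<^sup>2 V / 2)\<close> has the effect of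
  translating it by \<open>\<theta> V\<close>.  For \<open>V > 0\<close>, integrate this over \<open>\<theta>\<close>: the tilts add up to a multiple of
  \<open>exp (y\<^sup>2 / (2 V))\<close>, the translations spread the law to a multiple of Lebesgue measure, and so the
  law must be the normal one.  For \<open>V = 0\<close> the exponential moments at \<open>\<theta> = 1\<close> and \<open>\<theta> = -1\<close> add up to
  \<open>2\<close>, which forces \<open>cosh Y = 1\<close>.\<close>

lemma (in prob_space) centered_gaussian_by_tilting:
  assumes Y [measurable]: "Y \<in> borel_measurable M"
    and tilt: "\<And>\<theta> g. g \<in> borel_measurable borel \<Longrightarrow>
      (\<integral>\<^sup>+\<omega>. g (Y \<omega>) * ennreal (exp (\<theta> * Y \<omega>)) \<partial>M) = ennreal (exp (\<theta>\<^sup>2 * V / 2)) * (\<integral>\<^sup>+\<omega>. g (Y \<omega> + \<theta> * V) \<partial>M)"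
  shows "centered_gaussian M Y V"
proof -
  let ?N = "density lborel (\<lambda>x. ennreal (normal_density 0 (sqrt V) x))" and ?e = "\<lambda>\<theta> y. ennreal (exp (\<theta> * y - \<theta>\<^sup>2 * V / 2))"
  have mgf: "(\<integral>\<^sup>+\<omega>. ennreal (exp (\<theta> * Y \<omega>)) \<partial>M) = ennreal (exp (\<theta>\<^sup>2 * V / 2))" for \<theta>
    using tilt[of "\<lambda>_. 1" \<theta>] by (simp add: emeasure_space_1)
  \<comment> \<open>\<open>h = exp Y + exp (-Y) - 2\<close> is nonnegative and vanishes only where \<open>Y\<close> does.\<close>
  define h where "h \<omega> = 2 * (cosh (Y \<omega>) - 1)" for \<omega>
  have [measurable]: "h \<in> borel_measurable M" unfolding h_def cosh_field_def by measurable
  have h0: "h \<omega> \<ge> 0" for \<omega> using cosh_real_ge_1[of "Y \<omega>"] by (simp add: h_def)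
  have "(\<integral>\<^sup>+\<omega>. ennreal (h \<omega>) \<partial>M) + 2 = (\<integral>\<^sup>+\<omega>. ennreal (h \<omega>) + 2 \<partial>M)"
    by (subst nn_integral_add) (auto simp: emeasure_space_1)
  also have "\<dots> = (\<integral>\<^sup>+\<omega>. ennreal (exp (1 * Y \<omega>)) + ennreal (exp (- 1 * Y \<omega>)) \<partial>M)"
  proof (intro nn_integral_cong)
    fix \<omega>
    have "ennreal (h \<omega>) + ennreal 2 = ennreal (h \<omega> + 2)" using h0 by (subst ennreal_plus) auto
    also have "h \<omega> + 2 = exp (1 * Y \<omega>) + exp (- 1 * Y \<omega>)" by (simp add: h_def cosh_field_def)
    also have "ennreal \<dots> = ennreal (exp (1 * Y \<omega>)) + ennreal (exp (- 1 * Y \<omega>))" by (subst ennreal_plus) auto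
    finally show "ennreal (h \<omega>) + 2 = ennreal (exp (1 * Y \<omega>)) + ennreal (exp (- 1 * Y \<omega>))" by simp
  qed
  also have "\<dots> = ennreal (exp (V / 2)) + ennreal (exp (V / 2))"
    by (subst nn_integral_add) (auto simp only: mgf, auto)
  also have "\<dots> = ennreal (2 * exp (V / 2))" by (subst ennreal_plus[symmetric]) auto
  finally have h_int: "(\<integral>\<^sup>+\<omega>. ennreal (h \<omega>) \<partial>M) + 2 = ennreal (2 * exp (V / 2))" .
  have V0: "V \<ge> 0"
  proof -
    have "ennreal 2 \<le> (\<integral>\<^sup>+\<omega>. ennreal (h \<omega>) \<partial>M) + 2" by simp
    then have "2 \<le> 2 * exp (V / 2)" unfolding h_int by (subst (asm) ennreal_le_iff) auto
    then show ?thesis by simp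
  qed
  have zero: "AE \<omega> in M. Y \<omega> = 0" if "V = 0"
  proof -
    have "(\<integral>\<^sup>+\<omega>. ennreal (h \<omega>) \<partial>M) + 2 = 0 + 2" using h_int that by simp
    then have "(\<integral>\<^sup>+\<omega>. ennreal (h \<omega>) \<partial>M) = 0" using ennreal_add_left_cancel[of 2 "\<integral>\<^sup>+\<omega>. ennreal (h \<omega>) \<partial>M" 0] by (simp add: add.commute)
    then have "AE \<omega> in M. ennreal (h \<omega>) = 0" by (subst (asm) nn_integral_0_iff_AE) auto
    then show ?thesis
    proof eventually_elim
      case (elim \<omega>)
      then have "cosh (Y \<omega>) \<le> 1" by (simp add: h_def ennreal_eq_0_iff)
      then have "cosh (Y \<omega>) = 1" using cosh_real_ge_1[of "Y \<omega>"] by linarith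
      then show ?case by simp
    qed
  qed
  have pos: "distr M borel Y = ?N" if V: "V > 0"
  proof (rule measure_eqI)
    fix A assume "A \<in> sets (distr M borel Y)"
    then have [measurable]: "A \<in> sets borel" by simp
    \<comment> \<open>The factor compensates the integrated tilt, so that \<open>A\<close> is tested against the law itself.\<close>
    define g where "g y = indicator A y * ennreal (exp (- (y\<^sup>2 / (2 * V))))" for y :: real
    have [measurable]: "g \<in> borel_measurable borel" unfolding g_def by measurable
    have gauss: "(\<integral>\<^sup>+\<theta>. ?e \<theta> y \<partial>lborel) = ennreal (exp (y\<^sup>2 / (2 * V))) * ennreal (sqrt (2 * pi / V))" for y
    proof -
      have "exp (\<theta> * y - \<theta>\<^sup>2 * V / 2) = exp (y\<^sup>2 / (2 * V)) * exp (- (V / 2 * (norm (\<theta> - y / V))\<^sup>2))" for \<theta>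
        unfolding exp_add[symmetric] using V
        by (simp add: power2_eq_square field_simps)
      then have "(\<integral>\<^sup>+\<theta>. ?e \<theta> y \<partial>lborel)
         = (\<integral>\<^sup>+\<theta>. ennreal (exp (y\<^sup>2 / (2 * V))) * ennreal (exp (- (V / 2 * (norm (\<theta> - y / V))\<^sup>2))) \<partial>lborel)"
        by (simp add: ennreal_mult'[symmetric])
      also have "\<dots> = ennreal (exp (y\<^sup>2 / (2 * V))) * ennreal ((pi / (V / 2)) powr (real DIM(real) / 2))"
        using V by (subst nn_integral_cmult) (simp_all only: nn_integral_gaussian half_gt_zero, measurable)
      finally show ?thesis using V by (simp add: powr_half_sqrt mult.commute)
    qed
    have "ennreal (sqrt (2 * pi / V)) * emeasure (distr M borel Y) A
        = (\<integral>\<^sup>+\<omega>. ennreal (sqrt (2 * pi / V)) * indicator A (Y \<omega>) \<partial>M)"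
    proof -
      have "emeasure (distr M borel Y) A = (\<integral>\<^sup>+y. indicator A y \<partial>distr M borel Y)"
        by (rule nn_integral_indicator[symmetric]) simp
      also have "\<dots> = (\<integral>\<^sup>+\<omega>. indicator A (Y \<omega>) \<partial>M)" by (rule nn_integral_distr) auto
      finally show ?thesis by (subst nn_integral_cmult) auto
    qed
    also have "\<dots> = (\<integral>\<^sup>+\<omega>. g (Y \<omega>) * (\<integral>\<^sup>+\<theta>. ?e \<theta> (Y \<omega>) \<partial>lborel) \<partial>M)"
      unfolding gauss
      by (intro nn_integral_cong) (simp add: g_def indicator_def ennreal_mult'[symmetric] mult.assoc[symmetric] exp_add[symmetric])
    also have "\<dots> = (\<integral>\<^sup>+\<omega>. (\<integral>\<^sup>+\<theta>. g (Y \<omega>) * ?e \<theta> (Y \<omega>) \<partial>lborel) \<partial>M)"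
      by (intro nn_integral_cong nn_integral_cmult[symmetric]) measurable
    also have "\<dots> = (\<integral>\<^sup>+\<theta>. (\<integral>\<^sup>+\<omega>. g (Y \<omega>) * ?e \<theta> (Y \<omega>) \<partial>M) \<partial>lborel)"
    proof -
      interpret pair_sigma_finite M "lborel :: real measure" ..
      show ?thesis by (rule Fubini'[symmetric]) measurable
    qed
    also have "\<dots> = (\<integral>\<^sup>+\<theta>. (\<integral>\<^sup>+\<omega>. g (Y \<omega> + \<theta> * V) \<partial>M) \<partial>lborel)"
    proof (rule nn_integral_cong)
      fix \<theta> :: real
      have "(\<integral>\<^sup>+\<omega>. g (Y \<omega>) * ?e \<theta> (Y \<omega>) \<partial>M)
          = (\<integral>\<^sup>+\<omega>. ennreal (exp (- (\<theta>\<^sup>2 * V / 2))) * (g (Y \<omega>) * ennreal (exp (\<theta> * Y \<omega>))) \<partial>M)"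
        by (intro nn_integral_cong) (simp add: diff_conv_add_uminus exp_add ennreal_mult' mult_ac del: add_uminus_conv_diff)
      also have "\<dots> = ennreal (exp (- (\<theta>\<^sup>2 * V / 2))) * (ennreal (exp (\<theta>\<^sup>2 * V / 2)) * (\<integral>\<^sup>+\<omega>. g (Y \<omega> + \<theta> * V) \<partial>M))"
        by (subst nn_integral_cmult) (simp_all add: tilt)
      also have "\<dots> = (\<integral>\<^sup>+\<omega>. g (Y \<omega> + \<theta> * V) \<partial>M)"
        by (simp add: mult.assoc[symmetric] ennreal_mult'[symmetric] exp_add[symmetric])
      finally show "(\<integral>\<^sup>+\<omega>. g (Y \<omega>) * ?e \<theta> (Y \<omega>) \<partial>M) = (\<integral>\<^sup>+\<omega>. g (Y \<omega> + \<theta> * V) \<partial>M)" .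
    qed
    also have "\<dots> = (\<integral>\<^sup>+\<omega>. (\<integral>\<^sup>+\<theta>. g (Y \<omega> + \<theta> * V) \<partial>lborel) \<partial>M)"
    proof -
      interpret pair_sigma_finite M "lborel :: real measure" ..
      show ?thesis by (rule Fubini') measurable
    qed
    also have "\<dots> = (\<integral>\<^sup>+\<omega>. ennreal (1 / V) * (\<integral>\<^sup>+y. g y \<partial>lborel) \<partial>M)"
    proof (rule nn_integral_cong)
      fix \<omega>
      have "(\<integral>\<^sup>+y. g y \<partial>lborel) = ennreal \<bar>V\<bar> * (\<integral>\<^sup>+\<theta>. g (Y \<omega> + V * \<theta>) \<partial>lborel)"
        by (rule nn_integral_real_affine) (use V in auto)
      then show "(\<integral>\<^sup>+\<theta>. g (Y \<omega> + \<theta> * V) \<partial>lborel) = ennreal (1 / V) * (\<integral>\<^sup>+y. g y \<partial>lborel)"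
        using V by (simp add: mult.assoc[symmetric] ennreal_mult'[symmetric] mult.commute)
    qed
    also have "\<dots> = ennreal (1 / V) * (\<integral>\<^sup>+y. g y \<partial>lborel)" by (simp add: emeasure_space_1)
    finally have key: "ennreal (sqrt (2 * pi / V)) * emeasure (distr M borel Y) A = ennreal (1 / V) * (\<integral>\<^sup>+y. g y \<partial>lborel)" .
    have "emeasure (distr M borel Y) A = ennreal (sqrt (V / (2 * pi))) * (ennreal (sqrt (2 * pi / V)) * emeasure (distr M borel Y) A)"
      using V by (simp add: mult.assoc[symmetric] ennreal_mult'[symmetric] real_sqrt_mult[symmetric])
    also have "\<dots> = ennreal (sqrt (V / (2 * pi)) / V) * (\<integral>\<^sup>+y. g y \<partial>lborel)"
      unfolding key using V by (simp add: mult.assoc[symmetric] ennreal_mult'[symmetric])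
    also have "\<dots> = (\<integral>\<^sup>+y. ennreal (sqrt (V / (2 * pi)) / V) * g y \<partial>lborel)" by (rule nn_integral_cmult[symmetric]) measurable
    also have "\<dots> = (\<integral>\<^sup>+y. ennreal (normal_density 0 (sqrt V) y) * indicator A y \<partial>lborel)"
    proof (rule nn_integral_cong)
      fix y :: real
      have "sqrt (V / (2 * pi)) / V = 1 / sqrt (2 * pi * V)"
        using V by (simp add: real_sqrt_divide real_sqrt_mult field_simps)
      then show "ennreal (sqrt (V / (2 * pi)) / V) * g y = ennreal (normal_density 0 (sqrt V) y) * indicator A y"
        using V by (simp add: g_def normal_density_def indicator_def ennreal_mult'[symmetric])
    qed
    also have "\<dots> = emeasure (?N) A"
      by (rule emeasure_density[symmetric]) auto
    finally show "emeasure (distr M borel Y) A = emeasure (?N) A" .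
  qed simp
  show ?thesis unfolding centered_gaussian_def using V0 zero pos Y by blast
qed

lemma (in prob_space) centered_gaussian_rv:
  assumes "centered_gaussian M Y V"
  shows "gaussian_rv M Y"
proof (cases "V = 0")
  case True
  have [measurable]: "Y \<in> borel_measurable M" using assms by (simp add: centered_gaussian_def)
  have "distr M borel Y = distr M borel (\<lambda>_. 0)"
    by (rule distr_cong_AE) (use assms True in \<open>auto simp: centered_gaussian_def\<close>)
  also have "\<dots> = return borel 0" by (rule distr_const) simp
  finally show ?thesis unfolding gaussian_rv_def by auto
next
  case False
  then have "0 < sqrt V" "distr M borel Y = density lborel (\<lambda>x. ennreal (normal_density 0 (sqrt V) x))"
    "Y \<in> borel_measurable M"
    using assms by (auto simp: centered_gaussian_def)
  then show ?thesis unfolding gaussian_rv_def by blast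
qed

lemma (in prob_space) centered_gaussian_second_moment:
  assumes "centered_gaussian M Y V"
  shows "has_bochner_integral M (\<lambda>\<omega>. (Y \<omega>)\<^sup>2) V"
proof (cases "V = 0")
  case True
  have [measurable]: "Y \<in> borel_measurable M" using assms by (simp add: centered_gaussian_def)
  have "AE \<omega> in M. (Y \<omega>)\<^sup>2 = 0" using assms True by (auto simp: centered_gaussian_def)
  then have "has_bochner_integral M (\<lambda>\<omega>. (Y \<omega>)\<^sup>2) 0 \<longleftrightarrow> has_bochner_integral M (\<lambda>\<omega>. 0 :: real) 0"
    by (intro has_bochner_integral_cong_AE) auto
  then show ?thesis using True has_bochner_integral_zero[of M] by simp
next
  case False
  have Y [measurable]: "Y \<in> borel_measurable M" using assms by (simp add: centered_gaussian_def)
  have V: "V > 0" and d: "distr M borel Y = density lborel (\<lambda>x. ennreal (normal_density 0 (sqrt V) x))"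
    using assms False by (auto simp: centered_gaussian_def)
  have m: "has_bochner_integral lborel (\<lambda>x. normal_density 0 (sqrt V) x * x\<^sup>2) V"
    using normal_moment_even[of "sqrt V" 0 1] V by simp
  have "integrable (distr M borel Y) (\<lambda>x. x\<^sup>2) \<longleftrightarrow> integrable lborel (\<lambda>x. normal_density 0 (sqrt V) x * x\<^sup>2)"
    unfolding d by (subst integrable_density) auto
  then have i: "integrable M (\<lambda>\<omega>. (Y \<omega>)\<^sup>2)"
    using m integrable_distr_eq[OF Y, of "\<lambda>x. x\<^sup>2"] by (auto simp: has_bochner_integral_iff)
  have "(\<integral>\<omega>. (Y \<omega>)\<^sup>2 \<partial>M) = (\<integral>x. x\<^sup>2 \<partial>distr M borel Y)"
    by (subst integral_distr) auto
  also have "\<dots> = (\<integral>x. normal_density 0 (sqrt V) x * x\<^sup>2 \<partial>lborel)"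
    unfolding d by (subst integral_density) auto
  also have "\<dots> = V" using m by (simp add: has_bochner_integral_iff)
  finally show ?thesis using i by (simp add: has_bochner_integral_iff)
qed

section \<open>The quadratic action and its Green function\<close>

text \<open>For \<open>cosh\<close> as a solution of \<open>c'' = c\<close> on an interval, the mixed part of the action is a boundary
  term: the test values at the two ends times the derivative \<open>sinh\<close> there.\<close>

lemma sinh_cosh_bridge:
  fixes p q x y :: real
  assumes "sinh (q - p) \<noteq> 0"
  shows "(cosh (q - p) * (x * cosh q + y * cosh p) - x * cosh p - y * cosh q) / sinh (q - p) = x * sinh q - y * sinh p"
proof -
  define D where "D = q - p"
  have "cosh p = cosh q * cosh D - sinh q * sinh D" "cosh q = cosh p * cosh D + sinh p * sinh D"
    using cosh_diff[of q D] cosh_add[of p D] by (simp_all add: D_def)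
  then have e: "cosh D * cosh q - cosh p = sinh q * sinh D" "cosh D * cosh p - cosh q = - (sinh p * sinh D)"
    by (simp_all only: mult.commute)
  have "cosh D * (x * cosh q + y * cosh p) - x * cosh p - y * cosh q
      = x * (cosh D * cosh q - cosh p) + y * (cosh D * cosh p - cosh q)"
    by (simp add: algebra_simps)
  also have "\<dots> = (x * sinh q - y * sinh p) * sinh D" unfolding e by (simp add: algebra_simps)
  finally have "cosh D * (x * cosh q + y * cosh p) - x * cosh p - y * cosh q = (x * sinh q - y * sinh p) * sinh D" .
  then show ?thesis using assms by (simp add: D_def)
qed

text \<open>The symmetric bilinear form that belongs to the quadratic form \<open>2 mehler_exponent\<close>.\<close>

definition mehler_form :: "real \<Rightarrow> real \<Rightarrow> 'a::real_inner \<Rightarrow> 'a \<Rightarrow> 'a \<Rightarrow> 'a \<Rightarrow> real" where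
  "mehler_form lam t x y x' y' = lam * (cosh (lam * t) * (x \<bullet> x' + y \<bullet> y') - x \<bullet> y' - y \<bullet> x') / sinh (lam * t)"

lemma mehler_exponent_add:
  "mehler_exponent lam t (x + x') (y + y')
     = mehler_exponent lam t x y + mehler_form lam t x y x' y' + mehler_exponent lam t x' y'"
proof (cases "sinh (lam * t) = 0")
  case False
  then show ?thesis
    unfolding mehler_exponent_def mehler_form_def
    by (simp add: inner_add_left inner_add_right inner_commute divide_simps) (simp add: algebra_simps inner_commute)
next
  case True
  then show ?thesis unfolding mehler_exponent_def mehler_form_def
    by (simp only: div_by_0 mult_zero_right)
qed

lemma mehler_form_self: "mehler_form lam t x y x y = 2 * mehler_exponent lam t x y"
proof (cases "sinh (lam * t) = 0")
  case False
  then show ?thesis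
    unfolding mehler_exponent_def mehler_form_def
    by (simp add: divide_simps) (simp add: algebra_simps inner_commute)
next
  case True
  then show ?thesis unfolding mehler_exponent_def mehler_form_def
    by (simp only: div_by_0 mult_zero_right)
qed

lemma mehler_form_sum:
  "mehler_form lam t x y (\<Sum>j\<in>J. f j) (\<Sum>j\<in>J. g j) = (\<Sum>j\<in>J. mehler_form lam t x y (f j) (g j))"
  unfolding mehler_form_def inner_sum_right
  by (simp add: sum_distrib_left sum_divide_distrib[symmetric] sum.distrib sum_subtractf algebra_simps)

definition loop_action :: "real \<Rightarrow> real \<Rightarrow> nat \<Rightarrow> (nat \<Rightarrow> real) \<Rightarrow> (nat \<Rightarrow> 'a::real_inner) \<Rightarrow> real" where
  "loop_action lam T n s v = (\<Sum>k=1..n. mehler_exponent lam (s k - s (k - 1)) (v k) (v (k - 1)))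
     + mehler_exponent lam (T - (s n - s 0)) (v 0) (v n)"

definition loop_form :: "real \<Rightarrow> real \<Rightarrow> nat \<Rightarrow> (nat \<Rightarrow> real) \<Rightarrow> (nat \<Rightarrow> 'a::real_inner) \<Rightarrow> (nat \<Rightarrow> 'a) \<Rightarrow> real" where
  "loop_form lam T n s v c = (\<Sum>k=1..n. mehler_form lam (s k - s (k - 1)) (v k) (v (k - 1)) (c k) (c (k - 1)))
     + mehler_form lam (T - (s n - s 0)) (v 0) (v n) (c 0) (c n)"

lemma loop_action_add:
  "loop_action lam T n s (\<lambda>k. v k + c k) = loop_action lam T n s v + loop_form lam T n s v c + loop_action lam T n s c"
  by (simp add: loop_action_def loop_form_def mehler_exponent_add sum.distrib)

lemma loop_form_self: "loop_form lam T n s v v = 2 * loop_action lam T n s v"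
  by (simp add: loop_action_def loop_form_def mehler_form_self sum_distrib_left)

lemma loop_form_sum:
  "loop_form lam T n s v (\<lambda>k. \<Sum>j\<in>J. c j k) = (\<Sum>j\<in>J. loop_form lam T n s v (c j))"
  unfolding loop_form_def mehler_form_sum by (simp add: sum.distrib sum.swap[of _ J])

lemma loop_density_eq_exp:
  "\<exists>C. \<forall>v :: nat \<Rightarrow> real ^ 'd::finite. loop_density lam T n s v = C * exp (- loop_action lam T n s v)"
proof -
  define N where "N t = (2 * pi * sinh (lam * t) / lam) powr (- real CARD('d) / 2)" for t
  have e: "mehler lam x t y = N t * exp (- mehler_exponent lam t x y)" for x y :: "real ^ 'd" and t
    unfolding N_def by (rule mehler_eq_exp)
  have "loop_density lam T n s v
      = (inverse (partition_fun TYPE('d) lam T) * (\<Prod>k=1..n. N (s k - s (k - 1))) * N (T - (s n - s 0))) * exp (- loop_action lam T n s v)"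
    for v :: "nat \<Rightarrow> real ^ 'd"
    unfolding loop_density_def loop_action_def e
    by (simp add: prod.distrib exp_sum sum_negf[symmetric] exp_diff exp_minus divide_inverse exp_add)
  then show ?thesis by blast
qed

text \<open>The periodic Green function of \<open>lam\<^sup>2 - d\<^sup>2/du\<^sup>2\<close> on a circle of length \<open>T\<close>, for \<open>\<bar>u\<bar> \<le> T\<close>.\<close>

definition green :: "real \<Rightarrow> real \<Rightarrow> real \<Rightarrow> real" where
  "green lam T u = cosh (lam * (\<bar>u\<bar> - T / 2)) / (2 * lam * sinh (lam * T / 2))"

text \<open>The loop \<open>\<tau> \<mapsto> green (\<tau> - s j)\<close> solves \<open>c'' = lam\<^sup>2 c\<close> away from \<open>s j\<close>.  By \<open>sinh_cosh_bridge\<close> each interval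
  between neighbouring times contributes boundary terms, and these cancel between neighbouring
  intervals except at \<open>s j\<close>, where the derivative jumps by \<open>-1\<close>.\<close>

lemma loop_form_green:
  fixes v :: "nat \<Rightarrow> 'a::real_inner"
  assumes lam: "0 < lam" and T: "0 < T" and s: "\<And>k. k < n \<Longrightarrow> s k < s (Suc k)" and gap: "s n - s 0 < T"
    and j: "j \<le> n"
  shows "loop_form lam T n s v (\<lambda>k. green lam T (s k - s j) *\<^sub>R a) = v j \<bullet> a"
proof -
  define C where "C = 1 / (2 * lam * sinh (lam * T / 2))"
  have shT: "sinh (lam * T / 2) > 0" using lam T by simp
  define \<alpha> where "\<alpha> k = v k \<bullet> a" for k
  \<comment> \<open>The right and left derivatives of the Green loop at \<open>s k\<close>; they differ only at \<open>s j\<close>.\<close>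
  define Dr where "Dr k = (if j \<le> k then C * lam * sinh (lam * (s k - s j - T / 2)) else C * lam * sinh (lam * (s k - s j + T / 2)))" for k
  define Dl where "Dl k = (if j < k then C * lam * sinh (lam * (s k - s j - T / 2)) else C * lam * sinh (lam * (s k - s j + T / 2)))" for k
  have le: "s i \<le> s k" if "i \<le> k" "k \<le> n" for i k using strict_steps_less(1)[of n s, OF s that] .
  have green_right: "green lam T (s k - s j) = C * cosh (lam * (s k - s j - T / 2))" if "j \<le> k" "k \<le> n" for k
    using le[OF that] by (simp add: green_def C_def)
  have green_left: "green lam T (s k - s j) = C * cosh (lam * (s k - s j + T / 2))" if "k \<le> j" for k
  proof -
    have "lam * (\<bar>s k - s j\<bar> - T / 2) = - (lam * (s k - s j + T / 2))" using le[OF that j] by (simp add: algebra_simps)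
    then show ?thesis by (simp only: green_def C_def cosh_minus) simp
  qed
  have bridge: "mehler_form lam t x y ((C * cosh q) *\<^sub>R a) ((C * cosh p) *\<^sub>R a)
     = (x \<bullet> a) * (C * lam * sinh q) - (y \<bullet> a) * (C * lam * sinh p)" if "lam * t = q - p" "0 < t" for t p q and x y :: 'a
  proof -
    have "sinh (q - p) \<noteq> 0" using that lam by (simp flip: that(1))
    from sinh_cosh_bridge[OF this, of "x \<bullet> a" "y \<bullet> a"]
    have "(C * lam) * ((cosh (q - p) * ((x \<bullet> a) * cosh q + (y \<bullet> a) * cosh p) - (x \<bullet> a) * cosh p - (y \<bullet> a) * cosh q) / sinh (q - p))
       = (C * lam) * ((x \<bullet> a) * sinh q - (y \<bullet> a) * sinh p)" by simp
    then show ?thesis unfolding mehler_form_def that(1) inner_scaleR_right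
      by (simp add: algebra_simps)
  qed
  have step: "mehler_form lam (s k - s (k - 1)) (v k) (v (k - 1)) (green lam T (s k - s j) *\<^sub>R a) (green lam T (s (k - 1) - s j) *\<^sub>R a)
     = \<alpha> k * Dl k - \<alpha> (k - 1) * Dr (k - 1)" if k: "k \<in> {1..n}" for k
  proof -
    have lt: "0 < s k - s (k - 1)" using s[of "k - 1"] k by auto
    show ?thesis
    proof (cases "j < k")
      case True
      then have "j \<le> k" "j \<le> k - 1" "k \<le> n" "k - 1 \<le> n" using k by auto
      then show ?thesis using True lt
        by (simp only: green_right \<alpha>_def Dl_def Dr_def if_True) (rule bridge, simp_all add: algebra_simps)
    next
      case False
      then have "k \<le> j" "k - 1 \<le> j" "\<not> j \<le> k - 1" using k by auto
      then show ?thesis using False lt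
        by (simp only: green_left \<alpha>_def Dl_def Dr_def if_False) (rule bridge, simp_all add: algebra_simps)
    qed
  qed
  \<comment> \<open>The closing interval from \<open>s n\<close> to \<open>s 0 + T\<close>.\<close>
  have wrap: "mehler_form lam (T - (s n - s 0)) (v 0) (v n) (green lam T (s 0 - s j) *\<^sub>R a) (green lam T (s n - s j) *\<^sub>R a)
     = \<alpha> 0 * Dl 0 - \<alpha> n * Dr n"
  proof -
    have "\<not> j < 0" "0 \<le> j" "n \<le> n" by auto
    then show ?thesis using gap j
      by (simp only: green_right green_left \<alpha>_def Dl_def Dr_def if_False if_True) (rule bridge, simp_all add: algebra_simps)
  qed
  have jump: "Dl k - Dr k = (if k = j then 1 else 0)" for k
  proof (cases "k = j")
    case True
    have "Dl j - Dr j = C * lam * (sinh (lam * T / 2) - sinh (- (lam * T / 2)))"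
      by (simp add: Dl_def Dr_def algebra_simps)
    also have "\<dots> = 1" using lam T shT by (simp add: C_def)
    finally show ?thesis using True by simp
  qed (auto simp: Dl_def Dr_def)
  have "loop_form lam T n s v (\<lambda>k. green lam T (s k - s j) *\<^sub>R a)
     = (\<Sum>k=1..n. \<alpha> k * Dl k - \<alpha> (k - 1) * Dr (k - 1)) + (\<alpha> 0 * Dl 0 - \<alpha> n * Dr n)"
    unfolding loop_form_def using step wrap by simp
  also have "\<dots> = (\<Sum>k=0..n. \<alpha> k * Dl k) - (\<Sum>k=0..n. \<alpha> k * Dr k)"
  proof -
    have "(\<Sum>k=0..n. \<alpha> k * Dl k) = \<alpha> 0 * Dl 0 + (\<Sum>k=1..n. \<alpha> k * Dl k)"
      by (simp add: sum.atLeast_Suc_atMost)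
    moreover have "(\<Sum>k=0..n. \<alpha> k * Dr k) = (\<Sum>k=1..n. \<alpha> (k - 1) * Dr (k - 1)) + \<alpha> n * Dr n"
      by (induction n) simp_all
    ultimately show ?thesis by (simp add: sum_subtractf)
  qed
  also have "\<dots> = (\<Sum>k=0..n. \<alpha> k * (Dl k - Dr k))" by (simp add: sum_subtractf right_diff_distrib)
  also have "\<dots> = \<alpha> j" using j by (simp add: jump if_distrib[of "(*) _"] cong: if_cong)
  finally show ?thesis by (simp add: \<alpha>_def)
qed

definition loop_shift :: "real \<Rightarrow> real \<Rightarrow> nat \<Rightarrow> (nat \<Rightarrow> real) \<Rightarrow> (nat \<Rightarrow> 'a::real_inner) \<Rightarrow> nat \<Rightarrow> 'a" where
  "loop_shift lam T n s a k = (\<Sum>j=0..n. green lam T (s k - s j) *\<^sub>R a j)"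

definition loop_variance :: "real \<Rightarrow> real \<Rightarrow> nat \<Rightarrow> (nat \<Rightarrow> real) \<Rightarrow> (nat \<Rightarrow> 'a::real_inner) \<Rightarrow> real" where
  "loop_variance lam T n s a = (\<Sum>k=0..n. \<Sum>j=0..n. green lam T (s k - s j) * (a k \<bullet> a j))"

lemma loop_variance_eq: "loop_variance lam T n s a = (\<Sum>k=0..n. a k \<bullet> loop_shift lam T n s a k)"
  by (simp add: loop_variance_def loop_shift_def inner_sum_right)

text \<open>Translating by the superposition of Green functions with weights \<open>a k\<close> changes the quadratic
  action by a linear function and a constant, so that it tilts the density exponentially.\<close>

lemma loop_density_translate:
  fixes v a :: "nat \<Rightarrow> real ^ 'd::finite"
  assumes lam: "0 < lam" and T: "0 < T" and s: "\<And>k. k < n \<Longrightarrow> s k < s (Suc k)" and gap: "s n - s 0 < T"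
  shows "loop_density lam T n s (\<lambda>k. v k + loop_shift lam T n s a k)
    = loop_density lam T n s v * exp (- (\<Sum>k=0..n. a k \<bullet> v k) - loop_variance lam T n s a / 2)"
proof -
  let ?c = "loop_shift lam T n s a"
  have form: "loop_form lam T n s v ?c = (\<Sum>j=0..n. v j \<bullet> a j)" for v
  proof -
    have "loop_form lam T n s v ?c = (\<Sum>j=0..n. loop_form lam T n s v (\<lambda>k. green lam T (s k - s j) *\<^sub>R a j))"
      unfolding loop_shift_def[abs_def] by (rule loop_form_sum)
    also have "\<dots> = (\<Sum>j=0..n. v j \<bullet> a j)"
      by (intro sum.cong refl loop_form_green[OF lam T s gap]) auto
    finally show ?thesis .
  qed
  have "loop_action lam T n s ?c = loop_variance lam T n s a / 2"
    using loop_form_self[of lam T n s ?c] form[of ?c] by (simp add: loop_variance_eq inner_commute)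
  then have "loop_action lam T n s (\<lambda>k. v k + ?c k) = loop_action lam T n s v + (\<Sum>k=0..n. a k \<bullet> v k) + loop_variance lam T n s a / 2"
    unfolding loop_action_add form by (simp add: inner_commute)
  moreover obtain C where "\<And>v :: nat \<Rightarrow> real ^ 'd. loop_density lam T n s v = C * exp (- loop_action lam T n s v)"
    using loop_density_eq_exp by blast
  ultimately show ?thesis by (simp add: exp_add[symmetric] mult.assoc)
qed

section \<open>Gaussianity and covariance of the process\<close>

lemma loop_density_cong:
  "(\<And>k. k \<le> n \<Longrightarrow> v k = w k) \<Longrightarrow> loop_density lam T n s v = loop_density lam T n s w"
  unfolding loop_density_def by (auto intro!: arg_cong2[of _ _ _ _ "(*)"] prod.cong)

context periodic_oscillator
begin

text \<open>Invariance of Lebesgue measure under the translation in \<open>loop_density_translate\<close> gives the tilting identity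
  that characterizes the centered Gaussian law.\<close>

lemma gaussian_increasing_times:
  fixes a :: "nat \<Rightarrow> real ^ 'd"
  assumes s_range: "0 \<le> s 0" "s n \<le> T" "s n - s 0 < T" and s: "\<And>k. k < n \<Longrightarrow> s k < s (Suc k)"
  shows "centered_gaussian M (\<lambda>\<omega>. \<Sum>k=0..n. a k \<bullet> Z (s k) \<omega>) (loop_variance lam T n s a)"
proof (rule centered_gaussian_by_tilting)
  have r: "0 \<le> s k \<and> s k \<le> T" if "k \<le> n" for k
    using strict_steps_less(1)[of n s 0 k, OF s] strict_steps_less(1)[of n s k n, OF s] that s_range by auto
  note m = joint_measurable[of n s, OF r]
  have Zm: "(\<lambda>\<omega>. Z (s k) \<omega>) \<in> borel_measurable M" if "k \<in> {0..n}" for k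
    using r[of k] that by (intro Z_measurable) auto
  then show "(\<lambda>\<omega>. \<Sum>k=0..n. a k \<bullet> Z (s k) \<omega>) \<in> borel_measurable M"
    by (intro borel_measurable_sum borel_measurable_inner) auto
  fix \<theta> :: real and g :: "real \<Rightarrow> ennreal" assume g [measurable]: "g \<in> borel_measurable borel"
  let ?V = "loop_variance lam T n s a" and ?\<rho> = "loop_density lam T n s :: (nat \<Rightarrow> real ^ 'd) \<Rightarrow> real"
  define y where "y v = (\<Sum>k=0..n. a k \<bullet> v k)" for v :: "nat \<Rightarrow> real ^ 'd"
  have y_m [measurable]: "y \<in> borel_measurable (lebesgue_upto n)"
    unfolding y_def by (intro borel_measurable_sum borel_measurable_inner borel_measurable_const)
      (use measurable_component_singleton[of _ "{0..n}" "\<lambda>_. lborel :: (real ^ 'd) measure"] in auto)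
  have expect: "(\<integral>\<^sup>+\<omega>. f (\<Sum>k=0..n. a k \<bullet> Z (s k) \<omega>) \<partial>M) = (\<integral>\<^sup>+v. ennreal (?\<rho> v) * f (y v) \<partial>lebesgue_upto n)"
    if [measurable]: "f \<in> borel_measurable borel" for f :: "real \<Rightarrow> ennreal"
  proof -
    have "(\<integral>\<^sup>+\<omega>. f (\<Sum>k=0..n. a k \<bullet> Z (s k) \<omega>) \<partial>M) = (\<integral>\<^sup>+\<omega>. f (y (\<lambda>k\<in>{0..n}. Z (s k) \<omega>)) \<partial>M)"
      by (simp add: y_def)
    also have "\<dots> = (\<integral>\<^sup>+v. f (y v) \<partial>distr M (lebesgue_upto n) (\<lambda>\<omega>. \<lambda>k\<in>{0..n}. Z (s k) \<omega>))"
      by (rule nn_integral_distr[symmetric, OF m]) measurable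
    also have "\<dots> = (\<integral>\<^sup>+v. ennreal (?\<rho> v) * f (y v) \<partial>lebesgue_upto n)"
    proof -
      have jd: "distr M (lebesgue_upto n) (\<lambda>\<omega>. \<lambda>k\<in>{0..n}. Z (s k) \<omega>)
        = density (lebesgue_upto n) (\<lambda>v. ennreal (?\<rho> v))"
        by (rule joint_distr) (use s_range s in auto)
      show ?thesis unfolding jd by (rule nn_integral_density) measurable
    qed
    finally show ?thesis .
  qed
  \<comment> \<open>Scaling the weights by \<open>\<theta>\<close> scales the translation by \<open>\<theta>\<close> and the variance by \<open>\<theta>\<^sup>2\<close>.\<close>
  define a' where "a' k = \<theta> *\<^sub>R a k" for k
  let ?c = "loop_shift lam T n s a'"
  have c: "?c k = \<theta> *\<^sub>R loop_shift lam T n s a k" for k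
    by (simp add: loop_shift_def a'_def scaleR_sum_right mult.commute)
  have yc: "y (\<lambda>k\<in>{0..n}. v k + ?c k) = y v + \<theta> * ?V" for v
    by (simp add: y_def c loop_variance_eq inner_add_right sum.distrib sum_distrib_left)
  have V': "loop_variance lam T n s a' = \<theta>\<^sup>2 * ?V"
    by (simp add: loop_variance_def a'_def sum_distrib_left power2_eq_square mult_ac)
  have \<rho>c: "?\<rho> (\<lambda>k\<in>{0..n}. v k + ?c k) = ?\<rho> v * exp (- (\<theta> * y v) - \<theta>\<^sup>2 * ?V / 2)" for v
  proof -
    have "?\<rho> (\<lambda>k\<in>{0..n}. v k + ?c k) = ?\<rho> (\<lambda>k. v k + ?c k)" by (rule loop_density_cong) simp
    also have "\<dots> = ?\<rho> v * exp (- (\<Sum>k=0..n. a' k \<bullet> v k) - loop_variance lam T n s a' / 2)"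
      by (rule loop_density_translate[OF lam_pos T_pos s s_range(3)])
    also have "(\<Sum>k=0..n. a' k \<bullet> v k) = \<theta> * y v" by (simp add: a'_def y_def sum_distrib_left)
    finally show ?thesis unfolding V' .
  qed
  have \<rho>0: "?\<rho> v \<ge> 0" for v by (rule order_less_imp_le[OF loop_density_nonneg[OF lam_pos T_pos s s_range(3)]])
  define F where "F v = ennreal (?\<rho> v) * (g (y v) * ennreal (exp (\<theta> * y v)))" for v
  have "(\<integral>\<^sup>+\<omega>. g (\<Sum>k=0..n. a k \<bullet> Z (s k) \<omega>) * ennreal (exp (\<theta> * (\<Sum>k=0..n. a k \<bullet> Z (s k) \<omega>))) \<partial>M)
     = (\<integral>\<^sup>+v. F v \<partial>lebesgue_upto n)"
    unfolding F_def by (rule expect) measurable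
  also have "\<dots> = (\<integral>\<^sup>+v. F (\<lambda>k\<in>{0..n}. v k + ?c k) \<partial>lebesgue_upto n)"
    unfolding F_def by (rule PiM_lborel_translate[symmetric]) (simp, measurable)
  also have "\<dots> = (\<integral>\<^sup>+v. ennreal (exp (\<theta>\<^sup>2 * ?V / 2)) * (ennreal (?\<rho> v) * g (y v + \<theta> * ?V)) \<partial>lebesgue_upto n)"
  proof (rule nn_integral_cong)
    fix v :: "nat \<Rightarrow> real ^ 'd"
    have "exp (- (\<theta> * y v) - \<theta>\<^sup>2 * ?V / 2) * exp (\<theta> * (y v + \<theta> * ?V)) = exp (\<theta>\<^sup>2 * ?V / 2)"
      unfolding exp_add[symmetric] by (simp add: algebra_simps power2_eq_square)
    then have e: "ennreal (exp (- (\<theta> * y v) - \<theta>\<^sup>2 * ?V / 2)) * ennreal (exp (\<theta> * (y v + \<theta> * ?V))) = ennreal (exp (\<theta>\<^sup>2 * ?V / 2))"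
      by (subst ennreal_mult'[symmetric]) simp_all
    have "F (\<lambda>k\<in>{0..n}. v k + ?c k) = ennreal (?\<rho> v) * g (y v + \<theta> * ?V)
        * (ennreal (exp (- (\<theta> * y v) - \<theta>\<^sup>2 * ?V / 2)) * ennreal (exp (\<theta> * (y v + \<theta> * ?V))))"
      unfolding F_def yc \<rho>c using \<rho>0 by (simp add: ennreal_mult' mult_ac)
    then show "F (\<lambda>k\<in>{0..n}. v k + ?c k) = ennreal (exp (\<theta>\<^sup>2 * ?V / 2)) * (ennreal (?\<rho> v) * g (y v + \<theta> * ?V))"
      unfolding e by (simp add: mult_ac)
  qed
  also have "\<dots> = ennreal (exp (\<theta>\<^sup>2 * ?V / 2)) * (\<integral>\<^sup>+v. ennreal (?\<rho> v) * g (y v + \<theta> * ?V) \<partial>lebesgue_upto n)"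
    by (rule nn_integral_cmult) measurable
  also have "(\<integral>\<^sup>+v. ennreal (?\<rho> v) * g (y v + \<theta> * ?V) \<partial>lebesgue_upto n)
      = (\<integral>\<^sup>+\<omega>. g ((\<Sum>k=0..n. a k \<bullet> Z (s k) \<omega>) + \<theta> * ?V) \<partial>M)"
    by (rule expect[symmetric]) measurable
  finally show "(\<integral>\<^sup>+\<omega>. g (\<Sum>k=0..n. a k \<bullet> Z (s k) \<omega>) * ennreal (exp (\<theta> * (\<Sum>k=0..n. a k \<bullet> Z (s k) \<omega>))) \<partial>M)
    = ennreal (exp (\<theta>\<^sup>2 * ?V / 2)) * (\<integral>\<^sup>+\<omega>. g ((\<Sum>k=0..n. a k \<bullet> Z (s k) \<omega>) + \<theta> * ?V) \<partial>M)" .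
qed

text \<open>Moving the time \<open>T\<close> to \<open>0\<close> leaves the covariance unchanged.\<close>

lemma green_periodic:
  assumes "t \<in> {0..T}" "u \<in> {0..T}"
  shows "green lam T ((if t = T then 0 else t) - (if u = T then 0 else u)) = green lam T (t - u)"
proof -
  have "lam * (\<bar>0 - x\<bar> - T / 2) = - (lam * (\<bar>T - x\<bar> - T / 2))" if "x \<in> {0..T}" for x
    using that by (simp add: algebra_simps abs_if)
  then have *: "green lam T (0 - x) = green lam T (T - x)" if "x \<in> {0..T}" for x
    using that unfolding green_def by (metis cosh_minus)
  have sym: "green lam T (- x) = green lam T x" for x by (simp add: green_def)
  show ?thesis
  proof (cases "t = T"; cases "u = T")
    assume "t = T" "u \<noteq> T"
    then show ?thesis using *[of u] assms by simp
  next
    assume "t \<noteq> T" "u = T"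
    then show ?thesis using *[of t] sym[of t] sym[of "T - t"] assms by simp
  qed auto
qed

text \<open>The family of times may have repetitions and may contain both \<open>0\<close> and \<open>T\<close>.  Identifying \<open>T\<close> with \<open>0\<close>
  and adding up the coefficients of equal times reduces it to increasing times that span less than the
  period.\<close>

theorem gaussian_combination:
  fixes t :: "'i \<Rightarrow> real" and a :: "'i \<Rightarrow> real ^ 'd"
  assumes I: "finite I" and t: "\<And>i. i \<in> I \<Longrightarrow> t i \<in> {0..T}"
  shows "centered_gaussian M (\<lambda>\<omega>. \<Sum>i\<in>I. a i \<bullet> Z (t i) \<omega>) (\<Sum>i\<in>I. \<Sum>j\<in>I. green lam T (t i - t j) * (a i \<bullet> a j))"
proof (cases "I = {}")
  case True
  then show ?thesis by (simp add: centered_gaussian_def)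
next
  case False
  define r where "r i = (if t i = T then 0 else t i)" for i
  have r: "0 \<le> r i" "r i < T" if "i \<in> I" for i using t[OF that] T_pos by (auto simp: r_def)
  obtain n s where s: "\<And>k. k < n \<Longrightarrow> s k < s (Suc k)" and bij: "bij_betw s {0..n} (r ` I)"
    using finite_real_set_enumeration[of "r ` I"] I False by blast
  have sI: "s k \<in> r ` I" if "k \<le> n" for k using bij that by (auto simp: bij_betw_def)
  have range: "0 \<le> s k" "s k < T" if "k \<le> n" for k using sI[OF that] r by auto
  define b where "b \<tau> = (\<Sum>i\<in>{i \<in> I. r i = \<tau>}. a i)" for \<tau>
  have regroup: "(\<Sum>k=0..n. b (s k) \<bullet> \<phi> (s k)) = (\<Sum>i\<in>I. a i \<bullet> \<phi> (r i))" for \<phi> :: "real \<Rightarrow> real ^ 'd"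
  proof -
    have "(\<Sum>k=0..n. b (s k) \<bullet> \<phi> (s k)) = (\<Sum>\<tau>\<in>r ` I. b \<tau> \<bullet> \<phi> \<tau>)"
      using sum.reindex_bij_betw[OF bij, of "\<lambda>\<tau>. b \<tau> \<bullet> \<phi> \<tau>"] .
    also have "\<dots> = (\<Sum>\<tau>\<in>r ` I. \<Sum>i\<in>{i \<in> I. r i = \<tau>}. a i \<bullet> \<phi> (r i))"
      unfolding b_def inner_sum_left by (intro sum.cong refl) auto
    also have "\<dots> = (\<Sum>i\<in>I. a i \<bullet> \<phi> (r i))" by (rule sum.image_gen[OF I, symmetric])
    finally show ?thesis .
  qed
  have "loop_variance lam T n s (\<lambda>k. b (s k)) = (\<Sum>k=0..n. b (s k) \<bullet> (\<Sum>j=0..n. green lam T (s k - s j) *\<^sub>R b (s j)))"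
    by (simp add: loop_variance_def inner_sum_right)
  also have "\<dots> = (\<Sum>i\<in>I. a i \<bullet> (\<Sum>j=0..n. green lam T (r i - s j) *\<^sub>R b (s j)))"
    by (rule regroup[of "\<lambda>\<tau>. \<Sum>j=0..n. green lam T (\<tau> - s j) *\<^sub>R b (s j)"])
  also have "\<dots> = (\<Sum>i\<in>I. \<Sum>j=0..n. b (s j) \<bullet> (green lam T (r i - s j) *\<^sub>R a i))"
    by (simp add: inner_sum_right inner_commute)
  also have "\<dots> = (\<Sum>i\<in>I. \<Sum>j\<in>I. a j \<bullet> (green lam T (r i - r j) *\<^sub>R a i))"
    by (intro sum.cong refl regroup)
  also have "\<dots> = (\<Sum>i\<in>I. \<Sum>j\<in>I. green lam T (t i - t j) * (a i \<bullet> a j))"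
    using t by (intro sum.cong refl) (simp add: r_def green_periodic inner_commute)
  finally have V: "loop_variance lam T n s (\<lambda>k. b (s k)) = (\<Sum>i\<in>I. \<Sum>j\<in>I. green lam T (t i - t j) * (a i \<bullet> a j))" .
  have "centered_gaussian M (\<lambda>\<omega>. \<Sum>k=0..n. b (s k) \<bullet> Z (s k) \<omega>) (loop_variance lam T n s (\<lambda>k. b (s k)))"
    using range[of 0] range[of n] by (intro gaussian_increasing_times s) auto
  then have g: "centered_gaussian M (\<lambda>\<omega>. \<Sum>i\<in>I. a i \<bullet> Z (r i) \<omega>) (\<Sum>i\<in>I. \<Sum>j\<in>I. green lam T (t i - t j) * (a i \<bullet> a j))"
    unfolding V regroup[of "\<lambda>\<tau>. Z \<tau> _"] .
  have AE: "AE \<omega> in M. (\<Sum>i\<in>I. a i \<bullet> Z (r i) \<omega>) = (\<Sum>i\<in>I. a i \<bullet> Z (t i) \<omega>)"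
    using endpoints_AE_equal
  proof eventually_elim
    case (elim \<omega>)
    then show ?case by (intro sum.cong) (auto simp: r_def)
  qed
  have m: "(\<lambda>\<omega>. \<Sum>i\<in>I. a i \<bullet> Z (t i) \<omega>) \<in> borel_measurable M"
    using t by (intro borel_measurable_sum borel_measurable_inner borel_measurable_const Z_measurable) auto
  have m': "(\<lambda>\<omega>. \<Sum>i\<in>I. a i \<bullet> Z (r i) \<omega>) \<in> borel_measurable M"
    using r by (intro borel_measurable_sum borel_measurable_inner borel_measurable_const Z_measurable) (auto intro: less_imp_le)
  have "distr M borel (\<lambda>\<omega>. \<Sum>i\<in>I. a i \<bullet> Z (r i) \<omega>) = distr M borel (\<lambda>\<omega>. \<Sum>i\<in>I. a i \<bullet> Z (t i) \<omega>)"
    by (rule distr_cong_AE[OF refl refl AE m' m])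
  moreover have "AE \<omega> in M. (\<Sum>i\<in>I. a i \<bullet> Z (t i) \<omega>) = 0" if "AE \<omega> in M. (\<Sum>i\<in>I. a i \<bullet> Z (r i) \<omega>) = 0"
    using that AE by eventually_elim simp
  ultimately show ?thesis using g m unfolding centered_gaussian_def by auto
qed

theorem gaussian: "gaussian_process M T Z"
  unfolding gaussian_process_def
proof (intro conjI allI impI process)
  fix I :: "real set" and a :: "real \<Rightarrow> real ^ 'd"
  assume "finite I" "I \<subseteq> {0..T}"
  then show "gaussian_rv M (\<lambda>\<omega>. \<Sum>\<tau>\<in>I. a \<tau> \<bullet> Z \<tau> \<omega>)"
    using centered_gaussian_rv[OF gaussian_combination[of I "\<lambda>\<tau>. \<tau>" a]] by blast
qed

text \<open>Polarization: the variance of the sum of two components is known as well as those of the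
  components.\<close>

theorem covariance:
  assumes s: "s \<in> {0..T}" and t: "t \<in> {0..T}"
  shows "integrable M (\<lambda>\<omega>. Z s \<omega> $ i * Z t \<omega> $ j)"
    and "(\<integral>\<omega>. Z s \<omega> $ i * Z t \<omega> $ j \<partial>M) = green lam T (t - s) * (if i = j then 1 else 0)"
proof -
  define X where "X \<omega> = Z s \<omega> $ i" for \<omega>
  define Y where "Y \<omega> = Z t \<omega> $ j" for \<omega>
  have X: "has_bochner_integral M (\<lambda>\<omega>. (X \<omega>)\<^sup>2) (green lam T 0)"
    using centered_gaussian_second_moment[OF gaussian_combination[of "{()}" "\<lambda>_. s" "\<lambda>_. axis i 1"]] s
    by (simp add: X_def inner_axis' inner_axis_axis)
  have Y: "has_bochner_integral M (\<lambda>\<omega>. (Y \<omega>)\<^sup>2) (green lam T 0)"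
    using centered_gaussian_second_moment[OF gaussian_combination[of "{()}" "\<lambda>_. t" "\<lambda>_. axis j 1"]] t
    by (simp add: Y_def inner_axis' inner_axis_axis)
  have sym: "green lam T (s - t) = green lam T (t - s)" by (simp add: green_def abs_minus_commute)
  have XY: "has_bochner_integral M (\<lambda>\<omega>. (X \<omega> + Y \<omega>)\<^sup>2) (2 * green lam T 0 + 2 * (green lam T (t - s) * (if i = j then 1 else 0)))"
  proof -
    let ?t = "\<lambda>c. if c then s else t" and ?a = "\<lambda>c. axis (if c then i else j) (1 :: real)"
    have "has_bochner_integral M (\<lambda>\<omega>. (\<Sum>c\<in>UNIV. ?a c \<bullet> Z (?t c) \<omega>)\<^sup>2)
        (\<Sum>c\<in>UNIV. \<Sum>c'\<in>UNIV. green lam T (?t c - ?t c') * (?a c \<bullet> ?a c'))"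
      by (intro centered_gaussian_second_moment gaussian_combination) (use s t in auto)
    moreover have "(\<Sum>c\<in>UNIV. ?a c \<bullet> Z (?t c) \<omega>) = X \<omega> + Y \<omega>" for \<omega>
      by (simp add: UNIV_bool X_def Y_def inner_axis')
    moreover have "(\<Sum>c\<in>UNIV. \<Sum>c'\<in>UNIV. green lam T (?t c - ?t c') * (?a c \<bullet> ?a c'))
        = 2 * green lam T 0 + 2 * (green lam T (t - s) * (if i = j then 1 else 0))"
      by (cases "i = j") (simp_all add: UNIV_bool inner_axis_axis sym)
    ultimately show ?thesis by simp
  qed
  have eq: "X \<omega> * Y \<omega> = ((X \<omega> + Y \<omega>)\<^sup>2 - (X \<omega>)\<^sup>2 - (Y \<omega>)\<^sup>2) / 2" for \<omega>
    by (simp add: power2_eq_square algebra_simps)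
  have "has_bochner_integral M (\<lambda>\<omega>. ((X \<omega> + Y \<omega>)\<^sup>2 - (X \<omega>)\<^sup>2 - (Y \<omega>)\<^sup>2) / 2)
     ((2 * green lam T 0 + 2 * (green lam T (t - s) * (if i = j then 1 else 0)) - green lam T 0 - green lam T 0) / 2)"
    by (intro has_bochner_integral_divide has_bochner_integral_diff XY X Y)
  then have "has_bochner_integral M (\<lambda>\<omega>. X \<omega> * Y \<omega>) (green lam T (t - s) * (if i = j then 1 else 0))"
    unfolding eq[symmetric] by simp
  then show "integrable M (\<lambda>\<omega>. Z s \<omega> $ i * Z t \<omega> $ j)"
    "(\<integral>\<omega>. Z s \<omega> $ i * Z t \<omega> $ j \<partial>M) = green lam T (t - s) * (if i = j then 1 else 0)"
    by (auto simp: has_bochner_integral_iff X_def Y_def)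
qed

end

section \<open>Failure of the Markov property\<close>

lemma open_lborel_pos:
  fixes U :: "'a::euclidean_space set"
  assumes "open U" "U \<noteq> {}"
  shows "emeasure lborel U \<noteq> 0"
proof
  assume "emeasure lborel U = 0"
  then have "U \<in> null_sets lborel" using assms by (auto simp: null_sets_def)
  then have "negligible U" by (simp add: negligible_iff_null_sets null_sets_completionI)
  then show False using open_not_negligible assms by blast
qed

lemma subalgebra_sigma_of:
  assumes "process_on M T Z" "I \<subseteq> {0..T}"
  shows "subalgebra M (sigma_of M Z I)"
proof -
  have g: "{Z \<tau> -` F \<inter> space M | \<tau> F. \<tau> \<in> I \<and> F \<in> sets borel} \<subseteq> sets M"
    using assms by (auto simp: process_on_def intro!: measurable_sets)
  then have p: "{Z \<tau> -` F \<inter> space M | \<tau> F. \<tau> \<in> I \<and> F \<in> sets borel} \<subseteq> Pow (space M)" by auto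
  show ?thesis unfolding subalgebra_def sigma_of_def
    using g by (simp add: space_measure_of[OF p] sets_measure_of[OF p] sets.sigma_sets_subset)
qed

lemma sigma_of_single:
  "sets (sigma_of M Z {t}) = {Z t -` F \<inter> space M | F. F \<in> sets borel}"
proof -
  have p: "{Z \<tau> -` F \<inter> space M | \<tau> F. \<tau> \<in> {t} \<and> F \<in> sets borel} \<subseteq> Pow (space M)" by auto
  have "sets (sigma_of M Z {t}) = sigma_sets (space M) {Z t -` F \<inter> space M | F. F \<in> sets borel}"
    unfolding sigma_of_def sets_measure_of[OF p] by simp
  also have "\<dots> = sets (vimage_algebra (space M) (Z t) borel)" by (rule sets_vimage_algebra[symmetric])
  also have "\<dots> = {Z t -` F \<inter> space M | F. F \<in> sets borel}" by (rule sets_vimage_algebra2) auto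
  finally show ?thesis .
qed

context periodic_oscillator
begin

text \<open>The joint law at two distinct times within a period has a positive density.\<close>

lemma two_time_positive:
  assumes c: "0 < c" "c < T" and F [measurable]: "F \<in> sets borel" and G [measurable]: "G \<in> sets borel"
    and zero: "emeasure M {\<omega> \<in> space M. Z 0 \<omega> \<in> F \<and> Z c \<omega> \<in> G} = 0"
  shows "emeasure lborel F = 0 \<or> emeasure lborel G = 0"
proof -
  interpret product_sigma_finite "\<lambda>_. lborel :: (real ^ 'd) measure" ..
  define s where "s = (\<lambda>k::nat. if k = 0 then 0 else c)"
  define A where "A = (\<lambda>k::nat. if k = 0 then F else G)"
  have A: "A k \<in> sets borel" for k by (simp add: A_def)
  have box [measurable]: "rect 1 A \<in> sets (lebesgue_upto 1)" by (rule sets_PiE_upto[OF A])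
  have pos: "loop_density lam T 1 s v > 0" for v :: "nat \<Rightarrow> real ^ 'd"
    by (rule loop_density_nonneg[OF lam_pos T_pos]) (use c in \<open>auto simp: s_def\<close>)
  have "emeasure M {\<omega> \<in> space M. \<forall>k\<le>1. Z (s k) \<omega> \<in> A k} =
    (\<integral>\<^sup>+v\<in>rect 1 A. ennreal (loop_density lam T 1 s v) \<partial>lebesgue_upto 1)"
    by (rule law) (use c A in \<open>auto simp: s_def\<close>)
  moreover have "{\<omega> \<in> space M. \<forall>k\<le>1. Z (s k) \<omega> \<in> A k} = {\<omega> \<in> space M. Z 0 \<omega> \<in> F \<and> Z c \<omega> \<in> G}"
    by (auto simp: s_def A_def split: if_splits dest: spec[of _ 0] spec[of _ 1])
  ultimately have "(\<integral>\<^sup>+v\<in>rect 1 A. ennreal (loop_density lam T 1 s v) \<partial>lebesgue_upto 1) = 0"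
    using zero by simp
  then have "AE v in lebesgue_upto 1. ennreal (loop_density lam T 1 s v) * indicator (rect 1 A) v = 0"
  proof (subst (asm) nn_integral_0_iff_AE)
    show "(\<lambda>v. ennreal (loop_density lam T 1 s v) * indicator (rect 1 A) v)
      \<in> borel_measurable (lebesgue_upto 1)" by measurable
  qed
  then have "AE v in lebesgue_upto 1. v \<notin> rect 1 A"
  proof eventually_elim
    case (elim v)
    then show ?case using pos[of v] by (auto simp: indicator_def split: if_splits)
  qed
  then have "emeasure (lebesgue_upto 1) (rect 1 A) = 0"
    by (subst (asm) AE_iff_measurable[OF box]) (auto simp: space_PiM)
  then have "(\<Prod>k\<in>{0..1::nat}. emeasure lborel (A k)) = 0"
    by (subst (asm) emeasure_PiM) (auto simp: A)
  moreover have "{0..1::nat} = {0, 1}" by auto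
  ultimately show ?thesis by (simp add: A_def)
qed

text \<open>For a Markov process, the conditional probability of \<open>Z T \<in> F\<close> given the past up to \<open>T / 2\<close> would be a
  function of \<open>Z (T / 2)\<close>.  But \<open>Z T = Z 0\<close> belongs to that past, so the indicator of \<open>Z 0 \<in> F\<close> would be
  a function of \<open>Z (T / 2)\<close> almost surely.  This contradicts the positive joint density as soon as \<open>F\<close> and
  its complement both have positive Lebesgue measure.\<close>

theorem not_markov: "\<not> markov_process M T Z"
proof
  assume markov: "markov_process M T Z"
  define c where "c = T / 2"
  have c: "0 < c" "c < T" using T_pos by (auto simp: c_def)
  define F where "F = ball (0 :: real ^ 'd) 1"
  have [measurable]: "Z 0 \<in> borel_measurable M" "Z T \<in> borel_measurable M" "Z c \<in> borel_measurable M"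
    using c by (auto intro!: Z_measurable)
  have F_m [measurable]: "F \<in> sets borel" by (simp add: F_def)
  let ?P = "sigma_of M Z {0..c}" and ?C = "sigma_of M Z {c}"
  define h where "h \<omega> = (indicator F (Z T \<omega>) :: real)" for \<omega>
  define h0 where "h0 \<omega> = (indicator F (Z 0 \<omega>) :: real)" for \<omega>
  interpret P: finite_measure_subalgebra M ?P
    using subalgebra_sigma_of[OF process, of "{0..c}"] c by unfold_locales auto
  interpret C: finite_measure_subalgebra M ?C
    using subalgebra_sigma_of[OF process, of "{c}"] c by unfold_locales auto
  have "AE \<omega> in M. complex_cond_exp M ?P (\<lambda>\<omega>. complex_of_real (indicator F (Z T \<omega>))) \<omega>
      = complex_cond_exp M ?C (\<lambda>\<omega>. complex_of_real (indicator F (Z T \<omega>))) \<omega>"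
  proof -
    have "(\<lambda>x :: real ^ 'd. complex_of_real (indicator F x)) \<in> borel_measurable borel" by measurable
    moreover have "bounded (range (\<lambda>x :: real ^ 'd. complex_of_real (indicator F x)))"
      by (rule boundedI[of _ 1]) (auto simp: indicator_def)
    ultimately show ?thesis using markov c unfolding markov_process_def by fastforce
  qed
  then have cond: "AE \<omega> in M. real_cond_exp M ?P h \<omega> = real_cond_exp M ?C h \<omega>"
    unfolding h_def by eventually_elim (simp add: complex_cond_exp_def)
  have h0P: "h0 \<in> borel_measurable ?P"
  proof -
    have "Z 0 -` F \<inter> space M \<in> sets ?P"
    proof -
      have p: "{Z \<tau> -` F \<inter> space M | \<tau> F. \<tau> \<in> {0..c} \<and> F \<in> sets borel} \<subseteq> Pow (space M)" by auto
      show ?thesis unfolding sigma_of_def sets_measure_of[OF p]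
        using c F_m by (intro sigma_sets.Basic) (auto intro!: exI[of _ 0] exI[of _ F])
    qed
    moreover have "h0 = indicator (Z 0 -` F)" by (auto simp: h0_def indicator_def fun_eq_iff)
    moreover have "space ?P = space M" using P.subalg by (simp add: subalgebra_def)
    ultimately show ?thesis by (simp add: borel_measurable_indicator_iff)
  qed
  have hm: "h \<in> borel_measurable M" "h0 \<in> borel_measurable M" unfolding h_def h0_def by measurable
  have "AE \<omega> in M. h \<omega> = h0 \<omega>"
    using endpoints_AE_equal by eventually_elim (simp add: h_def h0_def)
  then have 1: "AE \<omega> in M. real_cond_exp M ?P h \<omega> = real_cond_exp M ?P h0 \<omega>"
    by (rule P.real_cond_exp_cong[OF _ hm])
  have "integrable M h0"
    by (rule integrable_const_bound[of _ 1]) (use hm in \<open>auto simp: h0_def indicator_def\<close>)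
  then have 2: "AE \<omega> in M. real_cond_exp M ?P h0 \<omega> = h0 \<omega>"
    using h0P by (rule P.real_cond_exp_F_meas)
  \<comment> \<open>The threshold \<open>1 / 2\<close> separates the two values of the indicator.\<close>
  define A where "A = {\<omega> \<in> space M. real_cond_exp M ?C h \<omega> > 1 / 2}"
  have "A \<in> sets ?C"
  proof -
    have "{\<omega> \<in> space ?C. real_cond_exp M ?C h \<omega> > 1 / 2} \<in> sets ?C" by measurable
    moreover have "space ?C = space M" using C.subalg by (simp add: subalgebra_def)
    ultimately show ?thesis by (simp add: A_def)
  qed
  then obtain B where B [measurable]: "B \<in> sets borel" and AB: "A = Z c -` B \<inter> space M"
    unfolding sigma_of_single by blast
  have key: "AE \<omega> in M. Z 0 \<omega> \<in> F \<longleftrightarrow> Z c \<omega> \<in> B"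
    using cond 1 2 AE_space
  proof eventually_elim
    case (elim \<omega>)
    then have "Z c \<omega> \<in> B \<longleftrightarrow> h0 \<omega> > 1 / 2" using AB by (auto simp: A_def)
    then show ?case by (simp add: h0_def indicator_def)
  qed
  have z1: "emeasure M {\<omega> \<in> space M. Z 0 \<omega> \<in> F \<and> Z c \<omega> \<in> - B} = 0"
    by (rule emeasure_eq_0_AE) (use key in \<open>eventually_elim, auto\<close>)
  have z2: "emeasure M {\<omega> \<in> space M. Z 0 \<omega> \<in> - F \<and> Z c \<omega> \<in> B} = 0"
    by (rule emeasure_eq_0_AE) (use key in \<open>eventually_elim, auto\<close>)
  have Fpos: "emeasure lborel F \<noteq> 0" by (rule open_lborel_pos) (auto simp: F_def)
  have "emeasure lborel (- cball (0 :: real ^ 'd) 1) \<noteq> 0"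
  proof (rule open_lborel_pos)
    have "norm (2 *\<^sub>R axis undefined 1 :: real ^ 'd) = 2" by (simp add: norm_axis_1)
    then have "2 *\<^sub>R axis undefined 1 \<in> - cball (0 :: real ^ 'd) 1" by simp
    then show "- cball (0 :: real ^ 'd) 1 \<noteq> {}" by blast
  qed auto
  moreover have "emeasure lborel (- cball (0 :: real ^ 'd) 1) \<le> emeasure lborel (- F)"
    by (rule emeasure_mono) (auto simp: F_def)
  ultimately have Fc: "emeasure lborel (- F) \<noteq> 0" by auto
  have "emeasure lborel (- B) = 0" using two_time_positive[OF c F_m _ z1] Fpos by simp
  moreover have "emeasure lborel B = 0" using two_time_positive[OF c _ B z2] Fc by simp
  ultimately have "emeasure lborel (B \<union> - B) = 0"
    by (intro antisym order_trans[OF emeasure_subadditive]) auto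
  then show False using open_lborel_pos[of "UNIV :: (real ^ 'd) set"] by simp
qed

end

section \<open>Square-integrable functions\<close>

lemma borel_measurable_cnj_compose [measurable (raw)]:
  "f \<in> borel_measurable M \<Longrightarrow> (\<lambda>x. cnj (f x)) \<in> borel_measurable M"
  by (rule measurable_compose[of f M borel cnj borel])
     (auto intro!: borel_measurable_continuous_onI continuous_intros)

lemma L2_measurable [measurable_dest]: "f \<in> L2 \<Longrightarrow> f \<in> borel_measurable lebesgue"
  by (simp add: L2_def)

lemma L2_integrable: "f \<in> L2 \<Longrightarrow> integrable lebesgue (\<lambda>x. (norm (f x))\<^sup>2)"
  by (simp add: L2_def)

lemma L2I_bound:
  assumes [measurable]: "f \<in> borel_measurable lebesgue" and "integrable lebesgue g"
    and "AE x in lebesgue. (norm (f x))\<^sup>2 \<le> g x"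
  shows "f \<in> L2"
proof -
  have "integrable lebesgue (\<lambda>x. (norm (f x))\<^sup>2)"
    by (rule Bochner_Integration.integrable_bound[OF assms(2)]) (use assms(3) in auto)
  then show ?thesis by (simp add: L2_def)
qed

lemma L2_integrable_norm_mult:
  assumes [measurable]: "f \<in> L2" "g \<in> L2"
  shows "integrable lebesgue (\<lambda>x. norm (f x) * norm (g x))"
proof (rule Bochner_Integration.integrable_bound)
  show "integrable lebesgue (\<lambda>x. (norm (f x))\<^sup>2 + (norm (g x))\<^sup>2)"
    by (intro Bochner_Integration.integrable_add L2_integrable assms)
  have "a * b \<le> a\<^sup>2 + b\<^sup>2" for a b :: real
  proof -
    have "2 * (a * b) \<le> a\<^sup>2 + b\<^sup>2" using sum_squares_bound[of a b] by simp
    moreover have "0 \<le> a\<^sup>2 + b\<^sup>2" by simp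
    ultimately show ?thesis by linarith
  qed
  then show "AE x in lebesgue. norm (norm (f x) * norm (g x)) \<le> norm ((norm (f x))\<^sup>2 + (norm (g x))\<^sup>2)"
    by (intro AE_I2) (simp add: abs_mult)
qed measurable

lemma L2_integrable_mult:
  assumes [measurable]: "f \<in> L2" "g \<in> L2"
  shows "integrable lebesgue (\<lambda>x. f x * cnj (g x))"
  by (rule Bochner_Integration.integrable_bound[OF L2_integrable_norm_mult[OF assms]])
     (auto simp: norm_mult)

lemma L2_add: assumes [measurable]: "f \<in> L2" "g \<in> L2" shows "(\<lambda>x. f x + g x) \<in> L2"
proof (rule L2I_bound)
  show "integrable lebesgue (\<lambda>x. 2 * (norm (f x))\<^sup>2 + 2 * (norm (g x))\<^sup>2)"
    by (intro Bochner_Integration.integrable_add integrable_mult_right L2_integrable assms)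
  have "(norm (a + b))\<^sup>2 \<le> 2 * (norm a)\<^sup>2 + 2 * (norm b)\<^sup>2" for a b :: complex
  proof -
    have "(norm (a + b))\<^sup>2 \<le> (norm a + norm b)\<^sup>2" by (intro power_mono norm_triangle_ineq) auto
    also have "\<dots> \<le> 2 * (norm a)\<^sup>2 + 2 * (norm b)\<^sup>2"
      using zero_le_power2[of "norm a - norm b"] by (simp add: power2_eq_square algebra_simps)
    finally show ?thesis .
  qed
  then show "AE x in lebesgue. (norm (f x + g x))\<^sup>2 \<le> 2 * (norm (f x))\<^sup>2 + 2 * (norm (g x))\<^sup>2" by simp
qed measurable

lemma L2_scale: assumes [measurable]: "f \<in> L2" shows "(\<lambda>x. c * f x) \<in> L2"
  by (rule L2I_bound[where g="\<lambda>x. (norm c)\<^sup>2 * (norm (f x))\<^sup>2"])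
     (use L2_integrable[OF assms] in \<open>auto simp: norm_mult power_mult_distrib\<close>)

lemma L2_diff: assumes "f \<in> L2" "g \<in> L2" shows "(\<lambda>x. f x - g x) \<in> L2"
  using L2_add[OF assms(1) L2_scale[OF assms(2), of "-1"]] by simp

lemma L2_sum_finite: "(\<And>i. u i \<in> L2) \<Longrightarrow> finite I \<Longrightarrow> (\<lambda>x. \<Sum>i\<in>I. u i x) \<in> L2"
proof (induction I rule: infinite_finite_induct)
  case empty
  then show ?case by (simp add: L2_def)
next
  case (insert i I)
  then show ?case by (simp add: L2_add)
qed simp

lemma L2_inner_add_left:
  "f \<in> L2 \<Longrightarrow> g \<in> L2 \<Longrightarrow> h \<in> L2 \<Longrightarrow> L2_inner (\<lambda>x. f x + g x) h = L2_inner f h + L2_inner g h"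
  unfolding L2_inner_def
  by (simp add: algebra_simps Bochner_Integration.integral_add L2_integrable_mult)

lemma L2_inner_diff_left:
  "f \<in> L2 \<Longrightarrow> g \<in> L2 \<Longrightarrow> h \<in> L2 \<Longrightarrow> L2_inner (\<lambda>x. f x - g x) h = L2_inner f h - L2_inner g h"
  unfolding L2_inner_def
  by (simp add: algebra_simps Bochner_Integration.integral_diff L2_integrable_mult)

lemma L2_inner_scale_left: "L2_inner (\<lambda>x. c * f x) h = c * L2_inner f h"
  unfolding L2_inner_def by (simp add: mult.assoc)

lemma L2_inner_scale_real_right:
  "L2_inner f (\<lambda>x. of_real c * h x) = of_real c * L2_inner f h"
  unfolding L2_inner_def by (simp add: mult.left_commute)

lemma L2_inner_sum_left:
  assumes "\<And>i. u i \<in> L2" "h \<in> L2" "finite I"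
  shows "L2_inner (\<lambda>x. \<Sum>i\<in>I. u i x) h = (\<Sum>i\<in>I. L2_inner (u i) h)"
  using assms(3)
proof (induction I)
  case empty
  then show ?case by (simp add: L2_inner_def)
next
  case (insert i I)
  then show ?case using assms by (simp add: L2_inner_add_left L2_sum_finite)
qed

lemma L2_inner_cnj: "L2_inner g f = cnj (L2_inner f g)"
proof -
  have "cnj (L2_inner f g) = (\<integral>x. cnj (f x * cnj (g x)) \<partial>lebesgue)"
    unfolding L2_inner_def by (rule Bochner_Integration.integral_cnj[symmetric])
  then show ?thesis by (simp add: L2_inner_def mult.commute)
qed

lemma L2_norm_nonneg: "L2_norm f \<ge> 0"
  by (simp add: L2_norm_def)

lemma L2_norm_sq: "(L2_norm f)\<^sup>2 = (\<integral>x. (norm (f x))\<^sup>2 \<partial>lebesgue)"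
  by (simp add: L2_norm_def)

lemma L2_inner_self: "L2_inner f f = of_real ((L2_norm f)\<^sup>2)"
  unfolding L2_inner_def L2_norm_sq
  by (simp only: complex_norm_square[symmetric] integral_complex_of_real)

lemma L2_norm_scale: "L2_norm (\<lambda>x. c * f x) = norm c * L2_norm f"
  unfolding L2_norm_def by (simp add: norm_mult power_mult_distrib real_sqrt_mult)

text \<open>From nonnegativity of the quadratic form in \<open>(s, t)\<close> that is the integral of
  \<open>(s \<bar>f\<bar> - t \<bar>g\<bar>)\<^sup>2\<close>.\<close>

lemma L2_Cauchy_Schwarz:
  assumes "f \<in> L2" "g \<in> L2"
  shows "norm (L2_inner f g) \<le> L2_norm f * L2_norm g"
proof -
  define a b p where "a = (L2_norm f)\<^sup>2" and "b = (L2_norm g)\<^sup>2"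
    and "p = (\<integral>x. norm (f x) * norm (g x) \<partial>lebesgue)"
  have ab: "a \<ge> 0" "b \<ge> 0" by (auto simp: a_def b_def)
  have quad: "0 \<le> s\<^sup>2 * a - 2 * s * t * p + t\<^sup>2 * b" for s t
  proof -
    have "0 \<le> (\<integral>x. (s * norm (f x) - t * norm (g x))\<^sup>2 \<partial>lebesgue)" by simp
    also have "\<dots> = (\<integral>x. s\<^sup>2 * (norm (f x))\<^sup>2 - 2 * s * t * (norm (f x) * norm (g x)) + t\<^sup>2 * (norm (g x))\<^sup>2 \<partial>lebesgue)"
      by (simp add: power2_eq_square algebra_simps)
    also have "\<dots> = s\<^sup>2 * a - 2 * s * t * p + t\<^sup>2 * b"
      unfolding a_def b_def p_def L2_norm_sq
      using L2_integrable[OF assms(1)] L2_integrable[OF assms(2)] L2_integrable_norm_mult[OF assms]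
      by simp
    finally show ?thesis .
  qed
  have "p\<^sup>2 \<le> a * b"
  proof (cases "b = 0")
    case False
    have "0 \<le> b * (a * b - p\<^sup>2)" using quad[of b p] by (simp add: power2_eq_square algebra_simps)
    then show ?thesis using False ab by (simp add: zero_le_mult_iff)
  next
    case True
    have "0 \<le> p\<^sup>2 * a - 2 * (a + 1) * p\<^sup>2"
      using quad[of p "a + 1"] True by (simp add: power2_eq_square algebra_simps)
    also have "\<dots> = - (p\<^sup>2 * (a + 2))" by (simp add: algebra_simps)
    finally have "p\<^sup>2 * (a + 2) \<le> 0" by simp
    then show ?thesis using True ab by (auto simp: mult_le_0_iff)
  qed
  then have "p \<le> L2_norm f * L2_norm g"
    unfolding a_def b_def power_mult_distrib[symmetric]
    by (rule power2_le_imp_le) (simp add: L2_norm_nonneg)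
  moreover have "norm (L2_inner f g) \<le> p"
    unfolding L2_inner_def p_def using integral_norm_bound[of lebesgue "\<lambda>x. f x * cnj (g x)"]
    by (simp add: norm_mult)
  ultimately show ?thesis by simp
qed

lemma has_L2_sum_unique_AE:
  assumes u: "has_L2_sum u g" and v: "has_L2_sum u g'"
  shows "AE x in lebesgue. g x = g' x"
proof -
  have m: "g \<in> L2" "g' \<in> L2" "\<And>i. u i \<in> L2" using u v by (auto simp: has_L2_sum_def)
  define d where "d g I = L2_norm (\<lambda>x. (\<Sum>i\<in>I. u i x) - g x)" for g I
  have lim: "((\<lambda>I. 2 * (d g I)\<^sup>2 + 2 * (d g' I)\<^sup>2) \<longlongrightarrow> 2 * 0\<^sup>2 + 2 * 0\<^sup>2) (finite_subsets_at_top UNIV)"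
    by (intro tendsto_intros) (use u v in \<open>auto simp: has_L2_sum_def d_def\<close>)
  have "(L2_norm (\<lambda>x. g x - g' x))\<^sup>2 \<le> 2 * (d g I)\<^sup>2 + 2 * (d g' I)\<^sup>2" if I: "finite I" for I
  proof -
    have L: "(\<lambda>x. (\<Sum>i\<in>I. u i x) - g x) \<in> L2" "(\<lambda>x. (\<Sum>i\<in>I. u i x) - g' x) \<in> L2"
      by (intro L2_diff L2_sum_finite m I)+
    have ineq: "(norm (a - b))\<^sup>2 \<le> 2 * (norm (c - a))\<^sup>2 + 2 * (norm (c - b))\<^sup>2" for a b c :: complex
    proof -
      have "(norm (a - b))\<^sup>2 \<le> (norm (c - a) + norm (c - b))\<^sup>2"
        by (intro power_mono) (use norm_triangle_ineq4[of "c - b" "c - a"] in auto)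
      also have "\<dots> \<le> 2 * (norm (c - a))\<^sup>2 + 2 * (norm (c - b))\<^sup>2"
        using zero_le_power2[of "norm (c - a) - norm (c - b)"] by (simp add: power2_eq_square algebra_simps)
      finally show ?thesis .
    qed
    have "(L2_norm (\<lambda>x. g x - g' x))\<^sup>2 \<le> (\<integral>x. 2 * (norm ((\<Sum>i\<in>I. u i x) - g x))\<^sup>2 + 2 * (norm ((\<Sum>i\<in>I. u i x) - g' x))\<^sup>2 \<partial>lebesgue)"
      unfolding L2_norm_sq
      by (intro integral_mono Bochner_Integration.integrable_add integrable_mult_right L2_integrable L L2_diff m ineq)
    also have "\<dots> = 2 * (d g I)\<^sup>2 + 2 * (d g' I)\<^sup>2"
      unfolding d_def L2_norm_sq using L2_integrable[OF L(1)] L2_integrable[OF L(2)] by simp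
    finally show ?thesis .
  qed
  then have "(L2_norm (\<lambda>x. g x - g' x))\<^sup>2 \<le> 2 * 0\<^sup>2 + 2 * 0\<^sup>2"
    by (intro tendsto_lowerbound[OF lim]) auto
  then have "(\<integral>x. (norm (g x - g' x))\<^sup>2 \<partial>lebesgue) = 0"
    unfolding L2_norm_sq by (intro antisym) auto
  then have "AE x in lebesgue. (norm (g x - g' x))\<^sup>2 = 0"
    by (subst (asm) integral_nonneg_eq_0_iff_AE) (auto intro!: L2_integrable L2_diff m simp del: norm_minus_commute)
  then show ?thesis by auto
qed

text \<open>Taking the inner product is continuous, so it may be applied term by term.\<close>

lemma has_L2_sum_inner:
  assumes u: "has_L2_sum u g" and h: "h \<in> L2"
  shows "((\<lambda>i. L2_inner (u i) h) has_sum L2_inner g h) UNIV"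
proof -
  have m: "g \<in> L2" "\<And>i. u i \<in> L2" using u by (auto simp: has_L2_sum_def)
  have "((\<lambda>I. (\<Sum>i\<in>I. L2_inner (u i) h) - L2_inner g h) \<longlongrightarrow> 0) (finite_subsets_at_top UNIV)"
  proof (rule Lim_null_comparison)
    show "((\<lambda>I. L2_norm (\<lambda>x. (\<Sum>i\<in>I. u i x) - g x) * L2_norm h) \<longlongrightarrow> 0) (finite_subsets_at_top UNIV)"
      using u by (intro tendsto_mult_left_zero) (auto simp: has_L2_sum_def)
    show "\<forall>\<^sub>F I in finite_subsets_at_top UNIV. norm ((\<Sum>i\<in>I. L2_inner (u i) h) - L2_inner g h)
       \<le> L2_norm (\<lambda>x. (\<Sum>i\<in>I. u i x) - g x) * L2_norm h"
    proof (rule eventually_finite_subsets_at_top_weakI)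
      fix I :: "'a set" assume I: "finite I"
      have "(\<Sum>i\<in>I. L2_inner (u i) h) - L2_inner g h = L2_inner (\<lambda>x. (\<Sum>i\<in>I. u i x) - g x) h"
        using I m h by (subst L2_inner_diff_left) (auto intro: L2_sum_finite simp: L2_inner_sum_left)
      then show "norm ((\<Sum>i\<in>I. L2_inner (u i) h) - L2_inner g h)
         \<le> L2_norm (\<lambda>x. (\<Sum>i\<in>I. u i x) - g x) * L2_norm h"
        using I m h by (simp add: L2_Cauchy_Schwarz L2_diff L2_sum_finite)
    qed
  qed
  then show ?thesis unfolding has_sum_def by (rule Lim_null[THEN iffD2])
qed

lemma L2_onb_Parseval:
  assumes e: "L2_onb e" and f: "f \<in> L2" and g: "g \<in> L2"
  shows "((\<lambda>n. L2_inner f (e n) * L2_inner (e n) g) has_sum L2_inner f g) UNIV"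
  using has_L2_sum_inner[of "\<lambda>n x. L2_inner f (e n) * e n x" f g] e f g
  by (simp add: L2_onb_def L2_inner_scale_left)

lemma L2_onb_Parseval_norm:
  assumes e: "L2_onb e" and f: "f \<in> L2"
  shows "((\<lambda>n. (norm (L2_inner f (e n)))\<^sup>2) has_sum (L2_norm f)\<^sup>2) UNIV"
proof -
  have "((\<lambda>n. complex_of_real ((norm (L2_inner f (e n)))\<^sup>2)) has_sum complex_of_real ((L2_norm f)\<^sup>2)) UNIV"
    using L2_onb_Parseval[OF e f f] unfolding L2_inner_self L2_inner_cnj[of "e _" f]
    by (simp only: complex_norm_square[symmetric])
  then show ?thesis by (subst (asm) has_sum_of_real_iff)
qed

section \<open>Traces of operators built from a square-summable family\<close>

text \<open>An increasing sequence of finite sets of indices that exhausts a countable index type.  It turns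
  unconditional sums into limits of sequences, to which dominated convergence applies.\<close>

definition initial_indices :: "nat \<Rightarrow> 'i::countable set" where
  "initial_indices n = {i. to_nat i < n}"

lemma finite_initial_indices: "finite (initial_indices n)"
  unfolding initial_indices_def
  by (rule finite_imageD[where f=to_nat]) (auto intro: finite_subset[of _ "{..<n}"] inj_on_subset[OF inj_to_nat])

lemma has_sum_initial_indices:
  assumes "(f has_sum s) (UNIV :: 'i::countable set)"
  shows "(\<lambda>n. sum f (initial_indices n)) \<longlonglongrightarrow> s"
proof -
  have "filterlim (initial_indices :: nat \<Rightarrow> 'i set) (finite_subsets_at_top UNIV) sequentially"
    unfolding filterlim_finite_subsets_at_top
  proof (intro allI impI)
    fix X :: "'i set" assume X: "finite X \<and> X \<subseteq> UNIV"
    show "\<forall>\<^sub>F n in sequentially. finite (initial_indices n :: 'i set) \<and> X \<subseteq> initial_indices n \<and> initial_indices n \<subseteq> UNIV"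
      using eventually_gt_at_top[of "Max (to_nat ` X)"]
    proof eventually_elim
      case (elim n)
      have "to_nat i < n" if "i \<in> X" for i
      proof (rule le_less_trans[OF Max_ge elim])
      qed (use X that in auto)
      then show ?case by (auto simp: finite_initial_indices) (auto simp: initial_indices_def)
    qed
  qed
  with assms show ?thesis unfolding has_sum_def by (rule filterlim_compose)
qed

lemma weighted_sum_Cauchy_Schwarz:
  fixes a :: "'i \<Rightarrow> complex" and p :: "'i \<Rightarrow> real"
  assumes a: "\<And>F. finite F \<Longrightarrow> F \<subseteq> A \<Longrightarrow> (\<Sum>i\<in>F. (norm (a i))\<^sup>2) \<le> \<alpha>"
    and p: "\<And>F. finite F \<Longrightarrow> F \<subseteq> A \<Longrightarrow> (\<Sum>i\<in>F. (p i)\<^sup>2) \<le> \<beta>"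
  shows "(\<lambda>i. norm (a i * of_real (p i))) summable_on A"
    and "(norm (\<Sum>\<^sub>\<infinity>i\<in>A. a i * of_real (p i)))\<^sup>2 \<le> \<alpha> * \<beta>"
proof -
  have nn: "\<alpha> \<ge> 0" "\<beta> \<ge> 0" using a[of "{}"] p[of "{}"] by auto
  have F: "(\<Sum>i\<in>F. norm (a i * of_real (p i))) \<le> sqrt (\<alpha> * \<beta>)" if "finite F" "F \<subseteq> A" for F
  proof (rule real_le_rsqrt)
    have "(\<Sum>i\<in>F. norm (a i * of_real (p i)))\<^sup>2 = (\<Sum>i\<in>F. norm (a i) * \<bar>p i\<bar>)\<^sup>2" by (simp add: norm_mult)
    also have "\<dots> \<le> (\<Sum>i\<in>F. (norm (a i))\<^sup>2) * (\<Sum>i\<in>F. \<bar>p i\<bar>\<^sup>2)" by (rule Cauchy_Schwarz_ineq_sum)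
    also have "\<dots> \<le> \<alpha> * \<beta>"
      using a[OF that] p[OF that] nn by (intro mult_mono) (auto intro: sum_nonneg)
    finally show "(\<Sum>i\<in>F. norm (a i * of_real (p i)))\<^sup>2 \<le> \<alpha> * \<beta>" .
  qed
  show s: "(\<lambda>i. norm (a i * of_real (p i))) summable_on A"
    by (rule nonneg_bdd_above_summable_on) (use F in \<open>auto simp: bdd_above_def\<close>)
  have "norm (\<Sum>\<^sub>\<infinity>i\<in>A. a i * of_real (p i)) \<le> (\<Sum>\<^sub>\<infinity>i\<in>A. norm (a i * of_real (p i)))"
    by (rule norm_infsum_bound[OF s])
  also have "\<dots> \<le> sqrt (\<alpha> * \<beta>)" by (rule infsum_le_finite_sums[OF s F])
  finally have "(norm (\<Sum>\<^sub>\<infinity>i\<in>A. a i * of_real (p i)))\<^sup>2 \<le> (sqrt (\<alpha> * \<beta>))\<^sup>2" by (intro power_mono) auto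
  then show "(norm (\<Sum>\<^sub>\<infinity>i\<in>A. a i * of_real (p i)))\<^sup>2 \<le> \<alpha> * \<beta>" using nn by simp
qed

text \<open>The sum \<open>k\<close> of the squares is the diagonal of the integral kernel of the positive operator
  \<open>f \<mapsto> \<Sum>\<^sub>i (f, \<phi>\<^sub>i) \<phi>\<^sub>i\<close>, and its integral is the trace of this operator.\<close>

locale square_summable_family =
  fixes \<phi> :: "'i::countable \<Rightarrow> 'a::euclidean_space \<Rightarrow> real" and k :: "'a \<Rightarrow> real"
  assumes phi_meas [measurable]: "\<And>i. \<phi> i \<in> borel_measurable lebesgue"
    and diag: "\<And>x. ((\<lambda>i. (\<phi> i x)\<^sup>2) has_sum k x) UNIV"
    and k_int: "integrable lebesgue k"
begin

abbreviation \<Phi> :: "'i \<Rightarrow> 'a \<Rightarrow> complex" where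
  "\<Phi> i \<equiv> \<lambda>x. of_real (\<phi> i x)"

definition weight :: "'i \<Rightarrow> real" where
  "weight i = (\<integral>x. (\<phi> i x)\<^sup>2 \<partial>lebesgue)"

definition total :: real where "total = (\<integral>x. k x \<partial>lebesgue)"

definition sum_operator :: "('a \<Rightarrow> complex) \<Rightarrow> 'a \<Rightarrow> complex" where
  "sum_operator f x = (\<Sum>\<^sub>\<infinity>i. L2_inner f (\<Phi> i) * \<Phi> i x)"

lemma sum_le_k: "finite I \<Longrightarrow> (\<Sum>i\<in>I. (\<phi> i x)\<^sup>2) \<le> k x"
  by (rule finite_sum_le_has_sum[OF diag]) auto

lemma k_nonneg: "k x \<ge> 0"
  using sum_le_k[of "{}"] by simp

lemma phi_sq_le: "(\<phi> i x)\<^sup>2 \<le> k x"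
  using sum_le_k[of "{i}"] by simp

lemma phi_sq_int: "integrable lebesgue (\<lambda>x. (\<phi> i x)\<^sup>2)"
  by (rule Bochner_Integration.integrable_bound[OF k_int]) (auto simp: phi_sq_le k_nonneg)

lemma Phi_L2: "\<Phi> i \<in> L2"
  by (rule L2I_bound[OF _ phi_sq_int]) auto

lemma Phi_norm: "(L2_norm (\<Phi> i))\<^sup>2 = weight i"
  by (simp add: L2_norm_sq weight_def)

lemma weight_nonneg: "weight i \<ge> 0"
  by (simp add: weight_def)

lemma sum_weight_le: "finite I \<Longrightarrow> sum weight I \<le> total"
  unfolding weight_def total_def
  by (subst Bochner_Integration.integral_sum[symmetric])
     (auto intro!: integral_mono phi_sq_int k_int sum_le_k)

lemma total_nonneg: "total \<ge> 0"
  using sum_weight_le[of "{}"] by simp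

lemma weight_summable: "weight summable_on UNIV"
  by (rule nonneg_bdd_above_summable_on)
     (use weight_nonneg sum_weight_le in \<open>auto simp: bdd_above_def\<close>)

text \<open>Dominated convergence with the integrable bound \<open>C k\<close>.\<close>

lemma has_sum_weighted_integral:
  assumes [measurable]: "b \<in> borel_measurable lebesgue" and C: "AE x in lebesgue. \<bar>b x\<bar> \<le> C"
  shows "((\<lambda>i. \<integral>x. b x * (\<phi> i x)\<^sup>2 \<partial>lebesgue) has_sum (\<integral>x. b x * k x \<partial>lebesgue)) UNIV"
proof -
  have int: "integrable lebesgue (\<lambda>x. b x * (\<phi> i x)\<^sup>2)" for i
  proof (rule Bochner_Integration.integrable_bound[where f="\<lambda>x. C * (\<phi> i x)\<^sup>2"])
    show "AE x in lebesgue. norm (b x * (\<phi> i x)\<^sup>2) \<le> norm (C * (\<phi> i x)\<^sup>2)"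
      using C by eventually_elim (auto simp: abs_mult intro!: mult_right_mono)
  qed (auto intro: phi_sq_int)
  have "norm (\<integral>x. b x * (\<phi> i x)\<^sup>2 \<partial>lebesgue) \<le> C * weight i" for i
  proof -
    have "norm (\<integral>x. b x * (\<phi> i x)\<^sup>2 \<partial>lebesgue) \<le> (\<integral>x. norm (b x * (\<phi> i x)\<^sup>2) \<partial>lebesgue)"
      by (rule integral_norm_bound)
    also have "\<dots> \<le> (\<integral>x. C * (\<phi> i x)\<^sup>2 \<partial>lebesgue)"
    proof (rule integral_mono_AE)
      show "AE x in lebesgue. norm (b x * (\<phi> i x)\<^sup>2) \<le> C * (\<phi> i x)\<^sup>2"
        using C by eventually_elim (auto simp: abs_mult intro!: mult_right_mono)
    qed (use int phi_sq_int in auto)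
    finally show ?thesis by (simp add: weight_def)
  qed
  then have "(\<lambda>i. norm (\<integral>x. b x * (\<phi> i x)\<^sup>2 \<partial>lebesgue)) summable_on UNIV"
    by (intro Infinite_Sum.abs_summable_on_comparison_test'[OF summable_on_cmult_right[OF weight_summable, of C]])
  then have "(\<lambda>i. \<integral>x. b x * (\<phi> i x)\<^sup>2 \<partial>lebesgue) summable_on UNIV"
    by (rule abs_summable_summable)
  then obtain s where s: "((\<lambda>i. \<integral>x. b x * (\<phi> i x)\<^sup>2 \<partial>lebesgue) has_sum s) UNIV"
    by (auto simp: summable_on_def)
  have lim1: "(\<lambda>n. \<Sum>i\<in>initial_indices n. \<integral>x. b x * (\<phi> i x)\<^sup>2 \<partial>lebesgue) \<longlonglongrightarrow> s"
    by (rule has_sum_initial_indices[OF s])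
  have "(\<lambda>n. \<integral>x. b x * (\<Sum>i\<in>initial_indices n. (\<phi> i x)\<^sup>2) \<partial>lebesgue) \<longlonglongrightarrow> (\<integral>x. b x * k x \<partial>lebesgue)"
  proof (rule integral_dominated_convergence)
    show "integrable lebesgue (\<lambda>x. C * k x)" using k_int by simp
    show "AE x in lebesgue. (\<lambda>n. b x * (\<Sum>i\<in>initial_indices n. (\<phi> i x)\<^sup>2)) \<longlonglongrightarrow> b x * k x"
      by (intro AE_I2 tendsto_mult tendsto_const has_sum_initial_indices[OF diag])
    show "AE x in lebesgue. norm (b x * (\<Sum>i\<in>initial_indices n. (\<phi> i x)\<^sup>2)) \<le> C * k x" for n
      using C
    proof eventually_elim
      case (elim x)
      have "\<bar>b x\<bar> * \<bar>\<Sum>i\<in>initial_indices n. (\<phi> i x)\<^sup>2\<bar> \<le> C * k x"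
        using elim sum_le_k[OF finite_initial_indices[of n], of x]
        by (intro mult_mono) (auto simp: sum_nonneg)
      then show ?case by (simp add: abs_mult)
    qed
    show "(\<lambda>x. b x * k x) \<in> borel_measurable lebesgue" using borel_measurable_integrable[OF k_int] by simp
  qed measurable
  moreover have "(\<integral>x. b x * (\<Sum>i\<in>initial_indices n. (\<phi> i x)\<^sup>2) \<partial>lebesgue)
      = (\<Sum>i\<in>initial_indices n. \<integral>x. b x * (\<phi> i x)\<^sup>2 \<partial>lebesgue)" for n
    unfolding sum_distrib_left by (rule Bochner_Integration.integral_sum) (rule int)
  ultimately have "(\<lambda>n. \<Sum>i\<in>initial_indices n. \<integral>x. b x * (\<phi> i x)\<^sup>2 \<partial>lebesgue)
      \<longlonglongrightarrow> (\<integral>x. b x * k x \<partial>lebesgue)" by (simp only:)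
  then have "(\<integral>x. b x * k x \<partial>lebesgue) = s" using lim1 by (rule LIMSEQ_unique)
  with s show ?thesis by simp
qed

lemma has_sum_weight: "(weight has_sum total) UNIV"
  using has_sum_weighted_integral[of "\<lambda>_. 1" 1] by (simp add: weight_def[abs_def] total_def)

lemma coeff_sq_le: "f \<in> L2 \<Longrightarrow> (norm (L2_inner f (\<Phi> i)))\<^sup>2 \<le> (L2_norm f)\<^sup>2 * weight i"
  unfolding Phi_norm[symmetric] power_mult_distrib[symmetric]
  by (intro power_mono L2_Cauchy_Schwarz Phi_L2) auto

lemma sum_coeff_sq_le:
  assumes f: "f \<in> L2" and I: "finite I"
  shows "(\<Sum>i\<in>I. (norm (L2_inner f (\<Phi> i)))\<^sup>2) \<le> (L2_norm f)\<^sup>2 * sum weight I"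
  unfolding sum_distrib_left by (intro sum_mono coeff_sq_le f)

lemma sum_operator_abs_summable:
  assumes f: "f \<in> L2"
  shows "(\<lambda>i. norm (L2_inner f (\<Phi> i) * \<Phi> i x)) summable_on UNIV"
proof (rule weighted_sum_Cauchy_Schwarz(1))
  fix F :: "'i set" assume F: "finite F"
  show "(\<Sum>i\<in>F. (norm (L2_inner f (\<Phi> i)))\<^sup>2) \<le> (L2_norm f)\<^sup>2 * total"
    using sum_coeff_sq_le[OF f F] mult_left_mono[OF sum_weight_le[OF F], of "(L2_norm f)\<^sup>2"] by simp
  show "(\<Sum>i\<in>F. (\<phi> i x)\<^sup>2) \<le> k x" by (rule sum_le_k[OF F])
qed

text \<open>By the Cauchy-Schwarz inequality for sums, the remainder after finitely many terms is bounded
  pointwise by the tail of the total weight times \<open>k x\<close>.  Integrating this bound gives convergence in the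
  mean, and with no terms summed it gives boundedness of the operator.\<close>

lemma sum_operator_tail:
  assumes f: "f \<in> L2" and I: "finite I"
  shows "(norm ((\<Sum>i\<in>I. L2_inner f (\<Phi> i) * \<Phi> i x) - sum_operator f x))\<^sup>2 \<le> (L2_norm f)\<^sup>2 * (total - sum weight I) * k x"
proof -
  let ?t = "\<lambda>i. L2_inner f (\<Phi> i) * \<Phi> i x"
  have s: "?t summable_on A" for A
    using abs_summable_summable[OF sum_operator_abs_summable[OF f]] summable_on_subset_banach by blast
  have "sum_operator f x = infsum ?t (I \<union> (UNIV - I))" by (simp add: sum_operator_def)
  also have "\<dots> = infsum ?t I + infsum ?t (UNIV - I)" by (intro infsum_Un_disjoint s) auto
  finally have e: "(\<Sum>i\<in>I. ?t i) - sum_operator f x = - infsum ?t (UNIV - I)" using I by simp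
  show ?thesis unfolding e norm_minus_cancel
  proof (rule weighted_sum_Cauchy_Schwarz(2))
    fix F assume F: "finite F" "F \<subseteq> UNIV - I"
    have "sum weight F + sum weight I = sum weight (F \<union> I)"
      using F I by (subst sum.union_disjoint) auto
    also have "\<dots> \<le> total" by (rule sum_weight_le) (use F I in auto)
    finally have "(L2_norm f)\<^sup>2 * sum weight F \<le> (L2_norm f)\<^sup>2 * (total - sum weight I)"
      by (intro mult_left_mono) auto
    with sum_coeff_sq_le[OF f F(1)]
    show "(\<Sum>i\<in>F. (norm (L2_inner f (\<Phi> i)))\<^sup>2) \<le> (L2_norm f)\<^sup>2 * (total - sum weight I)" by simp
    show "(\<Sum>i\<in>F. (\<phi> i x)\<^sup>2) \<le> k x" by (rule sum_le_k[OF F(1)])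
  qed
qed

lemma sum_operator_measurable [measurable]:
  assumes f: "f \<in> L2"
  shows "sum_operator f \<in> borel_measurable lebesgue"
proof (rule borel_measurable_LIMSEQ_metric)
  fix x
  have "((\<lambda>i. L2_inner f (\<Phi> i) * \<Phi> i x) has_sum sum_operator f x) UNIV"
    unfolding sum_operator_def by (rule has_sum_infsum[OF abs_summable_summable[OF sum_operator_abs_summable[OF f]]])
  then show "(\<lambda>n. \<Sum>i\<in>initial_indices n. L2_inner f (\<Phi> i) * \<Phi> i x) \<longlonglongrightarrow> sum_operator f x"
    by (rule has_sum_initial_indices)
qed measurable

lemma sum_operator_L2: "f \<in> L2 \<Longrightarrow> sum_operator f \<in> L2"
  by (rule L2I_bound[where g="\<lambda>x. (L2_norm f)\<^sup>2 * total * k x"])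
     (use sum_operator_tail[of f "{}"] k_int in auto)

lemma sum_operator_bounded: 
  assumes f: "f \<in> L2" shows "L2_norm (sum_operator f) \<le> total * L2_norm f"
proof (rule power2_le_imp_le)
  have "(L2_norm (sum_operator f))\<^sup>2 \<le> (\<integral>x. (L2_norm f)\<^sup>2 * total * k x \<partial>lebesgue)"
    unfolding L2_norm_sq[of "sum_operator f"]
    by (rule integral_mono) (use sum_operator_tail[OF f, of "{}"] k_int sum_operator_L2[OF f] in \<open>auto intro: L2_integrable\<close>)
  also have "\<dots> = (total * L2_norm f)\<^sup>2" by (simp add: total_def power2_eq_square)
  finally show "(L2_norm (sum_operator f))\<^sup>2 \<le> (total * L2_norm f)\<^sup>2" .
qed (simp add: total_nonneg L2_norm_nonneg)

lemma has_L2_sum_operator: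
  assumes f: "f \<in> L2"
  shows "has_L2_sum (\<lambda>i x. L2_inner f (\<Phi> i) * \<Phi> i x) (sum_operator f)"
  unfolding has_L2_sum_def
proof (intro conjI allI sum_operator_L2 f L2_scale Phi_L2)
  let ?d = "\<lambda>I. L2_norm (\<lambda>x. (\<Sum>i\<in>I. L2_inner f (\<Phi> i) * \<Phi> i x) - sum_operator f x)"
  have le: "(?d I)\<^sup>2 \<le> (L2_norm f)\<^sup>2 * (total - sum weight I) * total" if I: "finite I" for I
  proof -
    have "(?d I)\<^sup>2 \<le> (\<integral>x. (L2_norm f)\<^sup>2 * (total - sum weight I) * k x \<partial>lebesgue)"
      unfolding L2_norm_sq[of "\<lambda>x. _ x - sum_operator f x"]
      by (rule integral_mono)
         (use sum_operator_tail[OF f I] k_int in \<open>auto intro!: L2_integrable L2_diff sum_operator_L2 f L2_sum_finite I L2_scale Phi_L2\<close>)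
    then show ?thesis by (simp add: total_def)
  qed
  have "((\<lambda>I. (L2_norm f)\<^sup>2 * (total - sum weight I) * total) \<longlongrightarrow> (L2_norm f)\<^sup>2 * (total - total) * total)
      (finite_subsets_at_top UNIV)"
    by (intro tendsto_intros has_sum_weight[unfolded has_sum_def])
  then have "((\<lambda>I. (L2_norm f)\<^sup>2 * (total - sum weight I) * total) \<longlongrightarrow> 0) (finite_subsets_at_top UNIV)" by simp
  then have "((\<lambda>I. (?d I)\<^sup>2) \<longlongrightarrow> 0) (finite_subsets_at_top UNIV)"
    by (rule Lim_null_comparison[rotated]) (auto intro!: eventually_finite_subsets_at_top_weakI le)
  then have "((\<lambda>I. sqrt ((?d I)\<^sup>2)) \<longlongrightarrow> sqrt 0) (finite_subsets_at_top UNIV)"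
    by (intro tendsto_intros)
  then show "(?d \<longlongrightarrow> 0) (finite_subsets_at_top UNIV)" by (simp add: L2_norm_nonneg)
qed

lemma sum_operator_has_sum:
  "f \<in> L2 \<Longrightarrow> ((\<lambda>i. L2_inner f (\<Phi> i) * \<Phi> i x) has_sum sum_operator f x) UNIV"
  unfolding sum_operator_def by (rule has_sum_infsum[OF abs_summable_summable[OF sum_operator_abs_summable]])

lemma sum_operator_add:
  assumes "f \<in> L2" "g \<in> L2"
  shows "sum_operator (\<lambda>x. f x + g x) x = sum_operator f x + sum_operator g x"
proof -
  have "((\<lambda>i. L2_inner f (\<Phi> i) * \<Phi> i x + L2_inner g (\<Phi> i) * \<Phi> i x) has_sum (sum_operator f x + sum_operator g x)) UNIV"
    by (intro has_sum_add sum_operator_has_sum assms)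
  from infsumI[OF this] show ?thesis
    unfolding sum_operator_def[of "\<lambda>x. f x + g x"] L2_inner_add_left[OF assms Phi_L2] distrib_right .
qed

lemma sum_operator_scale: "sum_operator (\<lambda>x. c * f x) x = c * sum_operator f x"
  unfolding sum_operator_def L2_inner_scale_left mult.assoc by (rule infsum_cmult_right')

text \<open>The arbitrary representative chosen by \<^const>\<open>L2_sum\<close> agrees with the pointwise sum.\<close>

lemma L2_sum_eq_operator:
  assumes f: "f \<in> L2"
  defines "R \<equiv> L2_sum (\<lambda>i x. L2_inner f (\<Phi> i) * \<Phi> i x)"
  shows "has_L2_sum (\<lambda>i x. L2_inner f (\<Phi> i) * \<Phi> i x) R" and "AE x in lebesgue. R x = sum_operator f x"
proof -
  show 1: "has_L2_sum (\<lambda>i x. L2_inner f (\<Phi> i) * \<Phi> i x) R"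
    unfolding R_def L2_sum_def
    by (rule someI[where P="has_L2_sum (\<lambda>i x. L2_inner f (\<Phi> i) * \<Phi> i x)", OF has_L2_sum_operator[OF f]])
  show "AE x in lebesgue. R x = sum_operator f x"
    using has_L2_sum_unique_AE[OF 1 has_L2_sum_operator[OF f]] .
qed

lemma mult_operator_L2:
  assumes b [measurable]: "b \<in> borel_measurable lebesgue" and C: "AE x in lebesgue. \<bar>b x\<bar> \<le> C"
    and f [measurable]: "f \<in> L2"
  shows "mult_operator b f \<in> L2" and "(L2_norm (mult_operator b f))\<^sup>2 \<le> C\<^sup>2 * (L2_norm f)\<^sup>2"
proof -
  have le: "AE x in lebesgue. (norm (mult_operator b f x))\<^sup>2 \<le> C\<^sup>2 * (norm (f x))\<^sup>2"
    using C
  proof eventually_elim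
    case (elim x)
    have "\<bar>b x\<bar>\<^sup>2 \<le> C\<^sup>2" using elim by (intro power_mono) auto
    then show ?case by (simp add: mult_operator_def norm_mult power_mult_distrib mult_right_mono)
  qed
  have [measurable]: "mult_operator b f \<in> borel_measurable lebesgue" unfolding mult_operator_def by measurable
  show L: "mult_operator b f \<in> L2"
    by (rule L2I_bound[OF _ _ le]) (use L2_integrable[OF f] in auto)
  have "(L2_norm (mult_operator b f))\<^sup>2 \<le> (\<integral>x. C\<^sup>2 * (norm (f x))\<^sup>2 \<partial>lebesgue)"
    unfolding L2_norm_sq[of "mult_operator b f"]
    by (rule integral_mono_AE[OF _ _ le]) (use L2_integrable[OF f] L2_integrable[OF L] in auto)
  then show "(L2_norm (mult_operator b f))\<^sup>2 \<le> C\<^sup>2 * (L2_norm f)\<^sup>2" by (simp add: L2_norm_sq)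
qed

lemma inner_mult_operator: "L2_inner (mult_operator b f) g = L2_inner f (mult_operator b g)"
proof -
  have "(\<lambda>x. mult_operator b f x * cnj (g x)) = (\<lambda>x. f x * cnj (mult_operator b g x))"
    by (simp add: fun_eq_iff mult_operator_def)
  then show ?thesis by (simp only: L2_inner_def)
qed

text \<open>In an orthonormal basis \<open>e\<close> the trace is the double sum over \<open>n\<close> and \<open>i\<close> of
  \<open>(\<phi>\<^sub>i, e\<^sub>n) (e\<^sub>n, b \<phi>\<^sub>i)\<close>.  Parseval's identity bounds the sum over \<open>n\<close> of the absolute values by a
  multiple of the weight of \<open>\<phi>\<^sub>i\<close>, so the double sum converges absolutely and can be taken over \<open>n\<close>
  first.  The sum over \<open>n\<close> is \<open>(\<phi>\<^sub>i, b \<phi>\<^sub>i)\<close>, and adding these up gives the integral of \<open>b k\<close>.\<close>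

theorem has_trace_sum_operator:
  fixes b :: "'a \<Rightarrow> real" and c :: complex
  assumes b: "b \<in> real_Linf"
  defines "A \<equiv> \<lambda>f x. c * L2_sum (\<lambda>i y. L2_inner (mult_operator b f) (\<Phi> i) * \<Phi> i y) x"
  shows "has_trace A (c * of_real (\<integral>x. b x * k x \<partial>lebesgue))"
proof -
  obtain C where bm [measurable]: "b \<in> borel_measurable lebesgue" and C: "AE x in lebesgue. \<bar>b x\<bar> \<le> C"
    using b by (auto simp: real_Linf_def)
  define R where "R f = L2_sum (\<lambda>i y. L2_inner (mult_operator b f) (\<Phi> i) * \<Phi> i y)" for f
  have A: "A f = (\<lambda>x. c * R f x)" for f by (simp add: A_def R_def)
  have mL: "mult_operator b f \<in> L2" if "f \<in> L2" for f by (rule mult_operator_L2(1)[OF bm C that])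
  have R_sum: "has_L2_sum (\<lambda>i x. L2_inner (mult_operator b f) (\<Phi> i) * \<Phi> i x) (R f)"
    and R_AE: "AE x in lebesgue. R f x = sum_operator (mult_operator b f) x" if "f \<in> L2" for f
    unfolding R_def by (rule L2_sum_eq_operator[OF mL[OF that]])+
  have RL: "R f \<in> L2" if "f \<in> L2" for f using R_sum[OF that] by (simp add: has_L2_sum_def)
  have bop: "L2_bounded_operator A"
    unfolding L2_bounded_operator_def
  proof (intro conjI ballI allI)
    fix f :: "'a \<Rightarrow> complex" assume f: "f \<in> L2"
    show "A f \<in> L2" unfolding A by (intro L2_scale RL f)
    show "AE x in lebesgue. A (\<lambda>x. d * f x) x = d * A f x" for d
      using R_AE[OF f] R_AE[OF L2_scale[OF f, of d]]
    proof eventually_elim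
      case (elim x)
      have "mult_operator b (\<lambda>x. d * f x) = (\<lambda>x. d * mult_operator b f x)"
        by (simp add: mult_operator_def fun_eq_iff)
      then show ?case unfolding A elim by (simp add: sum_operator_scale)
    qed
    fix g :: "'a \<Rightarrow> complex" assume g: "g \<in> L2"
    show "AE x in lebesgue. A (\<lambda>x. f x + g x) x = A f x + A g x"
      using R_AE[OF f] R_AE[OF g] R_AE[OF L2_add[OF f g]]
    proof eventually_elim
      case (elim x)
      have "mult_operator b (\<lambda>x. f x + g x) = (\<lambda>x. mult_operator b f x + mult_operator b g x)"
        by (simp add: mult_operator_def fun_eq_iff algebra_simps)
      then show ?case unfolding A elim by (simp add: sum_operator_add mL f g algebra_simps)
    qed
  next
    show "\<exists>K. \<forall>f\<in>L2. L2_norm (A f) \<le> K * L2_norm f"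
    proof (intro exI ballI)
      fix f :: "'a \<Rightarrow> complex" assume f: "f \<in> L2"
      have "L2_norm (R f) = L2_norm (sum_operator (mult_operator b f))"
      proof -
        note [measurable] = RL[OF f] sum_operator_L2[OF mL[OF f]]
        have "(\<integral>x. (norm (R f x))\<^sup>2 \<partial>lebesgue) = (\<integral>x. (norm (sum_operator (mult_operator b f) x))\<^sup>2 \<partial>lebesgue)"
        proof (rule integral_cong_AE)
          show "AE x in lebesgue. (norm (R f x))\<^sup>2 = (norm (sum_operator (mult_operator b f) x))\<^sup>2"
            using R_AE[OF f] by eventually_elim simp
        qed measurable
        then show ?thesis by (simp add: L2_norm_def)
      qed
      also have "\<dots> \<le> total * L2_norm (mult_operator b f)" by (rule sum_operator_bounded[OF mL[OF f]])
      also have "\<dots> \<le> total * (\<bar>C\<bar> * L2_norm f)"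
      proof (rule mult_left_mono[OF power2_le_imp_le total_nonneg])
        show "(L2_norm (mult_operator b f))\<^sup>2 \<le> (\<bar>C\<bar> * L2_norm f)\<^sup>2"
          using mult_operator_L2(2)[OF bm C f] by (simp add: power_mult_distrib)
      qed (simp add: L2_norm_nonneg)
      finally have "norm c * L2_norm (R f) \<le> norm c * (total * (\<bar>C\<bar> * L2_norm f))"
        by (intro mult_left_mono) auto
      then show "L2_norm (A f) \<le> (norm c * total * \<bar>C\<bar>) * L2_norm f"
        by (simp add: A L2_norm_scale mult.assoc)
    qed
  qed
  have tr: "((\<lambda>n. L2_inner (A (e n)) (e n)) has_sum (c * of_real (\<integral>x. b x * k x \<partial>lebesgue))) UNIV"
    if e: "L2_onb e" for e
  proof -
    have eL: "e n \<in> L2" for n using e by (simp add: L2_onb_def)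
    define F where "F = (\<lambda>(i, n). L2_inner (\<Phi> i) (e n) * L2_inner (e n) (mult_operator b (\<Phi> i)))"
    have row: "((\<lambda>n. F (i, n)) has_sum of_real (\<integral>x. b x * (\<phi> i x)\<^sup>2 \<partial>lebesgue)) UNIV" for i
    proof -
      have "L2_inner (\<Phi> i) (mult_operator b (\<Phi> i)) = of_real (\<integral>x. b x * (\<phi> i x)\<^sup>2 \<partial>lebesgue)"
      proof -
        have "(\<lambda>x. \<Phi> i x * cnj (mult_operator b (\<Phi> i) x)) = (\<lambda>x. complex_of_real (b x * (\<phi> i x)\<^sup>2))"
          by (simp add: fun_eq_iff mult_operator_def power2_eq_square)
        then show ?thesis by (simp only: L2_inner_def integral_complex_of_real)
      qed
      then show ?thesis
        using L2_onb_Parseval[OF e Phi_L2[of i] mL[OF Phi_L2[of i]]] by (simp add: F_def)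
    qed
    have col: "((\<lambda>i. F (i, n)) has_sum L2_inner (R (e n)) (e n)) UNIV" for n
    proof -
      have "L2_inner (\<lambda>x. L2_inner (mult_operator b (e n)) (\<Phi> i) * \<Phi> i x) (e n) = F (i, n)" for i
        unfolding L2_inner_scale_left inner_mult_operator by (simp add: F_def)
      then show ?thesis using has_L2_sum_inner[OF R_sum[OF eL[of n]] eL[of n]] by simp
    qed
    have s: "(\<lambda>n. norm (F (i, n))) summable_on UNIV"
      and bound: "infsum (\<lambda>n. norm (F (i, n))) UNIV \<le> (1 + C\<^sup>2) * weight i" for i
    proof -
      let ?q = "\<lambda>n. (norm (L2_inner (\<Phi> i) (e n)))\<^sup>2 + (norm (L2_inner (mult_operator b (\<Phi> i)) (e n)))\<^sup>2"
      have q: "(?q has_sum ((L2_norm (\<Phi> i))\<^sup>2 + (L2_norm (mult_operator b (\<Phi> i)))\<^sup>2)) UNIV"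
        by (intro has_sum_add L2_onb_Parseval_norm e mL Phi_L2)
      have le: "norm (F (i, n)) \<le> ?q n" for n
      proof -
        have "norm (F (i, n)) = norm (L2_inner (\<Phi> i) (e n)) * norm (L2_inner (mult_operator b (\<Phi> i)) (e n))"
          unfolding F_def using L2_inner_cnj[where g="e n" and f="mult_operator b (\<Phi> i)"] by (simp add: norm_mult)
        moreover have "x * y \<le> x\<^sup>2 + y\<^sup>2" for x y :: real
          using sum_squares_bound[of x y] zero_le_power2[of x] zero_le_power2[of y] by linarith
        ultimately show ?thesis by simp
      qed
      show s: "(\<lambda>n. norm (F (i, n))) summable_on UNIV"
        by (rule Infinite_Sum.abs_summable_on_comparison_test'[OF _ le]) (use q in \<open>auto simp: summable_on_def\<close>)
      have "infsum (\<lambda>n. norm (F (i, n))) UNIV \<le> infsum ?q UNIV"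
        by (intro infsum_mono s le) (use q in \<open>auto simp: summable_on_def\<close>)
      also have "\<dots> = (L2_norm (\<Phi> i))\<^sup>2 + (L2_norm (mult_operator b (\<Phi> i)))\<^sup>2" by (rule infsumI[OF q])
      also have "\<dots> \<le> (1 + C\<^sup>2) * weight i"
        using mult_operator_L2(2)[OF bm C Phi_L2[of i]] by (simp add: Phi_norm algebra_simps)
      finally show "infsum (\<lambda>n. norm (F (i, n))) UNIV \<le> (1 + C\<^sup>2) * weight i" .
    qed
    have "(\<lambda>i. norm (infsum (\<lambda>n. norm (F (i, n))) UNIV)) summable_on UNIV"
      by (rule Infinite_Sum.abs_summable_on_comparison_test'[OF summable_on_cmult_right[OF weight_summable, of "1 + C\<^sup>2"]])
         (use bound in \<open>simp add: infsum_nonneg\<close>)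
    then have "(\<lambda>z. norm (F z)) summable_on (UNIV \<times> UNIV)"
      unfolding Infinite_Sum.abs_summable_on_Sigma_iff using s by simp
    then have F_sum: "F summable_on (UNIV \<times> UNIV)" by (rule abs_summable_summable)
    have "((\<lambda>i. complex_of_real (\<integral>x. b x * (\<phi> i x)\<^sup>2 \<partial>lebesgue)) has_sum of_real (\<integral>x. b x * k x \<partial>lebesgue)) UNIV"
      by (subst has_sum_of_real_iff) (rule has_sum_weighted_integral[OF bm C])
    with row have "(F has_sum of_real (\<integral>x. b x * k x \<partial>lebesgue)) (UNIV \<times> UNIV)"
      by (intro has_sum_SigmaI[OF _ _ F_sum])
    then have "((\<lambda>(n, i). F (i, n)) has_sum of_real (\<integral>x. b x * k x \<partial>lebesgue)) (UNIV \<times> UNIV)"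
      by (subst (asm) has_sum_swap)
    then have "((\<lambda>n. L2_inner (R (e n)) (e n)) has_sum of_real (\<integral>x. b x * k x \<partial>lebesgue)) UNIV"
      by (rule has_sum_SigmaD) (use col in auto)
    then show ?thesis unfolding A L2_inner_scale_left by (rule has_sum_cmult_right)
  qed
  show ?thesis unfolding has_trace_def using bop tr by blast
qed

end

section \<open>Bounded observables\<close>

context periodic_oscillator
begin

lemma marginal_pos: "marginal x > 0"
  using osc_variance_pos[OF T_pos lam_pos] by (simp add: marginal_def)

text \<open>A bounded observable is only Lebesgue measurable.  Its composition with the process is still
  measurable because the probability space is complete and the law of \<open>Z t\<close> has the same null sets as
  Lebesgue measure.\<close>

lemma distr_marginal_lebesgue:
  assumes t: "0 \<le> t" "t \<le> T"
  shows "Z t \<in> M \<rightarrow>\<^sub>M lebesgue" and "distr M lebesgue (Z t) = density lebesgue (\<lambda>x. ennreal (marginal x))"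
proof -
  interpret complete_measure M by (rule complete_M)
  have Zt: "Z t \<in> M \<rightarrow>\<^sub>M lborel" using Z_measurable[OF t] by simp
  have d: "distr M lborel (Z t) = density lborel (\<lambda>x. ennreal (marginal x))"
    using distr_marginal[OF t] distr_cong[of M M lborel borel "Z t" "Z t"] by simp
  have n: "null_sets (distr M lborel (Z t)) = null_sets lborel"
  proof -
    have "N \<in> null_sets (density lborel (\<lambda>x. ennreal (marginal x))) \<longleftrightarrow> N \<in> null_sets lborel" for N
    proof -
      have "ennreal (marginal x) = 0 \<longleftrightarrow> False" for x using marginal_pos[of x] by (simp add: ennreal_eq_0_iff)
      then have "N \<in> null_sets (density lborel (\<lambda>x. ennreal (marginal x))) \<longleftrightarrow> N \<in> sets lborel \<and> (AE x in lborel. x \<notin> N)"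
        by (subst null_sets_density_iff) auto
      then show ?thesis using Measure_Space.AE_iff_null_sets[of N lborel] null_setsD2[of N lborel] by blast
    qed
    then show ?thesis unfolding d by blast
  qed
  show Zl: "Z t \<in> M \<rightarrow>\<^sub>M lebesgue" by (rule measurable_completion2[OF Zt]) (simp add: n)
  have "distr M lebesgue (Z t) = completion (distr M lborel (Z t))" by (rule completion_distr_eq[OF Zt n, symmetric])
  also have "\<dots> = density lebesgue (\<lambda>x. ennreal (marginal x))"
    unfolding d by (rule completion_density_eq) (auto simp: marginal_pos)
  finally show "distr M lebesgue (Z t) = density lebesgue (\<lambda>x. ennreal (marginal x))" .
qed

lemma expectation_bounded_observable:
  assumes b: "b \<in> real_Linf" and t: "0 \<le> t" "t \<le> T"
  shows "integrable M (\<lambda>\<omega>. b (Z t \<omega>))" and "(\<integral>\<omega>. b (Z t \<omega>) \<partial>M) = (\<integral>x. b x * marginal x \<partial>lebesgue)"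
proof -
  obtain C where bm [measurable]: "b \<in> borel_measurable lebesgue" and C: "AE x in lebesgue. \<bar>b x\<bar> \<le> C"
    using b by (auto simp: real_Linf_def)
  note Zl [measurable] = distr_marginal_lebesgue(1)[OF t] and d = distr_marginal_lebesgue(2)[OF t]
  have [measurable]: "marginal \<in> borel_measurable lebesgue" by (rule measurable_completion) simp
  have "AE x in density lebesgue (\<lambda>x. ennreal (marginal x)). \<bar>b x\<bar> \<le> C"
    using C by (subst AE_density) auto
  then have "AE x in distr M lebesgue (Z t). \<bar>b x\<bar> \<le> C" unfolding d .
  then have "AE \<omega> in M. \<bar>b (Z t \<omega>)\<bar> \<le> C" by (rule AE_distrD[OF Zl])
  then show "integrable M (\<lambda>\<omega>. b (Z t \<omega>))"
    by (intro integrable_const_bound[of _ C]) auto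
  have "(\<integral>\<omega>. b (Z t \<omega>) \<partial>M) = (\<integral>x. b x \<partial>distr M lebesgue (Z t))"
    by (rule integral_distr[OF Zl bm, symmetric])
  also have "\<dots> = (\<integral>x. marginal x *\<^sub>R b x \<partial>lebesgue)"
    unfolding d by (rule integral_density) (auto simp: marginal_nonneg)
  finally show "(\<integral>\<omega>. b (Z t \<omega>) \<partial>M) = (\<integral>x. b x * marginal x \<partial>lebesgue)"
    by (simp add: mult.commute)
qed

text \<open>The density operator comes from the family of eigenfunctions weighted by the square roots of
  their Boltzmann factors; by the diagonal Mehler formula the squares of this family add up to the
  diagonal of the Mehler kernel.\<close>

theorem trace_density_operator:
  assumes b: "b \<in> real_Linf"
  shows "has_trace (density_operator lam T \<circ> mult_operator b) (complex_of_real (\<integral>x. b x * marginal x \<partial>lebesgue))"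
proof -
  define Zinv where "Zinv = inverse (partition_fun TYPE('d) lam T)"
  have Zp: "Zinv > 0" unfolding Zinv_def by (rule inv_part_pos)
  \<comment> \<open>The square root of the Boltzmann factor, since the weight enters twice in each term.\<close>
  define w where "w m = sqrt (exp (- T * osc_energy lam m))" for m :: "nat ^ 'd"
  define \<phi> where "\<phi> m x = w m * osc_eigenfun lam m x" for m :: "nat ^ 'd" and x :: "real ^ 'd"
  have w2: "w m * w m = exp (- T * osc_energy lam m)" for m by (simp add: w_def)
  have k: "Zinv * mehler lam x T x = marginal x" for x :: "real ^ 'd"
    unfolding Zinv_def marginal_def by (rule mehler_diagonal_normalized[OF T_pos lam_pos])
  interpret square_summable_family \<phi> "\<lambda>x. mehler lam x T x"
  proof
    show "\<phi> m \<in> borel_measurable lebesgue" for m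
      unfolding \<phi>_def using osc_eigenfun_measurable[of lam m]
      by (intro borel_measurable_times borel_measurable_const measurable_completion) simp
    show "((\<lambda>m. (\<phi> m x)\<^sup>2) has_sum mehler lam x T x) UNIV" for x
      using mehler_diagonal_expansion[OF T_pos lam_pos, of x] w2
      by (simp add: \<phi>_def power_mult_distrib) (simp add: power2_eq_square)
    have "integrable lborel (\<lambda>x :: real ^ 'd. (1 / Zinv) * marginal x)" using marginal_integrable by simp
    moreover have "(1 / Zinv) * marginal x = mehler lam x T x" for x :: "real ^ 'd"
      unfolding k[symmetric] using Zp by simp
    ultimately show "integrable lebesgue (\<lambda>x :: real ^ 'd. mehler lam x T x)"
      by (subst integrable_completion) auto
  qed
  have "has_trace (\<lambda>f x. of_real Zinv * L2_sum (\<lambda>i y. L2_inner (mult_operator b f) (\<lambda>x. of_real (\<phi> i x)) * of_real (\<phi> i y)) x)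
     (of_real Zinv * of_real (\<integral>x. b x * mehler lam x T x \<partial>lebesgue))"
    by (rule has_trace_sum_operator[OF b])
  moreover have "(\<lambda>f x. of_real Zinv * L2_sum (\<lambda>i y. L2_inner (mult_operator b f) (\<lambda>x. of_real (\<phi> i x)) * of_real (\<phi> i y)) x)
     = density_operator lam T \<circ> mult_operator b"
  proof -
    have "L2_inner g (\<lambda>x. of_real (\<phi> i x)) * of_real (\<phi> i y)
      = of_real (exp (- T * osc_energy lam i)) * L2_inner g (\<lambda>z. of_real (osc_eigenfun lam i z)) * of_real (osc_eigenfun lam i y)" for g i y
      unfolding \<phi>_def of_real_mult L2_inner_scale_real_right w2[symmetric] by (simp add: mult_ac)
    then show ?thesis by (simp add: fun_eq_iff density_operator_def Zinv_def)
  qed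
  moreover have "of_real Zinv * of_real (\<integral>x. b x * mehler lam x T x \<partial>lebesgue) = complex_of_real (\<integral>x. b x * marginal x \<partial>lebesgue)"
  proof -
    have "Zinv * (\<integral>x. b x * mehler lam x T x \<partial>lebesgue) = (\<integral>x. Zinv * (b x * mehler lam x T x) \<partial>lebesgue)" by simp
    also have "\<dots> = (\<integral>x. b x * marginal x \<partial>lebesgue)"
      unfolding k[symmetric] by (simp add: mult_ac)
    finally show ?thesis by (simp only: of_real_mult[symmetric])
  qed
  ultimately show ?thesis by simp
qed

end

section \<open>Stationarity, Gaussianity and the trace formula\<close>

theorem theorem6:
  fixes M :: "'w measure" and Z :: "real \<Rightarrow> 'w \<Rightarrow> real ^ 'd::finite" and T lam :: real
  assumes "0 < T" and "0 < lam"
    and "associated_bernstein_process lam T (mu_bar lam T) M Z"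
  shows "stationary_process M T Z \<and> \<not> markov_process M T Z \<and> gaussian_process M T Z \<and>
    (\<forall>t\<in>{0..T}. \<forall>F\<in>sets borel.
       measure M {\<omega> \<in> space M. Z t \<omega> \<in> F} =
         (2 * pi * osc_variance lam T) powr (- real CARD('d) / 2)
         * (LINT x:F|lborel. exp (- (norm x)\<^sup>2 / (2 * osc_variance lam T)))) \<and>
    (\<forall>s\<in>{0..T}. \<forall>t\<in>{0..T}. \<forall>i j.
       integrable M (\<lambda>\<omega>. Z s \<omega> $ i * Z t \<omega> $ j) \<and>
       (\<integral>\<omega>. Z s \<omega> $ i * Z t \<omega> $ j \<partial>M) =
         cosh (lam * (\<bar>t - s\<bar> - T / 2)) / (2 * lam * sinh (lam * T / 2))
         * (if i = j then 1 else 0)) \<and>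
    (\<forall>b\<in>real_Linf. \<forall>t\<in>{0..T}.
       integrable M (\<lambda>\<omega>. b (Z t \<omega>)) \<and>
       has_trace (density_operator lam T \<circ> mult_operator b)
         (complex_of_real (\<integral>\<omega>. b (Z t \<omega>) \<partial>M)) \<and>
       (\<integral>\<omega>. b (Z t \<omega>) \<partial>M) =
         (2 * pi * osc_variance lam T) powr (- real CARD('d) / 2)
         * (\<integral>x. b x * exp (- (norm x)\<^sup>2 / (2 * osc_variance lam T)) \<partial>lebesgue))"
proof -
  interpret periodic_oscillator lam T M Z
    by (rule periodic_oscillator.intro) (rule assms)+
  let ?c = "(2 * pi * osc_variance lam T) powr (- real CARD('d) / 2)"
  have "measure M {\<omega> \<in> space M. Z t \<omega> \<in> F} = ?c * (LINT x:F|lborel. exp (- (norm x)\<^sup>2 / (2 * osc_variance lam T)))"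
    if "t \<in> {0..T}" "F \<in> sets borel" for t F
    using one_time_distribution[of t F] that unfolding marginal_def by simp
  moreover have "(\<integral>\<omega>. b (Z t \<omega>) \<partial>M) = ?c * (\<integral>x. b x * exp (- (norm x)\<^sup>2 / (2 * osc_variance lam T)) \<partial>lebesgue)"
    if "b \<in> real_Linf" "t \<in> {0..T}" for b t
  proof -
    have "(\<integral>\<omega>. b (Z t \<omega>) \<partial>M) = (\<integral>x. ?c * (b x * exp (- (norm x)\<^sup>2 / (2 * osc_variance lam T))) \<partial>lebesgue)"
      using expectation_bounded_observable(2)[of b t] that unfolding marginal_def by (simp add: mult.left_commute)
    then show ?thesis by simp
  qed
  moreover have "has_trace (density_operator lam T \<circ> mult_operator b) (complex_of_real (\<integral>\<omega>. b (Z t \<omega>) \<partial>M))"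
    if "b \<in> real_Linf" "t \<in> {0..T}" for b t
    using trace_density_operator[of b] expectation_bounded_observable(2)[of b t] that by simp
  ultimately show ?thesis
    using stationary not_markov gaussian covariance[unfolded green_def] expectation_bounded_observable(1)
    by auto
qed

end
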